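(* Let $\ell\ge5$ and assume that the simple objects of $\mathcal C_\ell$ are, up to isomorphism, exactly $L_i=L(\lambda_i)$, $0\le i\le\ell$. Then there is a canonical identification $$K_0(\mathcal C_\ell)=\bigoplus_{i=0}^{\ell}\mathbb Z[L_i],$$ i.e. the ordinary Grothendieck group of $\mathcal C_\ell$ is free abelian with basis $[L_0],\dots,[L_\ell]$.
   Context: $\mathfrak g$ is the simple complex Lie algebra of type $D_\ell$, $\ell\ge5$, with Cartan subalgebra $\mathfrak h$; $\widehat{\mathfrak g}^{e}=\mathfrak g[t,t^{-1}]\oplus\mathbb C K\oplus\mathbb C d$ is the affine Kac–Moody algebra with $[d,xt^n]=n\,xt^n$, $\widehat{\mathfrak h}=\mathfrak h\oplus\mathbb CK\oplus\mathbb Cd$. $\widehat W$ is its affine Weyl group, $\widehat\rho=h^\vee\Lambda_0+\rho$ with $h^\vee=2\ell-2$ and $\rho$ the half-sum of positive roots of $\mathfrak g$, $w\circ\lambda=w(\lambda+\widehat\rho)-\widehat\rho$, $\widehat Q_+$ is the set of $\mathbb Z_{\ge0}$-combinations of simple roots, and $L(\lambda)$ is the simple highest-weight module. $L_{-1}(D_\ell)$ is the simple affine vertex algebra at level $-1$; on its modules $d$ acts as $-L_0$ with $L_0$ the Sugawara operator. $\mathcal C_\ell$ is the category of $L_{-1}(D_\ell)$-modules $M$ whose underlying $\widehat{\mathfrak g}^e$-module has level $-1$, belongs to the linkage block of $-\Lambda_0$ (irreducible subquotients have highest weights in $\widehat W\circ(-\Lambda_0)$), and satisfies: (i) $M$ is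 the direct sum of its generalized $\widehat{\mathfrak h}$-weight spaces; (ii) each generalized weight space is finite dimensional; (iii) for each $\mu\in\widehat{\mathfrak h}^*$ only finitely many weights in $\mu+\widehat Q_+$ occur in $M$. The Kazhdan–Lusztig left cell $\mathbf c^L(s_0)$ of $\widehat W$ containing the affine simple reflection $s_0$ is known to consist of $\ell+1$ elements $w_0=s_0$ and $w_i=z_is_0$ ($1\le i\le\ell$) with $z_i$ in the finite Weyl group of $\mathfrak g$. Put $\mu_0=0$, $\mu_i=z_i\rho-\rho$, and $\lambda_i=w_i\circ(-\Lambda_0)=-\Lambda_0+\mu_i\in\widehat{\mathfrak h}^*$, where $\lambda_i(d)=0$. *)

theory Defs
  imports
    "HOL-Algebra.Free_Abelian_Groups"
    "HOL-Library.Product_Plus"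
    "HOL-Library.Groups_Big_Fun"
    "Jordan_Normal_Form.Matrix"
begin

section \<open>Complex vector spaces\<close>

text \<open>
  Every complex vector space with a basis indexed by (a subset of) \<open>'a\<close> is, up to isomorphism, a
  subspace of the space \<open>'a \<Rightarrow>\<^sub>0 complex\<close> of finitely supported functions. Vertex algebras and their
  modules are therefore carried by subspaces of such a space. The index type is a type variable
  throughout and bounds nothing but the dimension.
\<close>

type_synonym 'a cvec = "'a \<Rightarrow>\<^sub>0 complex"

definition smul :: "complex \<Rightarrow> 'a cvec \<Rightarrow> 'a cvec" where
  "smul c f = Poly_Mapping.map ((*) c) f"

lemma lookup_smul [simp]: "Poly_Mapping.lookup (smul c f) x = c * Poly_Mapping.lookup f x"
  by (simp add: smul_def Poly_Mapping.map.rep_eq when_def)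

interpretation cvec: vector_space smul
  by unfold_locales (auto intro!: poly_mapping_eqI simp: lookup_add algebra_simps)

definition linear_on :: "'a cvec set \<Rightarrow> ('a cvec \<Rightarrow> 'b cvec) \<Rightarrow> bool" where
  "linear_on S f \<longleftrightarrow>
     (\<forall>x\<in>S. \<forall>y\<in>S. f (x + y) = f x + f y) \<and> (\<forall>c. \<forall>x\<in>S. f (smul c x) = smul c (f x))"


section \<open>Vertex algebras and their modules\<close>

text \<open>\<open>nprod V a n b\<close> is the \<open>n\<close>-th product \<open>a\<^bsub>(n)\<^esub>b\<close>, where \<open>Y(a,z) = \<Sum>n. a\<^bsub>(n)\<^esub> z\<^sup>-\<^sup>n\<^sup>-\<^sup>1\<close>.\<close>

record 'v valg =
  vcarrier :: "'v cvec set"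
  vac :: "'v cvec"
  nprod :: "'v cvec \<Rightarrow> int \<Rightarrow> 'v cvec \<Rightarrow> 'v cvec"

record ('v, 'b) vmod =
  mcarrier :: "'b cvec set"
  mode :: "'v cvec \<Rightarrow> int \<Rightarrow> 'b cvec \<Rightarrow> 'b cvec"

text \<open>
  \<open>Y\<close> is a family of fields on \<open>M\<close>, indexed linearly by the elements of \<open>V\<close>, in which the vacuum
  acts as the identity and which satisfies the Borcherds identity. The sums over \<open>i\<close> have finite
  support by the truncation condition, and \<open>Sum_any\<close> is their value.
\<close>

definition fields_on ::
  "'v valg \<Rightarrow> 'b cvec set \<Rightarrow> ('v cvec \<Rightarrow> int \<Rightarrow> 'b cvec \<Rightarrow> 'b cvec) \<Rightarrow> bool" where
  "fields_on V M Y \<longleftrightarrow>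
     cvec.subspace M \<and>
     (\<forall>a\<in>vcarrier V. \<forall>n. \<forall>u\<in>M. Y a n u \<in> M) \<and>
     (\<forall>a\<in>vcarrier V. \<forall>n. linear_on M (Y a n)) \<and>
     (\<forall>n. \<forall>u\<in>M. linear_on (vcarrier V) (\<lambda>a. Y a n u)) \<and>
     (\<forall>a\<in>vcarrier V. \<forall>u\<in>M. \<exists>N. \<forall>n\<ge>N. Y a n u = 0) \<and>
     (\<forall>n. \<forall>u\<in>M. Y (vac V) n u = (if n = -1 then u else 0)) \<and>
     (\<forall>a\<in>vcarrier V. \<forall>b\<in>vcarrier V. \<forall>u\<in>M. \<forall>p q r.
        Sum_any (\<lambda>i. smul (of_int p gchoose i)
          (Y (nprod V a (r + int i) b) (p + q - int i) u)) =
        Sum_any (\<lambda>i. smul ((-1) ^ i * (of_int r gchoose i))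
          (Y a (p + r - int i) (Y b (q + int i) u)
           - smul ((-1) powi r) (Y b (q + r - int i) (Y a (p + int i) u)))))"

definition vertex_algebra :: "'v valg \<Rightarrow> bool" where
  "vertex_algebra V \<longleftrightarrow>
     vac V \<in> vcarrier V \<and>
     fields_on V (vcarrier V) (nprod V) \<and>
     (\<forall>a\<in>vcarrier V. nprod V a (-1) (vac V) = a \<and> (\<forall>n\<ge>0. nprod V a n (vac V) = 0))"

definition va_ideal :: "'v valg \<Rightarrow> 'v cvec set \<Rightarrow> bool" where
  "va_ideal V I \<longleftrightarrow> cvec.subspace I \<and> I \<subseteq> vcarrier V \<and>
     (\<forall>a\<in>vcarrier V. \<forall>b\<in>I. \<forall>n. nprod V a n b \<in> I \<and> nprod V b n a \<in> I)"

definition simple_va :: "'v valg \<Rightarrow> bool" where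
  "simple_va V \<longleftrightarrow> vcarrier V \<noteq> {0} \<and> (\<forall>I. va_ideal V I \<longrightarrow> I = {0} \<or> I = vcarrier V)"

definition va_generated_by :: "'v valg \<Rightarrow> 'v cvec set \<Rightarrow> bool" where
  "va_generated_by V X \<longleftrightarrow> X \<subseteq> vcarrier V \<and>
     (\<forall>U. cvec.subspace U \<and> U \<subseteq> vcarrier V \<and> vac V \<in> U \<and> X \<subseteq> U \<and>
        (\<forall>a\<in>U. \<forall>b\<in>U. \<forall>n. nprod V a n b \<in> U) \<longrightarrow> U = vcarrier V)"

definition va_module :: "'v valg \<Rightarrow> ('v, 'b) vmod \<Rightarrow> bool" where
  "va_module V M \<longleftrightarrow> fields_on V (mcarrier M) (mode M)"

definition va_submodule :: "'v valg \<Rightarrow> ('v, 'b) vmod \<Rightarrow> 'b cvec set \<Rightarrow> bool" where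
  "va_submodule V M N \<longleftrightarrow> cvec.subspace N \<and> N \<subseteq> mcarrier M \<and>
     (\<forall>a\<in>vcarrier V. \<forall>n. \<forall>u\<in>N. mode M a n u \<in> N)"

definition va_hom :: "'v valg \<Rightarrow> ('v, 'b) vmod \<Rightarrow> ('v, 'b) vmod \<Rightarrow> ('b cvec \<Rightarrow> 'b cvec) \<Rightarrow> bool" where
  "va_hom V M N f \<longleftrightarrow> f ` mcarrier M \<subseteq> mcarrier N \<and> linear_on (mcarrier M) f \<and>
     (\<forall>a\<in>vcarrier V. \<forall>n. \<forall>u\<in>mcarrier M. f (mode M a n u) = mode N a n (f u))"

definition va_isomorphic :: "'v valg \<Rightarrow> ('v, 'b) vmod \<Rightarrow> ('v, 'b) vmod \<Rightarrow> bool" where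
  "va_isomorphic V M N \<longleftrightarrow> (\<exists>f. va_hom V M N f \<and> bij_betw f (mcarrier M) (mcarrier N))"

definition short_exact ::
  "'v valg \<Rightarrow> ('v, 'b) vmod \<Rightarrow> ('v, 'b) vmod \<Rightarrow> ('v, 'b) vmod \<Rightarrow> bool" where
  "short_exact V M' M M'' \<longleftrightarrow> (\<exists>f g.
     va_hom V M' M f \<and> va_hom V M M'' g \<and>
     inj_on f (mcarrier M') \<and> g ` mcarrier M = mcarrier M'' \<and>
     f ` mcarrier M' = {u \<in> mcarrier M. g u = 0})"


section \<open>The Lie algebra of type \<open>D\<^sub>\<ell>\<close>\<close>

text \<open>
  \<open>\<gg>\<close> is realised as \<open>so(2\<ell>)\<close> with respect to the symmetric form pairing the basis vectors \<open>a\<close> and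
  \<open>a'\<close>, where \<open>a' = a \<plusminus> \<ell>\<close>. The Cartan subalgebra consists of the diagonal matrices
  \<open>diag(h\<^sub>0,\<dots>,h\<^bsub>\<ell>-1\<^esub>,-h\<^sub>0,\<dots>,-h\<^bsub>\<ell>-1\<^esub>)\<close>, and \<open>\<epsilon>\<^sub>j\<close> picks out \<open>h\<^sub>j\<close>; coordinates are counted from 0.
\<close>

definition dual_index :: "nat \<Rightarrow> nat \<Rightarrow> nat" where
  "dual_index l a = (if a < l then a + l else a - l)"

definition form_matrix :: "nat \<Rightarrow> complex mat" where
  "form_matrix l = mat (2*l) (2*l) (\<lambda>(a, b). if b = dual_index l a then 1 else 0)"

definition so_alg :: "nat \<Rightarrow> complex mat set" where
  "so_alg l = {A \<in> carrier_mat (2*l) (2*l).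
     transpose_mat A * form_matrix l + form_matrix l * A = 0\<^sub>m (2*l) (2*l)}"

definition lie :: "complex mat \<Rightarrow> complex mat \<Rightarrow> complex mat" where
  "lie A B = A * B - B * A"

text \<open>Half the trace form is the invariant form for which long roots have square length 2.\<close>

definition inv_form :: "nat \<Rightarrow> complex mat \<Rightarrow> complex mat \<Rightarrow> complex" where
  "inv_form l A B = (\<Sum>i<2*l. (A * B) $$ (i, i)) / 2"

definition cartan :: "nat \<Rightarrow> complex mat set" where
  "cartan l = {A \<in> so_alg l. diagonal_mat A}"

definition so_gen :: "nat \<Rightarrow> nat \<Rightarrow> nat \<Rightarrow> complex mat" where
  "so_gen l a b = mat (2*l) (2*l) (\<lambda>(i, j).
     (if i = a \<and> j = b then 1 else 0) -
     (if i = dual_index l b \<and> j = dual_index l a then 1 else 0))"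

definition dual_coxeter :: "nat \<Rightarrow> complex" where
  "dual_coxeter l = 2 * of_nat l - 2"


section \<open>Affine weights and the affine Weyl group\<close>

text \<open>\<open>(m, k, n)\<close> stands for \<open>\<Sum>j. m\<^sub>j \<epsilon>\<^sub>j + k \<Lambda>\<^sub>0 + n \<delta>\<close>, with \<open>\<Lambda>\<^sub>0(K) = \<delta>(d) = 1\<close>.\<close>

type_synonym weight = "(nat \<Rightarrow>\<^sub>0 complex) \<times> complex \<times> complex"

definition hdual :: "nat \<Rightarrow> weight set" where
  "hdual l = {(m, k, n). Poly_Mapping.keys m \<subseteq> {..<l}}"

definition wscale :: "complex \<Rightarrow> weight \<Rightarrow> weight" where
  "wscale c = (\<lambda>(m, k, n). (smul c m, c * k, c * n))"

definition eps :: "nat \<Rightarrow> weight" where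
  "eps j = (Poly_Mapping.single j 1, 0, 0)"

definition Lambda0 :: weight where
  "Lambda0 = (0, 1, 0)"

definition delta :: weight where
  "delta = (0, 0, 1)"

definition wform :: "nat \<Rightarrow> weight \<Rightarrow> weight \<Rightarrow> complex" where
  "wform l = (\<lambda>(m, k, n) (m', k', n').
     (\<Sum>j<l. Poly_Mapping.lookup m j * Poly_Mapping.lookup m' j) + k * n' + n * k')"

text \<open>The value of a weight at \<open>H + c K + e d\<close>.\<close>

definition weval :: "nat \<Rightarrow> weight \<Rightarrow> complex mat \<Rightarrow> complex \<Rightarrow> complex \<Rightarrow> complex" where
  "weval l = (\<lambda>(m, k, n) H c e.
     (\<Sum>j<l. Poly_Mapping.lookup m j * H $$ (j, j)) + k * c + n * e)"

definition pos_roots :: "nat \<Rightarrow> weight set" where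
  "pos_roots l = {eps i - eps j | i j. i < j \<and> j < l} \<union> {eps i + eps j | i j. i < j \<and> j < l}"

definition rho :: "nat \<Rightarrow> weight" where
  "rho l = wscale (1/2) (\<Sum>\<alpha>\<in>pos_roots l. \<alpha>)"

definition rho_hat :: "nat \<Rightarrow> weight" where
  "rho_hat l = wscale (dual_coxeter l) Lambda0 + rho l"

text \<open>The node 0 is the affine one; the highest root is \<open>\<epsilon>\<^sub>0 + \<epsilon>\<^sub>1\<close>.\<close>

definition simple_root :: "nat \<Rightarrow> nat \<Rightarrow> weight" where
  "simple_root l i =
     (if i = 0 then delta - (eps 0 + eps 1)
      else if i < l then eps (i - 1) - eps i
      else eps (l - 2) + eps (l - 1))"

definition Q_plus :: "nat \<Rightarrow> weight set" where
  "Q_plus l = {(\<Sum>i\<le>l. wscale (of_nat (c i)) (simple_root l i)) | c :: nat \<Rightarrow> nat. True}"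

definition srefl :: "nat \<Rightarrow> nat \<Rightarrow> weight \<Rightarrow> weight" where
  "srefl l i \<mu> =
     \<mu> - wscale (2 * wform l \<mu> (simple_root l i) / wform l (simple_root l i) (simple_root l i))
           (simple_root l i)"

definition word_elt :: "nat \<Rightarrow> nat list \<Rightarrow> weight \<Rightarrow> weight" where
  "word_elt l is = foldr (\<lambda>i f. srefl l i \<circ> f) is id"

definition W_aff :: "nat \<Rightarrow> (weight \<Rightarrow> weight) set" where
  "W_aff l = {word_elt l is | is. set is \<subseteq> {..l}}"

definition W_fin :: "nat \<Rightarrow> (weight \<Rightarrow> weight) set" where
  "W_fin l = {word_elt l is | is. set is \<subseteq> {1..l}}"

definition W_len :: "nat \<Rightarrow> (weight \<Rightarrow> weight) \<Rightarrow> nat" where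
  "W_len l w = (LEAST n. \<exists>is. set is \<subseteq> {..l} \<and> length is = n \<and> word_elt l is = w)"

definition dot :: "nat \<Rightarrow> (weight \<Rightarrow> weight) \<Rightarrow> weight \<Rightarrow> weight" where
  "dot l w \<mu> = w (\<mu> + rho_hat l) - rho_hat l"


section \<open>Kazhdan--Lusztig left cells\<close>

text \<open>
  The Hecke algebra of \<open>W_aff l\<close> over \<open>\<int>[v,v\<^sup>-\<^sup>1]\<close> in Soergel's normalisation: it has a basis \<open>H\<^sub>w\<close>
  with \<open>H\<^sub>s\<^sup>2 = 1 + (v\<^sup>-\<^sup>1 - v) H\<^sub>s\<close> and \<open>H\<^sub>x H\<^sub>y = H\<^bsub>xy\<^esub>\<close> if lengths add. In terms of the original
  one, \<open>q = v\<^sup>-\<^sup>2\<close> and \<open>H\<^sub>w = v\<^bsup>len(w)\<^esup> T\<^sub>w\<close>. An element is the family of its coefficients.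
\<close>

type_synonym laurent = "int \<Rightarrow>\<^sub>0 int"
type_synonym hecke = "(weight \<Rightarrow> weight) \<Rightarrow>\<^sub>0 laurent"

definition vpow :: "int \<Rightarrow> laurent" where
  "vpow n = Poly_Mapping.single n 1"

definition hscale :: "laurent \<Rightarrow> hecke \<Rightarrow> hecke" where
  "hscale a h = Poly_Mapping.map ((*) a) h"

definition hbasis :: "(weight \<Rightarrow> weight) \<Rightarrow> hecke" where
  "hbasis w = Poly_Mapping.single w 1"

text \<open>Left multiplication by \<open>H\<^sub>s\<close>, where \<open>s\<close> is the \<open>i\<close>-th simple reflection.\<close>

definition hecke_lmult :: "nat \<Rightarrow> nat \<Rightarrow> hecke \<Rightarrow> hecke" where
  "hecke_lmult l i h = (\<Sum>w\<in>Poly_Mapping.keys h. hscale (Poly_Mapping.lookup h w)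
     (if W_len l w < W_len l (srefl l i \<circ> w) then hbasis (srefl l i \<circ> w)
      else hbasis (srefl l i \<circ> w) + hscale (vpow (-1) - vpow 1) (hbasis w)))"

text \<open>
  The bar involution sends \<open>v\<close> to \<open>v\<^sup>-\<^sup>1\<close> and \<open>H\<^sub>w\<close> to the inverse of \<open>H\<^bsub>w\<^sup>-\<^sup>1\<^esub>\<close>, which is the product of
  the \<open>H\<^sub>s\<^sup>-\<^sup>1 = H\<^sub>s + (v - v\<^sup>-\<^sup>1)\<close> along any reduced word of \<open>w\<close>.
\<close>

definition reduced_word :: "nat \<Rightarrow> (weight \<Rightarrow> weight) \<Rightarrow> nat list" where
  "reduced_word l w = (SOME is. set is \<subseteq> {..l} \<and> length is = W_len l w \<and> word_elt l is = w)"

definition bar_basis :: "nat \<Rightarrow> (weight \<Rightarrow> weight) \<Rightarrow> hecke" where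
  "bar_basis l w =
     foldr (\<lambda>i h. hecke_lmult l i h + hscale (vpow 1 - vpow (-1)) h) (reduced_word l w) (hbasis id)"

definition bar_laurent :: "laurent \<Rightarrow> laurent" where
  "bar_laurent a = Poly_Mapping.map_key uminus a"

definition hecke_bar :: "nat \<Rightarrow> hecke \<Rightarrow> hecke" where
  "hecke_bar l h =
     (\<Sum>w\<in>Poly_Mapping.keys h. hscale (bar_laurent (Poly_Mapping.lookup h w)) (bar_basis l w))"

text \<open>
  The Kazhdan--Lusztig basis element of \<open>w\<close> is the unique self-dual element of
  \<open>H\<^sub>w + (\<Sum>y. v \<int>[v] H\<^sub>y)\<close>.
\<close>

definition KL_basis :: "nat \<Rightarrow> (weight \<Rightarrow> weight) \<Rightarrow> hecke" where
  "KL_basis l w = (THE h. Poly_Mapping.keys h \<subseteq> W_aff l \<and> hecke_bar l h = h \<and>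
     Poly_Mapping.lookup h w = 1 \<and>
     (\<forall>y. y \<noteq> w \<longrightarrow> Poly_Mapping.keys (Poly_Mapping.lookup h y) \<subseteq> {1..}))"

text \<open>
  \<open>left_step l x y\<close>: the basis element of \<open>x\<close> occurs in \<open>(H\<^sub>s + v)\<close> times the one of \<open>y\<close> for some
  simple reflection \<open>s\<close>. Note that \<open>H\<^sub>s + v\<close> is itself the basis element of \<open>s\<close>.
\<close>

definition left_step :: "nat \<Rightarrow> (weight \<Rightarrow> weight) \<Rightarrow> (weight \<Rightarrow> weight) \<Rightarrow> bool" where
  "left_step l x y \<longleftrightarrow> (\<exists>i\<le>l. \<exists>c :: hecke.
     Poly_Mapping.keys c \<subseteq> W_aff l \<and> x \<in> Poly_Mapping.keys c \<and>
     hecke_lmult l i (KL_basis l y) + hscale (vpow 1) (KL_basis l y) =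
       (\<Sum>z\<in>Poly_Mapping.keys c. hscale (Poly_Mapping.lookup c z) (KL_basis l z)))"

definition left_cell :: "nat \<Rightarrow> (weight \<Rightarrow> weight) \<Rightarrow> (weight \<Rightarrow> weight) set" where
  "left_cell l y = {x \<in> W_aff l. (left_step l)\<^sup>*\<^sup>* x y \<and> (left_step l)\<^sup>*\<^sup>* y x}"


section \<open>Simple affine vertex algebras and the affine action\<close>

text \<open>
  \<open>V\<close>, with currents \<open>J x\<close> for \<open>x \<in> \<gg>\<close>, is the simple affine vertex algebra \<open>L\<^sub>k(\<gg>)\<close>. By the universal
  property of \<open>V\<^sup>k(\<gg>)\<close>, the vertex algebras generated by currents with the operator products
  \<open>J x (z) J y (w) \<sim> k (x,y) (z-w)\<^sup>-\<^sup>2 + J [x,y] (w) (z-w)\<^sup>-\<^sup>1\<close> are exactly its quotients.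
\<close>

definition simple_affine_va ::
  "nat \<Rightarrow> complex \<Rightarrow> 'v valg \<Rightarrow> (complex mat \<Rightarrow> 'v cvec) \<Rightarrow> bool" where
  "simple_affine_va l k V J \<longleftrightarrow>
     vertex_algebra V \<and> simple_va V \<and> va_generated_by V (J ` so_alg l) \<and>
     (\<forall>x\<in>so_alg l. \<forall>y\<in>so_alg l. J (x + y) = J x + J y) \<and>
     (\<forall>c. \<forall>x\<in>so_alg l. J (c \<cdot>\<^sub>m x) = smul c (J x)) \<and>
     (\<forall>x\<in>so_alg l. \<forall>y\<in>so_alg l.
        nprod V (J x) 0 (J y) = J (lie x y) \<and>
        nprod V (J x) 1 (J y) = smul (k * inv_form l x y) (vac V) \<and>
        (\<forall>n\<ge>2. nprod V (J x) n (J y) = 0))"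

text \<open>
  Sugawara vector. With \<open>F\<^bsub>ab\<^esub>\<close> for \<open>so_gen l a b\<close>, one has \<open>F\<^bsub>b'a'\<^esub> = -F\<^bsub>ab\<^esub>\<close>, and \<open>F\<^bsub>ab\<^esub>\<close> (one for each
  pair \<open>{(a,b),(b',a')}\<close> with \<open>b \<noteq> a'\<close>) form a basis of \<open>\<gg>\<close> with dual basis \<open>F\<^bsub>ba\<^esub>\<close>. Since \<open>F\<^bsub>aa'\<^esub> = 0\<close>,
  the sum over all \<open>a, b\<close> is twice the sum over dual bases.
\<close>

definition sugawara ::
  "nat \<Rightarrow> complex \<Rightarrow> 'v valg \<Rightarrow> (complex mat \<Rightarrow> 'v cvec) \<Rightarrow> 'v cvec" where
  "sugawara l k V J = smul (1 / (2 * (k + dual_coxeter l))) (smul (1/2)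
     (\<Sum>a<2*l. \<Sum>b<2*l. nprod V (J (so_gen l a b)) (-1) (J (so_gen l b a))))"

text \<open>
  The elements \<open>x t\<^sup>n\<close>, \<open>K\<close> and \<open>d\<close> span the affine Kac--Moody algebra. On an \<open>L\<^sub>k(\<gg>)\<close>-module, \<open>x t\<^sup>n\<close>
  acts as \<open>(J x)\<^bsub>(n)\<^esub>\<close>, \<open>K\<close> as \<open>k\<close> and \<open>d\<close> as \<open>-L\<^sub>0 = -\<omega>\<^bsub>(1)\<^esub>\<close>.
\<close>

datatype affine = Loop "complex mat" int | Central | Deriv

definition affine_span :: "nat \<Rightarrow> affine set" where
  "affine_span l = {Loop x n | x n. x \<in> so_alg l} \<union> {Central, Deriv}"

fun act :: "nat \<Rightarrow> complex \<Rightarrow> 'v valg \<Rightarrow> (complex mat \<Rightarrow> 'v cvec) \<Rightarrow> ('v, 'b) vmod \<Rightarrow>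
    affine \<Rightarrow> 'b cvec \<Rightarrow> 'b cvec" where
  "act l k V J M (Loop x n) u = mode M (J x) n u"
| "act l k V J M Central u = smul k u"
| "act l k V J M Deriv u = - mode M (sugawara l k V J) 1 u"

text \<open>The action of \<open>H + c K + e d\<close>.\<close>

definition act_h :: "nat \<Rightarrow> complex \<Rightarrow> 'v valg \<Rightarrow> (complex mat \<Rightarrow> 'v cvec) \<Rightarrow> ('v, 'b) vmod \<Rightarrow>
    complex mat \<Rightarrow> complex \<Rightarrow> complex \<Rightarrow> 'b cvec \<Rightarrow> 'b cvec" where
  "act_h l k V J M H c e u =
     act l k V J M (Loop H 0) u + smul c (act l k V J M Central u) + smul e (act l k V J M Deriv u)"

definition affine_submodule :: "nat \<Rightarrow> complex \<Rightarrow> 'v valg \<Rightarrow> (complex mat \<Rightarrow> 'v cvec) \<Rightarrow>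
    ('v, 'b) vmod \<Rightarrow> 'b cvec set \<Rightarrow> bool" where
  "affine_submodule l k V J M N \<longleftrightarrow> cvec.subspace N \<and> N \<subseteq> mcarrier M \<and>
     (\<forall>X\<in>affine_span l. \<forall>u\<in>N. act l k V J M X u \<in> N)"

definition irreducible_subquotient :: "nat \<Rightarrow> complex \<Rightarrow> 'v valg \<Rightarrow> (complex mat \<Rightarrow> 'v cvec) \<Rightarrow>
    ('v, 'b) vmod \<Rightarrow> 'b cvec set \<Rightarrow> 'b cvec set \<Rightarrow> bool" where
  "irreducible_subquotient l k V J M N N' \<longleftrightarrow>
     affine_submodule l k V J M N \<and> affine_submodule l k V J M N' \<and> N' \<subset> N \<and>
     (\<forall>P. affine_submodule l k V J M P \<and> N' \<subseteq> P \<and> P \<subseteq> N \<longrightarrow> P = N' \<or> P = N)"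

definition root_space :: "nat \<Rightarrow> weight \<Rightarrow> complex mat set" where
  "root_space l \<alpha> = {x \<in> so_alg l. \<forall>H\<in>cartan l. lie H x = weval l \<alpha> H 0 0 \<cdot>\<^sub>m x}"

text \<open>
  \<open>u\<close> represents a highest-weight vector of weight \<open>\<mu>\<close> in the quotient by the submodule \<open>N'\<close>. The
  nilradical of the standard Borel subalgebra is \<open>\<nn>\<^sub>+ + t \<gg>[t]\<close>.
\<close>

definition hw_vector_mod :: "nat \<Rightarrow> complex \<Rightarrow> 'v valg \<Rightarrow> (complex mat \<Rightarrow> 'v cvec) \<Rightarrow>
    ('v, 'b) vmod \<Rightarrow> 'b cvec set \<Rightarrow> weight \<Rightarrow> 'b cvec \<Rightarrow> bool" where
  "hw_vector_mod l k V J M N' \<mu> u \<longleftrightarrow> u \<notin> N' \<and>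
     (\<forall>\<alpha>\<in>pos_roots l. \<forall>x\<in>root_space l \<alpha>. act l k V J M (Loop x 0) u \<in> N') \<and>
     (\<forall>x\<in>so_alg l. \<forall>n>0. act l k V J M (Loop x n) u \<in> N') \<and>
     (\<forall>H\<in>cartan l. \<forall>c e. act_h l k V J M H c e u - smul (weval l \<mu> H c e) u \<in> N')"

text \<open>The subquotient \<open>N / N'\<close> is isomorphic to \<open>L(\<mu>)\<close>.\<close>

definition simple_hw_subquotient :: "nat \<Rightarrow> complex \<Rightarrow> 'v valg \<Rightarrow> (complex mat \<Rightarrow> 'v cvec) \<Rightarrow>
    ('v, 'b) vmod \<Rightarrow> 'b cvec set \<Rightarrow> 'b cvec set \<Rightarrow> weight \<Rightarrow> bool" where
  "simple_hw_subquotient l k V J M N N' \<mu> \<longleftrightarrow>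
     irreducible_subquotient l k V J M N N' \<and> (\<exists>u\<in>N. hw_vector_mod l k V J M N' \<mu> u)"

definition is_simple_hw_module :: "nat \<Rightarrow> complex \<Rightarrow> 'v valg \<Rightarrow> (complex mat \<Rightarrow> 'v cvec) \<Rightarrow>
    ('v, 'b) vmod \<Rightarrow> weight \<Rightarrow> bool" where
  "is_simple_hw_module l k V J M \<mu> \<longleftrightarrow> simple_hw_subquotient l k V J M (mcarrier M) {0} \<mu>"

definition gen_weight_space :: "nat \<Rightarrow> complex \<Rightarrow> 'v valg \<Rightarrow> (complex mat \<Rightarrow> 'v cvec) \<Rightarrow>
    ('v, 'b) vmod \<Rightarrow> weight \<Rightarrow> 'b cvec set" where
  "gen_weight_space l k V J M \<mu> = {u \<in> mcarrier M. \<forall>H\<in>cartan l. \<forall>c e.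
     \<exists>N::nat. ((\<lambda>u. act_h l k V J M H c e u - smul (weval l \<mu> H c e) u) ^^ N) u = 0}"


section \<open>The category and its Grothendieck group\<close>

text \<open>Objects of the category \<open>\<C>\<^sub>\<ell>\<close>; it is a full subcategory of the \<open>V\<close>-modules.\<close>

definition cat_C :: "nat \<Rightarrow> 'v valg \<Rightarrow> (complex mat \<Rightarrow> 'v cvec) \<Rightarrow> ('v, 'b) vmod set" where
  "cat_C l V J = {M.
     va_module V M \<and>
     (\<forall>u\<in>mcarrier M. act l (-1) V J M Central u = - u) \<and>
     (\<forall>N N'. irreducible_subquotient l (-1) V J M N N' \<longrightarrow>
        (\<exists>w\<in>W_aff l. simple_hw_subquotient l (-1) V J M N N' (dot l w (- Lambda0)))) \<and>
     (\<forall>u\<in>mcarrier M. \<exists>!f :: weight \<Rightarrow>\<^sub>0 'b cvec.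
        Poly_Mapping.keys f \<subseteq> hdual l \<and>
        (\<forall>\<mu>\<in>hdual l. Poly_Mapping.lookup f \<mu> \<in> gen_weight_space l (-1) V J M \<mu>) \<and>
        u = (\<Sum>\<mu>\<in>Poly_Mapping.keys f. Poly_Mapping.lookup f \<mu>)) \<and>
     (\<forall>\<mu>\<in>hdual l. \<exists>B. finite B \<and> gen_weight_space l (-1) V J M \<mu> \<subseteq> cvec.span B) \<and>
     (\<forall>\<mu>\<in>hdual l. finite {\<nu>. \<nu> - \<mu> \<in> Q_plus l \<and> gen_weight_space l (-1) V J M \<nu> \<noteq> {0}})}"

definition simple_object :: "'v valg \<Rightarrow> ('v, 'b) vmod set \<Rightarrow> ('v, 'b) vmod \<Rightarrow> bool" where
  "simple_object V Ob M \<longleftrightarrow> M \<in> Ob \<and> mcarrier M \<noteq> {0} \<and>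
     (\<forall>N. va_submodule V M N \<and> M\<lparr>mcarrier := N\<rparr> \<in> Ob \<longrightarrow> N = {0} \<or> N = mcarrier M)"

text \<open>
  The Grothendieck group is generated by the objects, with a relation for every short exact sequence.
  Isomorphic objects are identified by the relations for sequences with a zero term.
\<close>

definition K0_relations :: "'v valg \<Rightarrow> ('v, 'b) vmod set \<Rightarrow> (('v, 'b) vmod \<Rightarrow>\<^sub>0 int) set" where
  "K0_relations V Ob = generate (free_Abelian_group Ob)
     {frag_of M - frag_of M' - frag_of M'' | M' M M''.
        M' \<in> Ob \<and> M \<in> Ob \<and> M'' \<in> Ob \<and> short_exact V M' M M''}"

definition K0 :: "'v valg \<Rightarrow> ('v, 'b) vmod set \<Rightarrow> (('v, 'b) vmod \<Rightarrow>\<^sub>0 int) set monoid" where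
  "K0 V Ob = free_Abelian_group Ob Mod K0_relations V Ob"

definition K0_class ::
  "'v valg \<Rightarrow> ('v, 'b) vmod set \<Rightarrow> ('v, 'b) vmod \<Rightarrow> (('v, 'b) vmod \<Rightarrow>\<^sub>0 int) set" where
  "K0_class V Ob M = K0_relations V Ob #>\<^bsub>free_Abelian_group Ob\<^esub> frag_of M"

end

(*
  The dimension of a generalised weight space is additive on short exact sequences, so it defines a
  homomorphism from the Grothendieck group to the integers. The weights of L(lambda_j) other than
  lambda_j are lower than lambda_j, and the lambda_i are pairwise distinct: the reflection s_0 fixes
  -Lambda_0 + rho_hat, and the finite Weyl group acts freely on rho. Hence the matrix of the
  dimensions of L(lambda_j) at lambda_i is triangular with nonzero diagonal, and the classes are
  independent.

  They generate because every object has finite length. A nonzero object has, by Zorn's lemma, a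
  simple subquotient; the category is closed under submodules and quotients, so this is some
  L(lambda_i). Therefore the sum of the dimensions at lambda_0, ..., lambda_l is positive on nonzero
  objects, and it drops when an object is split into a proper submodule and its quotient.

  The definition of the category speaks about submodules for the affine Lie algebra. They are the
  submodules for the vertex algebra, since V is generated by currents. That L_0 is a grading operator
  on the currents is the Sugawara computation.
*)
theory Submission
  imports Defs "HOL-Combinatorics.Permutations"
begin

text \<open>Modules live in coordinate spaces of one fixed type, so a quotient M/N has to be found
  inside the space of M: it is the image of a projection that kills N, with every mode followed by
  that projection. Weight spaces are only generalised, so the Cartan operators need not be
  diagonalisable on an object. Eigenspace arguments are replaced by the remark that a single Cartan
  element separates finitely many weights; each statement on weights then concerns one operator and
  its generalised eigenvectors. The bound on the weights of a simple highest-weight module rests on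
  one grading element, whose eigenvalue drops by a positive integer under each lowering operator.
  Its coefficient 2l + 1 at d is chosen above 2l, the largest difference of its diagonal entries.
  Triangularity is ordered by the real parts of these eigenvalues. At level -1 the Sugawara
  denominator is, up to a constant, 2l - 3, which is odd and hence nonzero.\<close>

interpretation cvec_pair: vector_space_pair
    "smul :: complex \<Rightarrow> 'a cvec \<Rightarrow> 'a cvec" "smul :: complex \<Rightarrow> 'b cvec \<Rightarrow> 'b cvec"
  by unfold_locales

section \<open>Linear maps on subspaces\<close>

lemma linear_on_add: "linear_on S f \<Longrightarrow> x \<in> S \<Longrightarrow> y \<in> S \<Longrightarrow> f (x + y) = f x + f y"
  and linear_on_smul: "linear_on S f \<Longrightarrow> x \<in> S \<Longrightarrow> f (smul c x) = smul c (f x)"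
  by (auto simp: linear_on_def)

lemma linear_on_zero: "linear_on S f \<Longrightarrow> cvec.subspace S \<Longrightarrow> f 0 = 0"
  using linear_on_smul[of S f 0 0] by (simp add: cvec.subspace_0)

lemma linear_on_minus:
  assumes "linear_on S f" "x \<in> S" shows "f (- x) = - f x"
  using linear_on_smul[OF assms, of "-1"] by (simp add: cvec.scale_minus_left)

lemma linear_on_diff:
  assumes "linear_on S f" "cvec.subspace S" "x \<in> S" "y \<in> S"
  shows "f (x - y) = f x - f y"
  using linear_on_add[OF assms(1), of x "- y"] linear_on_minus[OF assms(1), of y] assms
  by (simp add: cvec.subspace_neg)

lemma linear_on_sum:
  assumes "linear_on S f" "cvec.subspace S" "\<And>i. i \<in> I \<Longrightarrow> g i \<in> S"
  shows "f (\<Sum>i\<in>I. g i) = (\<Sum>i\<in>I. f (g i))"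
proof (cases "finite I")
  case True
  then show ?thesis using assms(3)
    by (induction I)
      (auto simp: linear_on_zero[OF assms(1,2)] linear_on_add[OF assms(1)] cvec.subspace_sum[OF assms(2)])
qed (simp add: linear_on_zero[OF assms(1,2)])

lemma linear_on_combination:
  assumes "linear_on S f" "cvec.subspace S" "\<And>i. i \<in> I \<Longrightarrow> g i \<in> S"
  shows "f (\<Sum>i\<in>I. smul (c i) (g i)) = (\<Sum>i\<in>I. smul (c i) (f (g i)))"
proof -
  have "f (\<Sum>i\<in>I. smul (c i) (g i)) = (\<Sum>i\<in>I. f (smul (c i) (g i)))"
    using assms by (intro linear_on_sum cvec.subspace_scale)
  then show ?thesis using assms by (simp add: linear_on_smul)
qed

lemma linear_on_subset: "linear_on S f \<Longrightarrow> T \<subseteq> S \<Longrightarrow> linear_on T f"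
  unfolding linear_on_def by blast

lemma linear_on_linear: "Vector_Spaces.linear smul smul f \<Longrightarrow> linear_on S f"
  by (simp add: linear_on_def cvec_pair.linear_add cvec_pair.linear_scale)

lemma subspace_linear_image:
  assumes "cvec.subspace S" "linear_on S f"
  shows "cvec.subspace (f ` S)"
proof -
  have "\<exists>z\<in>S. f x + f y = f z" if "x \<in> S" "y \<in> S" for x y
    using that assms by (intro bexI[of _ "x + y"]) (auto simp: linear_on_add cvec.subspace_add)
  moreover have "\<exists>z\<in>S. smul c (f x) = f z" if "x \<in> S" for c x
    using that assms by (intro bexI[of _ "smul c x"]) (auto simp: linear_on_smul cvec.subspace_scale)
  moreover have "0 \<in> f ` S"
    using linear_on_zero[OF assms(2,1)] cvec.subspace_0[OF assms(1)] by force
  ultimately show ?thesis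
    by (auto simp: cvec.subspace_def image_iff)
qed

lemma subspace_linear_vimage:
  assumes "cvec.subspace S" "linear_on S f" "cvec.subspace T"
  shows "cvec.subspace {x \<in> S. f x \<in> T}"
  using assms linear_on_zero[OF assms(2,1)]
  by (auto simp: cvec.subspace_def linear_on_add linear_on_smul)

section \<open>Bases, complements and rank-nullity\<close>

lemma subspace_basis:
  assumes "cvec.subspace S"
  obtains B where "B \<subseteq> S" "cvec.independent B" "cvec.span B = S"
proof -
  obtain B where "B \<subseteq> S" "cvec.independent B" "S \<subseteq> cvec.span B"
    using cvec.maximal_independent_subset .
  then show thesis using that cvec.span_minimal[OF _ assms] by (simp add: subset_antisym)
qed

lemma subspace_basis_extend:
  assumes "cvec.subspace S" "B \<subseteq> S" "cvec.independent B"
  obtains C where "B \<subseteq> C" "C \<subseteq> S" "cvec.independent C" "cvec.span C = S"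
proof -
  obtain C where "B \<subseteq> C" "C \<subseteq> S" "cvec.independent C" "S \<subseteq> cvec.span C"
    using cvec.maximal_independent_subset_extend[OF assms(2,3)] .
  then show thesis using that cvec.span_minimal[OF _ assms(1)] by (simp add: subset_antisym)
qed

text \<open>Maps between modules are linear on the carrier and arbitrary elsewhere. Replacing them
  by global linear maps makes facts on spans and independent sets applicable.\<close>

lemma linear_on_extend:
  assumes "cvec.subspace S" "linear_on S f"
  obtains g where "Vector_Spaces.linear smul smul g" "\<And>x. x \<in> S \<Longrightarrow> g x = f x"
proof -
  obtain B where B: "B \<subseteq> S" "cvec.independent B" "cvec.span B = S"
    using subspace_basis[OF assms(1)] .
  obtain g where g: "Vector_Spaces.linear smul smul g" "\<And>x. x \<in> B \<Longrightarrow> g x = f x"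
    using cvec_pair.linear_independent_extend[OF B(2), of f] by blast
  have "x \<in> S \<and> g x = f x" if "x \<in> cvec.span B" for x
    using that
  proof (induction rule: cvec.span_induct_alt)
    case base
    show ?case
      using assms g by (simp add: cvec.subspace_0 cvec_pair.linear_0 linear_on_zero)
  next
    case (step c x y)
    then show ?case using B(1) assms g
      by (auto simp: cvec.subspace_add cvec.subspace_scale cvec_pair.linear_add
          cvec_pair.linear_scale linear_on_add linear_on_smul)
  qed
  then show thesis using that g B by auto
qed

text \<open>A basis of N is extended to one of M; p kills the old basis vectors and fixes the new
  ones. Its image is a complement of N, which serves as M/N without leaving the coordinate
  type.\<close>

lemma exists_projection:
  assumes "cvec.subspace M" "cvec.subspace N" "N \<subseteq> M"
  obtains p where "Vector_Spaces.linear smul smul p" "p ` M \<subseteq> M"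
    "\<And>x. x \<in> M \<Longrightarrow> p x = 0 \<longleftrightarrow> x \<in> N" "\<And>x. x \<in> M \<Longrightarrow> x - p x \<in> N"
proof -
  obtain B where B: "B \<subseteq> N" "cvec.independent B" "cvec.span B = N"
    using subspace_basis[OF assms(2)] .
  obtain C where C: "B \<subseteq> C" "C \<subseteq> M" "cvec.independent C" "cvec.span C = M"
    using subspace_basis_extend[OF assms(1) _ B(2)] B assms(3) by (metis subset_trans)
  obtain p where p: "Vector_Spaces.linear smul smul p"
    "\<And>x. x \<in> C \<Longrightarrow> p x = (if x \<in> B then 0 else x)"
    using cvec_pair.linear_independent_extend[OF C(3), of "\<lambda>x. if x \<in> B then 0 else x"] by blast
  have sub: "x - p x \<in> N" if "x \<in> cvec.span C" for x
    using that
  proof (induction rule: cvec.span_induct_alt)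
    case base
    show ?case using p assms by (simp add: cvec_pair.linear_0 cvec.subspace_0)
  next
    case (step c x y)
    have "x - p x \<in> N" using step p B assms by (auto simp: cvec.subspace_0)
    then have "smul c (x - p x) + (y - p y) \<in> N"
      using step assms by (auto intro!: cvec.subspace_add cvec.subspace_scale)
    then show ?case using p
      by (simp add: cvec_pair.linear_add cvec_pair.linear_scale cvec.scale_right_diff_distrib algebra_simps)
  qed
  have ker: "p x = 0" if "x \<in> cvec.span B" for x
    using that
  proof (induction rule: cvec.span_induct_alt)
    case base
    show ?case using p by (simp add: cvec_pair.linear_0)
  next
    case (step c x y)
    then show ?case using p C by (auto simp: cvec_pair.linear_add cvec_pair.linear_scale)
  qed
  show thesis
  proof (rule that[OF p(1)])
    show "x - p x \<in> N" if "x \<in> M" for x using sub that C by simp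
    then show "p x = 0 \<longleftrightarrow> x \<in> N" if "x \<in> M" for x
      using ker that B by (metis diff_zero)
    show "p ` M \<subseteq> M"
    proof (rule image_subsetI)
      fix x assume x: "x \<in> M"
      then have "x - (x - p x) \<in> M"
        using sub[of x] C(4) assms(1,3) cvec.subspace_diff[of M x "x - p x"] by auto
      then show "p x \<in> M" by simp
    qed
  qed
qed

text \<open>A basis B of the kernel is extended to a basis C of S, and the added vectors
  \<open>C - B\<close> are mapped injectively to a basis of the image. The set F ensures that C is
  finite.\<close>

lemma dim_rank_nullity:
  assumes S: "cvec.subspace S" "finite F" "S \<subseteq> cvec.span F" and f: "linear_on S f"
  shows "cvec.dim S = cvec.dim {x \<in> S. f x = 0} + cvec.dim (f ` S)"
proof -
  define K where "K = {x \<in> S. f x = 0}"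
  have K: "cvec.subspace K" "K \<subseteq> S"
    using subspace_linear_vimage[OF S(1) f, of "{0}"] by (auto simp: K_def)
  obtain B where B: "B \<subseteq> K" "cvec.independent B" "cvec.span B = K"
    using subspace_basis[OF K(1)] .
  obtain C where C: "B \<subseteq> C" "C \<subseteq> S" "cvec.independent C" "cvec.span C = S"
    using subspace_basis_extend[OF S(1) _ B(2)] B K by (metis subset_trans)
  obtain g where g: "Vector_Spaces.linear smul smul g" "\<And>x. x \<in> S \<Longrightarrow> g x = f x"
    using linear_on_extend[OF S(1) f] by blast
  have fin: "finite C"
    using cvec.independent_span_bound[OF S(2) C(3)] C S by auto
  have D: "cvec.independent (C - B)"
    using C(3) cvec.dependent_mono by blast
  have "inj_on g (cvec.span (C - B))"
  proof (subst cvec_pair.linear_inj_on_iff_eq_0[OF g(1) cvec.subspace_span], intro ballI impI)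
    fix x assume x: "x \<in> cvec.span (C - B)" and gx: "g x = 0"
    have "x \<in> S" using x C cvec.span_mono[of "C - B" C] by auto
    then have xB: "x \<in> cvec.span B" using gx g B by (simp add: K_def)
    \<comment> \<open>x lies in the spans of the disjoint sets B and \<open>C - B\<close>, so its
      coordinates over C are supported in both sets and vanish.\<close>
    have "cvec.representation C x = cvec.representation B x"
      "cvec.representation C x = cvec.representation (C - B) x"
      using cvec.representation_extend[OF C(3) xB C(1)]
        cvec.representation_extend[OF C(3) x] by auto
    then have "cvec.representation C x b = 0" for b
      by (metis cvec.representation_ne_zero DiffD2)
    moreover have "(\<Sum>b | cvec.representation C x b \<noteq> 0. smul (cvec.representation C x b) b) = x"
      using \<open>x \<in> S\<close> C by (intro cvec.sum_nonzero_representation_eq) auto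
    ultimately show "x = 0" by simp
  qed
  then have ind: "cvec.independent (g ` (C - B))" and inj: "inj_on g (C - B)"
    using cvec_pair.linear_independent_injective_image[OF g(1) D]
    by (auto intro: inj_on_subset[OF _ cvec.span_superset])
  have "f ` S = g ` cvec.span C" using g C by auto
  also have "\<dots> = cvec.span (g ` C)" by (rule cvec_pair.linear_span_image[OF g(1), symmetric])
  also have "\<dots> = cvec.span (g ` (C - B))"
  proof -
    have "g ` B \<subseteq> {0}" using g B K by (auto simp: K_def)
    then have "g ` C \<subseteq> insert 0 (g ` (C - B))" by auto
    then have "cvec.span (g ` C) \<subseteq> cvec.span (insert 0 (g ` (C - B)))"
      by (rule cvec.span_mono)
    then show ?thesis
      using cvec.span_mono[of "g ` (C - B)" "g ` C"] by auto
  qed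
  finally have "cvec.dim (f ` S) = card (C - B)"
    using cvec.dim_span_eq_card_independent[OF ind] card_image[OF inj] by simp
  moreover have "cvec.dim S = card C" "cvec.dim K = card B"
    using cvec.dim_span_eq_card_independent C B by auto
  ultimately show ?thesis
    using card_Diff_subset[of B C] card_mono[OF fin C(1)] C(1) fin
    by (auto simp: K_def[symmetric] finite_subset)
qed

lemma dim_linear_image_inj:
  assumes S: "cvec.subspace S" "finite F" "S \<subseteq> cvec.span F" and f: "linear_on S f" "inj_on f S"
  shows "cvec.dim (f ` S) = cvec.dim S"
proof -
  have "{x \<in> S. f x = 0} = {0}"
    using f(2) linear_on_zero[OF f(1) S(1)] cvec.subspace_0[OF S(1)] by (auto simp: inj_on_def)
  moreover have "cvec.dim {0 :: 'a cvec} = 0"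
    using cvec.dim_le_card[of "{0 :: 'a cvec}" "{}"] by simp
  ultimately show ?thesis
    using dim_rank_nullity[OF S f(1)] by simp
qed

lemma dim_pos:
  assumes "cvec.subspace S" "finite F" "S \<subseteq> cvec.span F" "S \<noteq> {0}"
  shows "cvec.dim S > 0"
proof -
  obtain B where B: "B \<subseteq> S" "cvec.independent B" "cvec.span B = S"
    using subspace_basis[OF assms(1)] .
  then have "finite B" "B \<noteq> {}"
    using cvec.independent_span_bound[OF assms(2) B(2)] assms by auto
  then show ?thesis
    using cvec.dim_span_eq_card_independent[OF B(2)] B by (simp add: card_gt_0_iff)
qed

section \<open>Generalised eigenvectors\<close>

text \<open>The exponent may depend on the vector. Exponent 0 admits the zero vector alone, which
  thus belongs to every a.\<close>

definition gen_eigenvector :: "('a cvec \<Rightarrow> 'a cvec) \<Rightarrow> complex \<Rightarrow> 'a cvec \<Rightarrow> bool" where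
  "gen_eigenvector T a x \<longleftrightarrow> (\<exists>n::nat. ((\<lambda>u. T u - smul a u) ^^ n) x = 0)"

text \<open>T stands for the action of one Cartan element on a module. Modes are total functions, so
  linearity is asked on the carrier M only.\<close>

locale invariant_subspace =
  fixes M :: "'a cvec set" and T :: "'a cvec \<Rightarrow> 'a cvec"
  assumes sub: "cvec.subspace M" and lin: "linear_on M T" and inv: "x \<in> M \<Longrightarrow> T x \<in> M"
begin

abbreviation shift :: "complex \<Rightarrow> 'a cvec \<Rightarrow> 'a cvec" where
  "shift a \<equiv> \<lambda>u. T u - smul a u"

lemma shift_in: "x \<in> M \<Longrightarrow> shift a x \<in> M"
  using sub inv by (simp add: cvec.subspace_diff cvec.subspace_scale)

lemma shift_pow_in: "x \<in> M \<Longrightarrow> (shift a ^^ n) x \<in> M"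
  by (induction n) (auto intro: shift_in)

lemma linear_shift: "linear_on M (shift a)"
  using lin by (auto simp: linear_on_def cvec.scale_right_distrib cvec.scale_right_diff_distrib mult.commute)

lemma linear_shift_pow: "linear_on M (shift a ^^ n)"
proof (induction n)
  case (Suc n)
  then show ?case using linear_shift[of a] shift_pow_in[where a=a and n=n] by (simp add: linear_on_def)
qed (simp add: linear_on_def)

lemma shift_commute: "x \<in> M \<Longrightarrow> shift a (shift b x) = shift b (shift a x)"
  using linear_on_diff[OF lin sub, of "T x" "smul a x"] linear_on_diff[OF lin sub, of "T x" "smul b x"]
    linear_on_smul[OF lin, of x] inv sub
  by (simp add: cvec.subspace_scale cvec.scale_right_diff_distrib mult.commute)

lemma shift_pow_shift: "x \<in> M \<Longrightarrow> (shift a ^^ n) (shift b x) = shift b ((shift a ^^ n) x)"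
proof (induction n)
  case (Suc n)
  then show ?case using shift_commute[OF shift_pow_in, of x] by simp
qed simp

lemma shift_pow_commute: "x \<in> M \<Longrightarrow> (shift a ^^ n) ((shift b ^^ m) x) = (shift b ^^ m) ((shift a ^^ n) x)"
proof (induction m)
  case (Suc m)
  then show ?case using shift_pow_shift[OF shift_pow_in, where a=a and b=b] by simp
qed simp

lemma gen_eigenvector_shift_pow:
  assumes "x \<in> M" "gen_eigenvector T a x"
  shows "gen_eigenvector T a ((shift b ^^ m) x)"
proof -
  obtain n where "(shift a ^^ n) x = 0" using assms(2) by (auto simp: gen_eigenvector_def)
  then have "(shift a ^^ n) ((shift b ^^ m) x) = 0"
    using shift_pow_commute[OF assms(1), where n=n and a=a and m=m and b=b] linear_on_zero[OF linear_shift_pow sub] by simp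
  then show ?thesis by (auto simp: gen_eigenvector_def)
qed

lemma gen_eigenvector_add:
  assumes "x \<in> M" "y \<in> M" "gen_eigenvector T a x" "gen_eigenvector T a y"
  shows "gen_eigenvector T a (x + y)"
proof -
  obtain n m where nm: "(shift a ^^ n) x = 0" "(shift a ^^ m) y = 0"
    using assms by (auto simp: gen_eigenvector_def)
  have "(shift a ^^ (m + n)) x = 0" "(shift a ^^ (n + m)) y = 0"
    using nm linear_on_zero[OF linear_shift_pow sub] by (auto simp add: funpow_add)
  then have "(shift a ^^ (n + m)) x = 0" "(shift a ^^ (n + m)) y = 0"
    by (simp_all add: add.commute)
  then have "(shift a ^^ (n + m)) (x + y) = 0"
    using linear_on_add[OF linear_shift_pow] assms by simp
  then show ?thesis by (auto simp: gen_eigenvector_def)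
qed

lemma gen_eigenvector_smul:
  "x \<in> M \<Longrightarrow> gen_eigenvector T a x \<Longrightarrow> gen_eigenvector T a (smul c x)"
  using linear_on_smul[OF linear_shift_pow] by (fastforce simp: gen_eigenvector_def)

lemma gen_eigenvector_zero: "gen_eigenvector T a 0"
  unfolding gen_eigenvector_def by (rule exI[of _ 0]) simp

context
  fixes N assumes N: "cvec.subspace N" "N \<subseteq> M" "\<And>x. x \<in> N \<Longrightarrow> T x \<in> N"
begin

text \<open>Subtracting \<open>(T - a) x\<close> from \<open>(T - b) x\<close> leaves \<open>(a - b) x\<close>.\<close>

lemma shift_in_stable:
  assumes "x \<in> M" "(shift a ^^ m) x = 0" "a \<noteq> b" "shift b x \<in> N"
  shows "x \<in> N"
  using assms
proof (induction m arbitrary: x)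
  case 0
  then show ?case using N by (simp add: cvec.subspace_0)
next
  case (Suc m)
  have "shift b (shift a x) = shift a (shift b x)" using shift_commute Suc by simp
  then have "shift b (shift a x) \<in> N"
    using Suc N by (simp add: cvec.subspace_diff cvec.subspace_scale)
  then have "shift a x \<in> N"
    using Suc.IH[OF shift_in, of x a] Suc.prems
    by (simp add: funpow_Suc_right del: funpow.simps(2))
  then have "shift b x - shift a x \<in> N" using Suc.prems(4) N(1) by (metis cvec.subspace_diff)
  moreover have "shift b x - shift a x = smul (a - b) x" by (simp add: cvec.scale_left_diff_distrib)
  ultimately have "smul (a - b) x \<in> N" by simp
  then have "smul (1 / (a - b)) (smul (a - b) x) \<in> N" using N(1) by (rule cvec.subspace_scale[rotated])
  then show ?case using Suc.prems(3) by simp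
qed

text \<open>For distinct a and b, T - b is injective modulo N on generalised eigenvectors for a;
  this removes the factors one at a time.\<close>

lemma shift_pow_in_stable:
  assumes "x \<in> M" "gen_eigenvector T a x" "a \<noteq> b" "(shift b ^^ n) x \<in> N"
  shows "x \<in> N"
  using assms
proof (induction n arbitrary: x)
  case (Suc n)
  have "(shift b ^^ n) (shift b x) \<in> N" using Suc.prems(4)
    by (simp add: funpow_Suc_right del: funpow.simps(2))
  then have "shift b x \<in> N"
    using Suc.IH[OF shift_in, of x b] gen_eigenvector_shift_pow[of x a 1 b] Suc.prems by simp
  then show ?case
    using shift_in_stable Suc.prems by (auto simp: gen_eigenvector_def)
qed simp

text \<open>A power of T - b removes the component at b, the induction applies to what is left, and
  \<open>shift_pow_in_stable\<close> undoes that power. For N = {0} this is the independence of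
  generalised eigenspaces.\<close>

lemma gen_eigenvector_components:
  assumes "finite A" "\<And>a. a \<in> A \<Longrightarrow> f a \<in> M" "\<And>a. a \<in> A \<Longrightarrow> gen_eigenvector T a (f a)"
    "(\<Sum>a\<in>A. f a) \<in> N" "a \<in> A"
  shows "f a \<in> N"
  using assms
proof (induction A arbitrary: f a rule: finite_induct)
  case (insert b A)
  obtain n where n: "(shift b ^^ n) (f b) = 0"
    using insert.prems by (auto simp: gen_eigenvector_def)
  have stab: "(shift b ^^ k) x \<in> N" if "x \<in> N" for x k
    using that N by (induction k) (auto simp: cvec.subspace_diff cvec.subspace_scale)
  have "(shift b ^^ n) (f b + (\<Sum>a\<in>A. f a)) \<in> N"
    using stab insert by simp
  also have "(shift b ^^ n) (f b + (\<Sum>a\<in>A. f a)) = (\<Sum>a\<in>A. (shift b ^^ n) (f a))"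
    using n linear_on_add[OF linear_shift_pow, of "f b" "\<Sum>a\<in>A. f a" n b]
      linear_on_sum[OF linear_shift_pow sub, of A f n b] insert.prems
    by (simp add: cvec.subspace_sum[OF sub])
  finally have "(shift b ^^ n) (f c) \<in> N" if "c \<in> A" for c
    using insert.IH[of "\<lambda>a. (shift b ^^ n) (f a)" c] insert.prems that
    by (auto intro: shift_pow_in gen_eigenvector_shift_pow)
  then have A: "f c \<in> N" if "c \<in> A" for c
    using shift_pow_in_stable[of "f c" c b n] insert.hyps insert.prems that by (metis insertCI)
  moreover have "f b \<in> N"
  proof -
    have "(\<Sum>a\<in>insert b A. f a) - (\<Sum>a\<in>A. f a) \<in> N"
      using A insert.prems(3) N(1) by (auto intro!: cvec.subspace_diff cvec.subspace_sum)
    then show ?thesis using insert.hyps by simp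
  qed
  ultimately show ?case using insert.prems(4) by (metis insertE)
qed simp

end

end

section \<open>The orthogonal Lie algebra\<close>

lemma dual_index_dual [simp]: "a < 2 * l \<Longrightarrow> dual_index l (dual_index l a) = a"
  and dual_index_less [simp]: "a < 2 * l \<Longrightarrow> dual_index l a < 2 * l"
  by (auto simp: dual_index_def)

lemma dual_index_flip: "a < 2 * l \<Longrightarrow> b < 2 * l \<Longrightarrow> dual_index l a = b \<longleftrightarrow> a = dual_index l b"
  by auto

lemma dual_index_inject [simp]:
  "a < 2 * l \<Longrightarrow> b < 2 * l \<Longrightarrow> dual_index l a = dual_index l b \<longleftrightarrow> a = b"
  by (metis dual_index_dual)

lemma sum_dual_index: "(\<Sum>a<2*l. f (dual_index l a)) = (\<Sum>a<2*l. f a)"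
  by (rule sum.reindex_bij_witness[of _ "dual_index l" "dual_index l"]) auto

lemma sum_delta_right: "(i::nat) < n \<Longrightarrow> (\<Sum>c<n. f c * of_bool (c = i)) = (f i :: complex)"
proof -
  assume "i < n"
  have "(\<Sum>c<n. f c * of_bool (c = i)) = (\<Sum>c<n. if c = i then f c else 0)"
    by (intro sum.cong) auto
  then show ?thesis using \<open>i < n\<close> by simp
qed

lemma sum_delta_left: "(i::nat) < n \<Longrightarrow> (\<Sum>c<n. of_bool (c = i) * f c) = (f i :: complex)"
  using sum_delta_right[of i n f] by (simp add: mult.commute)

lemma sum_delta_diff:
  "(i::nat) < n \<Longrightarrow> (j::nat) < n \<Longrightarrow>
     (\<Sum>c<n. f c * of_bool (c = i) - g c * of_bool (c = j)) = (f i - g j :: complex)"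
  by (simp add: sum_subtractf sum_delta_right)

lemma so_alg_carrier: "A \<in> so_alg l \<Longrightarrow> A \<in> carrier_mat (2*l) (2*l)"
  by (simp add: so_alg_def)

text \<open>Multiplication by the form matrix permutes indices by \<open>dual_index l\<close>, so
  the defining equation becomes antisymmetry under the passage from (i, j) to (j', i').\<close>

lemma so_alg_iff:
  "A \<in> so_alg l \<longleftrightarrow> A \<in> carrier_mat (2*l) (2*l) \<and>
     (\<forall>i<2*l. \<forall>j<2*l. A $$ (i, j) = - A $$ (dual_index l j, dual_index l i))"
  (is "_ \<longleftrightarrow> _ \<and> ?skew")
proof (cases "A \<in> carrier_mat (2*l) (2*l)")
  case A: True
  have L: "(transpose_mat A * form_matrix l) $$ (i, j) = A $$ (dual_index l j, i)"
    if "i < 2*l" "j < 2*l" for i j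
  proof -
    have "(transpose_mat A * form_matrix l) $$ (i, j) =
        (\<Sum>c<2*l. A $$ (c, i) * form_matrix l $$ (c, j))"
      using A that by (simp add: form_matrix_def scalar_prod_def lessThan_atLeast0)
    also have "\<dots> = (\<Sum>c<2*l. A $$ (c, i) * of_bool (c = dual_index l j))"
      using that by (intro sum.cong) (auto simp: form_matrix_def)
    finally have "(transpose_mat A * form_matrix l) $$ (i, j) =
        (\<Sum>c<2*l. A $$ (c, i) * of_bool (c = dual_index l j))" .
    then show ?thesis using that by (simp add: sum_delta_right)
  qed
  have R: "(form_matrix l * A) $$ (i, j) = A $$ (dual_index l i, j)"
    if "i < 2*l" "j < 2*l" for i j
  proof -
    have "(form_matrix l * A) $$ (i, j) =
        (\<Sum>c<2*l. form_matrix l $$ (i, c) * A $$ (c, j))"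
      using A that by (simp add: form_matrix_def scalar_prod_def lessThan_atLeast0)
    also have "\<dots> = (\<Sum>c<2*l. of_bool (c = dual_index l i) * A $$ (c, j))"
      using that by (intro sum.cong) (auto simp: form_matrix_def)
    finally have "(form_matrix l * A) $$ (i, j) =
        (\<Sum>c<2*l. of_bool (c = dual_index l i) * A $$ (c, j))" .
    then show ?thesis using that by (simp add: sum_delta_left)
  qed
  have dim: "dim_row (form_matrix l) = 2*l" "dim_col (form_matrix l) = 2*l"
    by (simp_all add: form_matrix_def)
  have "transpose_mat A * form_matrix l + form_matrix l * A = 0\<^sub>m (2*l) (2*l) \<longleftrightarrow>
      (\<forall>i<2*l. \<forall>j<2*l. A $$ (dual_index l j, i) + A $$ (dual_index l i, j) = 0)"
    using A L R dim by (auto simp: mat_eq_iff)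
  also have "\<dots> \<longleftrightarrow> ?skew"
  proof safe
    fix i j assume h: "\<forall>i<2*l. \<forall>j<2*l. A $$ (dual_index l j, i) + A $$ (dual_index l i, j) = 0"
      and ij: "i < 2*l" "j < 2*l"
    then have "A $$ (dual_index l j, dual_index l i) + A $$ (dual_index l (dual_index l i), j) = 0"
      using dual_index_less by blast
    then show "A $$ (i, j) = - A $$ (dual_index l j, dual_index l i)"
      using ij by (simp add: eq_neg_iff_add_eq_0 add.commute)
  next
    fix i j assume h: "\<forall>i<2*l. \<forall>j<2*l. A $$ (i, j) = - A $$ (dual_index l j, dual_index l i)"
      and ij: "i < 2*l" "j < 2*l"
    then have "A $$ (dual_index l j, i) = - A $$ (dual_index l i, dual_index l (dual_index l j))"
      using dual_index_less by blast
    then show "A $$ (dual_index l j, i) + A $$ (dual_index l i, j) = 0" using ij by simp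
  qed
  finally show ?thesis using A by (simp add: so_alg_def)
qed (simp add: so_alg_def)

lemma so_alg_skew:
  "A \<in> so_alg l \<Longrightarrow> i < 2*l \<Longrightarrow> j < 2*l \<Longrightarrow> A $$ (dual_index l j, dual_index l i) = - A $$ (i, j)"
  by (metis so_alg_iff minus_minus)

lemma so_alg_skew_left:
  "A \<in> so_alg l \<Longrightarrow> i < 2*l \<Longrightarrow> j < 2*l \<Longrightarrow> A $$ (dual_index l i, j) = - A $$ (dual_index l j, i)"
  using so_alg_skew[of A l "dual_index l i" j] by simp

lemma so_alg_skew_right:
  "A \<in> so_alg l \<Longrightarrow> i < 2*l \<Longrightarrow> j < 2*l \<Longrightarrow> A $$ (i, dual_index l j) = - A $$ (j, dual_index l i)"
  using so_alg_skew[of A l i "dual_index l j"] by simp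

text \<open>Reindexing by \<open>dual_index l\<close> preserves the sum and negates every diagonal
  entry.\<close>

lemma so_alg_trace: "A \<in> so_alg l \<Longrightarrow> (\<Sum>i<2*l. A $$ (i, i)) = 0"
proof -
  assume A: "A \<in> so_alg l"
  have "(\<Sum>i<2*l. A $$ (i, i)) = (\<Sum>i<2*l. A $$ (dual_index l i, dual_index l i))"
    by (rule sum_dual_index[where f = "\<lambda>i. A $$ (i, i)", symmetric])
  also have "\<dots> = - (\<Sum>i<2*l. A $$ (i, i))"
    unfolding sum_negf[symmetric] by (intro sum.cong) (auto simp: so_alg_skew[OF A])
  finally show ?thesis by simp
qed

lemma so_alg_zero: "0\<^sub>m (2*l) (2*l) \<in> so_alg l"
  by (simp add: so_alg_iff)

lemma so_alg_add:
  assumes "A \<in> so_alg l" "B \<in> so_alg l" shows "A + B \<in> so_alg l"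
  using assms so_alg_carrier[OF assms(1)] so_alg_carrier[OF assms(2)]
  by (auto simp: so_alg_iff[of "A + B"] so_alg_skew)

lemma so_alg_smult:
  assumes "A \<in> so_alg l" shows "c \<cdot>\<^sub>m A \<in> so_alg l"
  using assms so_alg_carrier[OF assms] by (auto simp: so_alg_iff[of "c \<cdot>\<^sub>m A"] so_alg_skew)

lemma lie_carrier: "A \<in> so_alg l \<Longrightarrow> B \<in> so_alg l \<Longrightarrow> lie A B \<in> carrier_mat (2*l) (2*l)"
  using so_alg_carrier[of A l] so_alg_carrier[of B l] by (auto simp: lie_def)

lemma lie_index:
  assumes "A \<in> so_alg l" "B \<in> so_alg l" "i < 2*l" "j < 2*l"
  shows "lie A B $$ (i, j) = (\<Sum>k<2*l. A $$ (i, k) * B $$ (k, j)) - (\<Sum>k<2*l. B $$ (i, k) * A $$ (k, j))"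
  using assms(3,4) so_alg_carrier[OF assms(1)] so_alg_carrier[OF assms(2)]
  by (auto simp: lie_def scalar_prod_def lessThan_atLeast0)

lemma so_alg_lie:
  assumes A: "A \<in> so_alg l" and B: "B \<in> so_alg l"
  shows "lie A B \<in> so_alg l"
  unfolding so_alg_iff
proof (intro conjI allI impI)
  \<comment> \<open>Duality reverses a product: XY becomes YX, the two signs cancelling. The
    commutator therefore changes sign.\<close>
  have *: "(\<Sum>k<2*l. X $$ (dual_index l j, k) * Y $$ (k, dual_index l i)) =
      (\<Sum>k<2*l. Y $$ (i, k) * X $$ (k, j))"
    if X: "X \<in> so_alg l" and Y: "Y \<in> so_alg l" and ij: "i < 2*l" "j < 2*l" for X Y i j
  proof -
    have "(\<Sum>k<2*l. X $$ (dual_index l j, k) * Y $$ (k, dual_index l i)) =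
        (\<Sum>k<2*l. X $$ (dual_index l j, dual_index l k) * Y $$ (dual_index l k, dual_index l i))"
      by (rule sum_dual_index[where f = "\<lambda>k. X $$ (dual_index l j, k) * Y $$ (k, dual_index l i)", symmetric])
    also have "\<dots> = (\<Sum>k<2*l. Y $$ (i, k) * X $$ (k, j))"
    proof (rule sum.cong[OF refl])
      fix k assume "k \<in> {..<2*l}"
      then have k: "k < 2*l" by simp
      show "X $$ (dual_index l j, dual_index l k) * Y $$ (dual_index l k, dual_index l i) =
          Y $$ (i, k) * X $$ (k, j)"
        unfolding so_alg_skew[OF X k ij(2)] so_alg_skew[OF Y ij(1) k] by simp
    qed
    finally show ?thesis .
  qed
  fix i j assume ij: "i < 2*l" "j < 2*l"
  show "lie A B $$ (i, j) = - lie A B $$ (dual_index l j, dual_index l i)"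
    by (simp only: lie_index[OF A B ij] lie_index[OF A B dual_index_less[OF ij(2)] dual_index_less[OF ij(1)]]
      *[OF A B ij] *[OF B A ij] minus_diff_eq)
qed (rule lie_carrier[OF A B])

section \<open>The generators F_ab, their brackets and Casimir contractions\<close>

lemma so_gen_index:
  "i < 2*l \<Longrightarrow> j < 2*l \<Longrightarrow> so_gen l a b $$ (i, j) =
     of_bool (i = a) * of_bool (j = b) - of_bool (i = dual_index l b) * of_bool (j = dual_index l a)"
  unfolding so_gen_def by (simp only: index_mat prod.case of_bool_conj[symmetric]) (simp only: of_bool_def)

lemma so_gen_in: "a < 2*l \<Longrightarrow> b < 2*l \<Longrightarrow> so_gen l a b \<in> so_alg l"
proof (unfold so_alg_iff, intro conjI allI impI)
  assume ab: "a < 2*l" "b < 2*l"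
  fix i j assume ij: "i < 2*l" "j < 2*l"
  show "so_gen l a b $$ (i, j) = - so_gen l a b $$ (dual_index l j, dual_index l i)"
    using ij ab by (auto simp: so_gen_index dual_index_flip)
qed (simp add: so_gen_def)

lemma mult_so_gen:
  assumes "A \<in> so_alg l" "a < 2*l" "b < 2*l" "i < 2*l" "j < 2*l"
  shows "(\<Sum>k<2*l. A $$ (i, k) * so_gen l a b $$ (k, j)) =
      A $$ (i, a) * of_bool (j = b) - A $$ (i, dual_index l b) * of_bool (j = dual_index l a)"
proof -
  have "(\<Sum>k<2*l. A $$ (i, k) * so_gen l a b $$ (k, j)) =
      (\<Sum>k<2*l. (A $$ (i, k) * of_bool (j = b)) * of_bool (k = a) -
        (A $$ (i, k) * of_bool (j = dual_index l a)) * of_bool (k = dual_index l b))"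
    using assms by (intro sum.cong) (auto simp: so_gen_index)
  then show ?thesis using assms by (simp only: sum_delta_diff dual_index_less)
qed

lemma so_gen_mult:
  assumes "A \<in> so_alg l" "a < 2*l" "b < 2*l" "i < 2*l" "j < 2*l"
  shows "(\<Sum>k<2*l. so_gen l a b $$ (i, k) * A $$ (k, j)) =
      of_bool (i = a) * A $$ (b, j) - of_bool (i = dual_index l b) * A $$ (dual_index l a, j)"
proof -
  have "(\<Sum>k<2*l. so_gen l a b $$ (i, k) * A $$ (k, j)) =
      (\<Sum>k<2*l. (of_bool (i = a) * A $$ (k, j)) * of_bool (k = b) -
        (of_bool (i = dual_index l b) * A $$ (k, j)) * of_bool (k = dual_index l a))"
    using assms by (intro sum.cong) (auto simp: so_gen_index)
  then show ?thesis using assms by (simp only: sum_delta_diff dual_index_less)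
qed

lemma lie_so_gen_index:
  assumes A: "A \<in> so_alg l" and ab: "a < 2*l" "b < 2*l" and ij: "i < 2*l" "j < 2*l"
  shows "lie A (so_gen l a b) $$ (i, j) =
     A $$ (i, a) * of_bool (j = b) + A $$ (b, dual_index l i) * of_bool (j = dual_index l a)
     - of_bool (i = a) * A $$ (b, j) - of_bool (i = dual_index l b) * A $$ (dual_index l j, a)"
  using assms so_alg_skew_right[OF A, of i b] so_alg_skew_left[OF A, of a j]
  by (simp add: lie_index so_gen_in mult_so_gen so_gen_mult)

text \<open>F_ab behaves like a vector index a and a covector index b, and the bracket with A acts
  on either of them. In this form the Casimir sums cancel by renaming indices.\<close>

lemma lie_so_gen:
  assumes A: "A \<in> so_alg l" and ab: "a < 2*l" "b < 2*l" and ij: "i < 2*l" "j < 2*l"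
  shows "lie A (so_gen l a b) $$ (i, j) =
     (\<Sum>c<2*l. A $$ (c, a) * so_gen l c b $$ (i, j)) - (\<Sum>c<2*l. A $$ (b, c) * so_gen l a c $$ (i, j))"
proof -
  have "(\<Sum>c<2*l. A $$ (c, a) * so_gen l c b $$ (i, j)) =
      (\<Sum>c<2*l. (A $$ (c, a) * of_bool (j = b)) * of_bool (c = i) -
        (of_bool (i = dual_index l b) * A $$ (c, a)) * of_bool (c = dual_index l j))"
    using ij by (intro sum.cong) (auto simp: so_gen_index dual_index_flip)
  also have "\<dots> = A $$ (i, a) * of_bool (j = b) - of_bool (i = dual_index l b) * A $$ (dual_index l j, a)"
    using ij by (simp only: sum_delta_diff dual_index_less)
  finally have 1: "(\<Sum>c<2*l. A $$ (c, a) * so_gen l c b $$ (i, j)) = \<dots>" .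
  have "(\<Sum>c<2*l. A $$ (b, c) * so_gen l a c $$ (i, j)) =
      (\<Sum>c<2*l. (of_bool (i = a) * A $$ (b, c)) * of_bool (c = j) -
        (A $$ (b, c) * of_bool (j = dual_index l a)) * of_bool (c = dual_index l i))"
    using ij by (intro sum.cong) (auto simp: so_gen_index dual_index_flip)
  also have "\<dots> = of_bool (i = a) * A $$ (b, j) - A $$ (b, dual_index l i) * of_bool (j = dual_index l a)"
    using ij by (simp only: sum_delta_diff dual_index_less)
  finally have 2: "(\<Sum>c<2*l. A $$ (b, c) * so_gen l a c $$ (i, j)) = \<dots>" .
  show ?thesis unfolding lie_so_gen_index[OF assms] 1 2 by simp
qed

text \<open>The pairs (a, b) and (b', a') contribute equally, as both the entry of A and the
  generator change sign; hence the factor 2.\<close>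

lemma so_gen_expansion:
  assumes A: "A \<in> so_alg l" and ij: "i < 2*l" "j < 2*l"
  shows "(\<Sum>a<2*l. \<Sum>b<2*l. A $$ (a, b) * so_gen l a b $$ (i, j)) = 2 * A $$ (i, j)"
proof -
  have "(\<Sum>b<2*l. A $$ (a, b) * so_gen l a b $$ (i, j)) =
      of_bool (a = i) * A $$ (a, j) - A $$ (a, dual_index l i) * of_bool (a = dual_index l j)"
    if "a < 2*l" for a
  proof -
    have "(\<Sum>b<2*l. A $$ (a, b) * so_gen l a b $$ (i, j)) =
      (\<Sum>b<2*l. (of_bool (a = i) * A $$ (a, b)) * of_bool (b = j) -
        (A $$ (a, b) * of_bool (a = dual_index l j)) * of_bool (b = dual_index l i))"
      using ij that by (intro sum.cong) (auto simp: so_gen_index dual_index_flip)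
    then show ?thesis using ij by (simp only: sum_delta_diff dual_index_less)
  qed
  then have "(\<Sum>a<2*l. \<Sum>b<2*l. A $$ (a, b) * so_gen l a b $$ (i, j)) =
      (\<Sum>a<2*l. of_bool (a = i) * A $$ (a, j) - A $$ (a, dual_index l i) * of_bool (a = dual_index l j))"
    by (intro sum.cong) auto
  then show ?thesis
    using ij so_alg_skew[OF A ij] by (simp add: sum_subtractf sum_delta_left sum_delta_right)
qed

text \<open>Pairing with a generator reads off one matrix entry, which turns contractions over dual
  bases into plain index sums.\<close>

lemma inv_form_so_gen:
  assumes A: "A \<in> so_alg l" and ab: "a < 2*l" "b < 2*l"
  shows "inv_form l A (so_gen l a b) = A $$ (b, a)"
proof -
  have "(\<Sum>i<2*l. (A * so_gen l a b) $$ (i, i)) =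
      (\<Sum>i<2*l. \<Sum>k<2*l. A $$ (i, k) * so_gen l a b $$ (k, i))"
    using so_alg_carrier[OF A] by (auto simp: so_gen_def scalar_prod_def lessThan_atLeast0 intro!: sum.cong)
  also have "\<dots> = (\<Sum>i<2*l. A $$ (i, a) * of_bool (i = b) - A $$ (i, dual_index l b) * of_bool (i = dual_index l a))"
    using assms by (intro sum.cong) (auto simp: mult_so_gen)
  also have "\<dots> = 2 * A $$ (b, a)"
    using assms by (simp add: sum_subtractf sum_delta_right so_alg_skew[OF A])
  finally show ?thesis by (simp add: inv_form_def)
qed

text \<open>The free index b contributes 2l, two further terms contribute -1 each, and the trace
  term is zero; the total 2l - 2 is the dual Coxeter number.\<close>

lemma casimir_contract_right:
  assumes A: "A \<in> so_alg l" and ac: "a < 2*l" "c < 2*l"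
  shows "(\<Sum>b<2*l. lie A (so_gen l a b) $$ (c, b)) = dual_coxeter l * A $$ (c, a)"
proof -
  have "(\<Sum>b<2*l. lie A (so_gen l a b) $$ (c, b)) =
      (\<Sum>b<2*l. A $$ (c, a) + A $$ (b, dual_index l c) * of_bool (b = dual_index l a)
        - of_bool (c = a) * A $$ (b, b) - of_bool (b = dual_index l c) * A $$ (dual_index l b, a))"
    using assms by (intro sum.cong) (auto simp: lie_so_gen_index)
  also have "\<dots> = 2 * of_nat l * A $$ (c, a) + A $$ (dual_index l a, dual_index l c)
      - of_bool (c = a) * (\<Sum>b<2*l. A $$ (b, b)) - A $$ (c, a)"
    using assms
    by (simp add: sum.distrib sum_subtractf sum_delta_left sum_delta_right sum_distrib_left[symmetric])
  also have "\<dots> = dual_coxeter l * A $$ (c, a)"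
    using assms so_alg_trace[OF A] by (simp add: so_alg_skew[OF A] dual_coxeter_def) (simp add: algebra_simps)
  finally show ?thesis .
qed

lemma casimir_contract_left:
  assumes A: "A \<in> so_alg l" and bc: "b < 2*l" "c < 2*l"
  shows "(\<Sum>a<2*l. lie A (so_gen l a b) $$ (a, c)) = - dual_coxeter l * A $$ (b, c)"
proof -
  have "(\<Sum>a<2*l. lie A (so_gen l a b) $$ (a, c)) =
      (\<Sum>a<2*l. A $$ (a, a) * of_bool (c = b) + A $$ (b, dual_index l a) * of_bool (a = dual_index l c)
        - A $$ (b, c) - of_bool (a = dual_index l b) * A $$ (dual_index l c, a))"
    using assms by (intro sum.cong) (auto simp: lie_so_gen_index)
  also have "\<dots> = (\<Sum>a<2*l. A $$ (a, a)) * of_bool (c = b) + A $$ (b, c)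
      - 2 * of_nat l * A $$ (b, c) - A $$ (dual_index l c, dual_index l b)"
    using assms
    by (simp add: sum.distrib sum_subtractf sum_delta_left sum_delta_right sum_distrib_right[symmetric])
  also have "\<dots> = - dual_coxeter l * A $$ (b, c)"
    using assms so_alg_trace[OF A] by (simp add: so_alg_skew[OF A] dual_coxeter_def) (simp add: algebra_simps)
  finally show ?thesis .
qed

text \<open>After one contraction only a multiple of the trace of A is left. The sum is the vacuum
  coefficient in the product of index 2 of a current with the Casimir vector.\<close>

lemma casimir_trace:
  assumes A: "A \<in> so_alg l"
  shows "(\<Sum>a<2*l. \<Sum>b<2*l. inv_form l (lie A (so_gen l a b)) (so_gen l b a)) = 0"
proof -
  have "(\<Sum>a<2*l. \<Sum>b<2*l. inv_form l (lie A (so_gen l a b)) (so_gen l b a)) =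
      (\<Sum>a<2*l. \<Sum>b<2*l. lie A (so_gen l a b) $$ (a, b))"
    using A by (intro sum.cong) (auto simp: inv_form_so_gen so_alg_lie so_gen_in)
  also have "\<dots> = (\<Sum>a<2*l. dual_coxeter l * A $$ (a, a))"
    using A by (intro sum.cong) (auto simp: casimir_contract_right)
  finally show ?thesis using so_alg_trace[OF A] by (simp add: sum_distrib_left[symmetric])
qed

section \<open>Cartan elements and root vectors\<close>

definition wt_diag :: "nat \<Rightarrow> (nat \<Rightarrow> complex) \<Rightarrow> complex mat" where
  "wt_diag l h = mat (2*l) (2*l) (\<lambda>(i, j). if i = j then (if i < l then h i else - h (i - l)) else 0)"

lemma wt_diag_cartan: "wt_diag l h \<in> cartan l"
proof -
  have "wt_diag l h \<in> so_alg l"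
    unfolding so_alg_iff by (auto simp: wt_diag_def) (auto simp: dual_index_def)
  then show ?thesis by (auto simp: cartan_def diagonal_mat_def wt_diag_def)
qed

lemma cartan_so: "H \<in> cartan l \<Longrightarrow> H \<in> so_alg l"
  by (simp add: cartan_def)

lemma cartan_lie_so_gen:
  assumes H: "H \<in> cartan l" and ab: "a < 2*l" "b < 2*l"
  shows "lie H (so_gen l a b) = (H $$ (a, a) - H $$ (b, b)) \<cdot>\<^sub>m so_gen l a b"
proof (rule eq_matI)
  have so: "H \<in> so_alg l" and diag: "\<And>i j. i < 2*l \<Longrightarrow> j < 2*l \<Longrightarrow> i \<noteq> j \<Longrightarrow> H $$ (i, j) = 0"
    using H so_alg_carrier[of H l] by (auto simp: cartan_def diagonal_mat_def)
  fix i j assume "i < dim_row ((H $$ (a, a) - H $$ (b, b)) \<cdot>\<^sub>m so_gen l a b)"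
    "j < dim_col ((H $$ (a, a) - H $$ (b, b)) \<cdot>\<^sub>m so_gen l a b)"
  then have ij: "i < 2*l" "j < 2*l" by (simp_all add: so_gen_def)
  have "i = dual_index l b \<longleftrightarrow> b = dual_index l i" "j = dual_index l a \<longleftrightarrow> dual_index l j = a"
    using dual_index_flip[OF ij(1) ab(2)] dual_index_flip[OF ij(2) ab(1)] by auto
  \<comment> \<open>Each entry of the diagonal matrix H is written as a Kronecker delta times one of
    the two fixed diagonal entries at a and b; the generator then factors out.\<close>
  then have entries: "H $$ (i, a) = of_bool (i = a) * H $$ (a, a)"
    "H $$ (b, dual_index l i) = of_bool (i = dual_index l b) * H $$ (b, b)"
    "H $$ (b, j) = of_bool (j = b) * H $$ (b, b)"
    "H $$ (dual_index l j, a) = of_bool (j = dual_index l a) * H $$ (a, a)"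
    using diag[OF ij(1) ab(1)] diag[OF ab(2) ij(2)] diag[OF ab(2) dual_index_less[OF ij(1)]]
      diag[OF dual_index_less[OF ij(2)] ab(1)]
    unfolding of_bool_def by (metis mult_1 mult_zero_left)+
  have "lie H (so_gen l a b) $$ (i, j) =
      H $$ (i, a) * of_bool (j = b) + H $$ (b, dual_index l i) * of_bool (j = dual_index l a)
     - of_bool (i = a) * H $$ (b, j) - of_bool (i = dual_index l b) * H $$ (dual_index l j, a)"
    using lie_so_gen_index[OF so ab ij] .
  also have "\<dots> = (H $$ (a, a) - H $$ (b, b)) * so_gen l a b $$ (i, j)"
    unfolding entries so_gen_index[OF ij] by (simp add: algebra_simps)
  finally show "lie H (so_gen l a b) $$ (i, j) = ((H $$ (a, a) - H $$ (b, b)) \<cdot>\<^sub>m so_gen l a b) $$ (i, j)"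
    using ij by (simp add: so_gen_def)
qed (use lie_carrier[of H l "so_gen l a b"] assms cartan_so so_gen_in in \<open>auto simp: so_gen_def\<close>)

lemma so_gen_diag_cartan: "a < 2*l \<Longrightarrow> so_gen l a a \<in> cartan l"
  using so_gen_in[of a l a] by (auto simp: cartan_def diagonal_mat_def) (auto simp: so_gen_def)

section \<open>Families of fields\<close>

lemma Sum_any_in_subspace:
  assumes "cvec.subspace N" "\<And>i. g i \<in> N"
  shows "Sum_any g \<in> N"
  unfolding Sum_any.expand_set using assms by (intro cvec.subspace_sum) auto

lemma Sum_any_single:
  fixes g :: "nat \<Rightarrow> 'a cvec"
  assumes "\<And>i. i \<noteq> j \<Longrightarrow> g i = 0"
  shows "Sum_any g = g j"
proof -
  have "Sum_any g = sum g {j}"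
    using assms by (intro Sum_any.expand_superset) auto
  then show ?thesis by simp
qed

text \<open>Covers a module and V acting on itself alike, so that each mode identity is available
  for both.\<close>

locale field_family =
  fixes V :: "'v valg" and M :: "'b cvec set" and Y :: "'v cvec \<Rightarrow> int \<Rightarrow> 'b cvec \<Rightarrow> 'b cvec"
  assumes vertex_algebra: "vertex_algebra V" and fields: "fields_on V M Y"
begin

lemma subspace: "cvec.subspace M"
  and mode_in: "a \<in> vcarrier V \<Longrightarrow> u \<in> M \<Longrightarrow> Y a n u \<in> M"
  and mode_linear: "a \<in> vcarrier V \<Longrightarrow> linear_on M (Y a n)"
  and mode_linear_left: "u \<in> M \<Longrightarrow> linear_on (vcarrier V) (\<lambda>a. Y a n u)"
  and mode_truncation: "a \<in> vcarrier V \<Longrightarrow> u \<in> M \<Longrightarrow> \<exists>N. \<forall>n\<ge>N. Y a n u = 0"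
  and mode_vac: "u \<in> M \<Longrightarrow> Y (vac V) n u = (if n = -1 then u else 0)"
  and borcherds: "a \<in> vcarrier V \<Longrightarrow> b \<in> vcarrier V \<Longrightarrow> u \<in> M \<Longrightarrow>
        Sum_any (\<lambda>i. smul (of_int p gchoose i)
          (Y (nprod V a (r + int i) b) (p + q - int i) u)) =
        Sum_any (\<lambda>i. smul ((-1) ^ i * (of_int r gchoose i))
          (Y a (p + r - int i) (Y b (q + int i) u)
           - smul ((-1) powi r) (Y b (q + r - int i) (Y a (p + int i) u))))"
  using fields unfolding fields_on_def by blast+

lemma V_subspace: "cvec.subspace (vcarrier V)"
  and V_mode_in: "a \<in> vcarrier V \<Longrightarrow> b \<in> vcarrier V \<Longrightarrow> nprod V a n b \<in> vcarrier V"
  and vac_in: "vac V \<in> vcarrier V"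
  using vertex_algebra unfolding vertex_algebra_def fields_on_def by blast+

lemma mode_zero: "a \<in> vcarrier V \<Longrightarrow> Y a n 0 = 0"
  using linear_on_zero[OF mode_linear subspace] .

lemma mode_zero_left: "u \<in> M \<Longrightarrow> Y 0 n u = 0"
  using linear_on_zero[OF mode_linear_left V_subspace] .

text \<open>The Borcherds identity for r = 0, where the right side keeps the term i = 0
  only.\<close>

lemma mode_commutator:
  assumes "a \<in> vcarrier V" "b \<in> vcarrier V" "u \<in> M"
  shows "Y a p (Y b q u) - Y b q (Y a p u) =
     Sum_any (\<lambda>i. smul (of_int p gchoose i) (Y (nprod V a (int i) b) (p + q - int i) u))"
proof -
  have "Sum_any (\<lambda>i. smul ((-1) ^ i * (of_int 0 gchoose i))
          (Y a (p + 0 - int i) (Y b (q + int i) u)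
           - smul ((-1) powi 0) (Y b (q + 0 - int i) (Y a (p + int i) u)))) =
      Y a p (Y b q u) - Y b q (Y a p u)"
    by (subst Sum_any_single[where j = 0]) (auto simp: gr0_conv_Suc gbinomial_0)
  then show ?thesis using borcherds[OF assms, of p 0 q] by simp
qed

text \<open>The Borcherds identity for p = 0, where the left side keeps the term i = 0 only. It
  expresses the modes of a product by modes of its factors.\<close>

lemma mode_associativity:
  assumes "a \<in> vcarrier V" "b \<in> vcarrier V" "u \<in> M"
  shows "Y (nprod V a r b) q u =
     Sum_any (\<lambda>i. smul ((-1) ^ i * (of_int r gchoose i))
          (Y a (r - int i) (Y b (q + int i) u)
           - smul ((-1) powi r) (Y b (q + r - int i) (Y a (int i) u))))"
proof -
  have "Sum_any (\<lambda>i. smul (of_int 0 gchoose i) (Y (nprod V a (r + int i) b) (0 + q - int i) u)) =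
      Y (nprod V a r b) q u"
    by (subst Sum_any_single[where j = 0]) (auto simp: gr0_conv_Suc gbinomial_0)
  then show ?thesis using borcherds[OF assms, of 0 r q] by simp
qed

end

locale current_fields = field_family V M Y
  for V :: "'v valg" and M :: "'b cvec set" and Y +
  fixes l :: nat and k :: complex and J :: "complex mat \<Rightarrow> 'v cvec"
  assumes affine_va: "simple_affine_va l k V J"
begin

lemma J_add: "x \<in> so_alg l \<Longrightarrow> y \<in> so_alg l \<Longrightarrow> J (x + y) = J x + J y"
  and J_smult: "x \<in> so_alg l \<Longrightarrow> J (c \<cdot>\<^sub>m x) = smul c (J x)"
  and J_prod0: "x \<in> so_alg l \<Longrightarrow> y \<in> so_alg l \<Longrightarrow> nprod V (J x) 0 (J y) = J (lie x y)"
  and J_prod1: "x \<in> so_alg l \<Longrightarrow> y \<in> so_alg l \<Longrightarrow>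
        nprod V (J x) 1 (J y) = smul (k * inv_form l x y) (vac V)"
  and J_prod2: "x \<in> so_alg l \<Longrightarrow> y \<in> so_alg l \<Longrightarrow> n \<ge> 2 \<Longrightarrow> nprod V (J x) n (J y) = 0"
  and J_generate: "va_generated_by V (J ` so_alg l)"
  using affine_va unfolding simple_affine_va_def by blast+

lemma J_in: "x \<in> so_alg l \<Longrightarrow> J x \<in> vcarrier V"
  using J_generate by (auto simp: va_generated_by_def)

text \<open>Among the nonnegative products of two currents only those of index 0 and 1 can be
  nonzero. The latter is a multiple of the vacuum, whose only mode has index -1, so the central term
  is confined to m + n = 0.\<close>

lemma current_commutator:
  assumes x: "x \<in> so_alg l" and y: "y \<in> so_alg l" and u: "u \<in> M"
  shows "Y (J x) m (Y (J y) n u) = Y (J y) n (Y (J x) m u) + Y (J (lie x y)) (m + n) u +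
     (if m + n = 0 then smul (of_int m * (k * inv_form l x y)) u else 0)"
proof -
  have "Sum_any (\<lambda>i. smul (of_int m gchoose i) (Y (nprod V (J x) (int i) (J y)) (m + n - int i) u)) =
      (\<Sum>i\<in>{0, 1}. smul (of_int m gchoose i) (Y (nprod V (J x) (int i) (J y)) (m + n - int i) u))"
  proof (rule Sum_any.expand_superset)
    show "{i. smul (of_int m gchoose i) (Y (nprod V (J x) (int i) (J y)) (m + n - int i) u) \<noteq> 0} \<subseteq> {0, 1}"
    proof
      fix i assume i: "i \<in> {i. smul (of_int m gchoose i) (Y (nprod V (J x) (int i) (J y)) (m + n - int i) u) \<noteq> 0}"
      show "i \<in> {0, 1}"
      proof (rule ccontr)
        assume "i \<notin> {0, 1}"
        then have "int i \<ge> 2" by auto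
        then show False using i J_prod2[OF x y] mode_zero_left[OF u] by simp
      qed
    qed
  qed simp
  also have "\<dots> = Y (J (lie x y)) (m + n) u +
      smul (of_int m) (Y (smul (k * inv_form l x y) (vac V)) (m + n - 1) u)"
    using J_prod0[OF x y] J_prod1[OF x y] by simp
  also have "Y (smul (k * inv_form l x y) (vac V)) (m + n - 1) u =
      (if m + n = 0 then smul (k * inv_form l x y) u else 0)"
    using linear_on_smul[OF mode_linear_left[OF u] vac_in] by (simp add: mode_vac[OF u])
  finally show ?thesis
    using mode_commutator[OF J_in[OF x] J_in[OF y] u, of m n] by (auto simp: algebra_simps)
qed

text \<open>Matrices of all sizes share one type, without a common zero for an empty sum. The linear
  relation is therefore given entrywise, and J is applied after removing one summand at a
  time.\<close>

lemma J_eq_sum: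
  assumes "finite S" "\<And>p. p \<in> S \<Longrightarrow> X p \<in> so_alg l" "x \<in> so_alg l"
    "\<And>i j. i < 2*l \<Longrightarrow> j < 2*l \<Longrightarrow> x $$ (i, j) = (\<Sum>p\<in>S. c p * X p $$ (i, j))"
  shows "J x = (\<Sum>p\<in>S. smul (c p) (J (X p)))"
  using assms
proof (induction S arbitrary: x rule: finite_induct)
  case empty
  then have "x = 0 \<cdot>\<^sub>m x" using so_alg_carrier[of x l] by (intro eq_matI) auto
  then show ?case using J_smult[OF empty(2), of 0] by simp
next
  case (insert q S)
  define y where "y = x + (- c q) \<cdot>\<^sub>m X q"
  have Xq: "X q \<in> so_alg l" using insert by simp
  have dims: "x \<in> carrier_mat (2*l) (2*l)" "X q \<in> carrier_mat (2*l) (2*l)"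
    using insert Xq by (auto intro: so_alg_carrier)
  have y: "y \<in> so_alg l" unfolding y_def using insert Xq by (intro so_alg_add so_alg_smult)
  have "J y = (\<Sum>p\<in>S. smul (c p) (J (X p)))"
  proof (rule insert.IH[OF _ y])
    show "y $$ (i, j) = (\<Sum>p\<in>S. c p * X p $$ (i, j))" if "i < 2*l" "j < 2*l" for i j
      using insert.hyps insert.prems(3)[OF that] dims that by (simp add: y_def)
  qed (use insert in auto)
  moreover have "J y = J x + smul (- c q) (J (X q))"
    unfolding y_def using insert.prems Xq by (simp add: J_add J_smult so_alg_smult)
  ultimately show ?case using insert.hyps by (simp add: cvec.scale_minus_left algebra_simps)
qed

abbreviation G :: "nat \<Rightarrow> nat \<Rightarrow> 'v cvec" where
  "G a b \<equiv> J (so_gen l a b)"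

lemma G_in: "a < 2*l \<Longrightarrow> b < 2*l \<Longrightarrow> G a b \<in> vcarrier V"
  by (simp add: J_in so_gen_in)

lemma J_expansion:
  assumes x: "x \<in> so_alg l"
  shows "(\<Sum>a<2*l. \<Sum>b<2*l. smul (x $$ (a, b)) (G a b)) = smul 2 (J x)"
proof -
  have "J (2 \<cdot>\<^sub>m x) = (\<Sum>p\<in>{..<2*l} \<times> {..<2*l}. smul (x $$ p) (J (case_prod (so_gen l) p)))"
  proof (rule J_eq_sum)
    show "(2 \<cdot>\<^sub>m x) $$ (i, j) =
        (\<Sum>p\<in>{..<2*l} \<times> {..<2*l}. x $$ p * (case_prod (so_gen l) p) $$ (i, j))"
      if "i < 2*l" "j < 2*l" for i j
      using so_gen_expansion[OF x that] so_alg_carrier[OF x] that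
      by (simp add: sum.cartesian_product case_prod_unfold)
  qed (auto simp: so_gen_in so_alg_smult[OF x])
  then show ?thesis by (simp add: J_smult[OF x] sum.cartesian_product case_prod_unfold)
qed

lemma J_half_expansion:
  assumes x: "x \<in> so_alg l"
  shows "J x = (\<Sum>a<2*l. \<Sum>b<2*l. smul (x $$ (a, b) / 2) (G a b))"
proof -
  have "J x = smul (1/2) (smul 2 (J x))" by simp
  also have "\<dots> = (\<Sum>a<2*l. \<Sum>b<2*l. smul (x $$ (a, b) / 2) (G a b))"
    unfolding J_expansion[OF x, symmetric] by (simp add: cvec.scale_sum_right)
  finally show ?thesis .
qed

lemma J_lie_so_gen:
  assumes x: "x \<in> so_alg l" and ab: "a < 2*l" "b < 2*l"
  shows "J (lie x (so_gen l a b)) =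
    (\<Sum>c<2*l. smul (x $$ (c, a)) (G c b)) - (\<Sum>c<2*l. smul (x $$ (b, c)) (G a c))"
proof -
  \<comment> \<open>A truth value beside the index tells which of the two sums a term belongs to, so
    that their difference is a single linear combination.\<close>
  let ?X = "\<lambda>p. if snd p then so_gen l (fst p) b else so_gen l a (fst p)"
  let ?c = "\<lambda>p. if snd p then x $$ (fst p, a) else - x $$ (b, fst p)"
  have split: "(\<Sum>p\<in>{..<2*l} \<times> UNIV. f (fst p) (snd p)) = (\<Sum>c<2*l. f c True) + (\<Sum>c<2*l. f c False)"
    for f :: "nat \<Rightarrow> bool \<Rightarrow> 'c::comm_monoid_add"
  proof -
    have "(\<Sum>p\<in>{..<2*l} \<times> UNIV. f (fst p) (snd p)) = (\<Sum>c<2*l. \<Sum>t\<in>UNIV. f c t)"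
      by (simp add: sum.cartesian_product case_prod_unfold)
    then show ?thesis by (simp add: UNIV_bool sum.distrib add.commute)
  qed
  have "J (lie x (so_gen l a b)) = (\<Sum>p\<in>{..<2*l} \<times> UNIV. smul (?c p) (J (?X p)))"
  proof (rule J_eq_sum)
    show "lie x (so_gen l a b) $$ (i, j) = (\<Sum>p\<in>{..<2*l} \<times> UNIV. ?c p * ?X p $$ (i, j))"
      if "i < 2*l" "j < 2*l" for i j
      using split[of "\<lambda>c t. (if t then x $$ (c, a) else - x $$ (b, c)) *
          (if t then so_gen l c b else so_gen l a c) $$ (i, j)"]
      by (simp add: lie_so_gen[OF x ab that] sum_negf)
  qed (use ab in \<open>auto simp: so_gen_in so_alg_lie x\<close>)
  then show ?thesis
    using split[of "\<lambda>c t. smul (if t then x $$ (c, a) else - x $$ (b, c))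
          (J (if t then so_gen l c b else so_gen l a c))"]
    by (simp add: cvec.scale_minus_left sum_negf)
qed

section \<open>The Sugawara vector\<close>

interpretation VV: current_fields V "vcarrier V" "nprod V" l k J
  using vertex_algebra affine_va by unfold_locales (auto simp: vertex_algebra_def)

lemma vac_prod: "a \<in> vcarrier V \<Longrightarrow> nprod V a (-1) (vac V) = a"
  using vertex_algebra by (simp add: vertex_algebra_def)

text \<open>The affine commutator in the adjoint module with second mode -1, which moves the central
  term to m = 1.\<close>

lemma current_normal_prod:
  assumes x: "x \<in> so_alg l" and y: "y \<in> so_alg l" and z: "z \<in> so_alg l"
  shows "nprod V (J x) m (nprod V (J y) (-1) (J z)) = nprod V (J y) (-1) (nprod V (J x) m (J z)) +
     nprod V (J (lie x y)) (m - 1) (J z) + (if m = 1 then smul (k * inv_form l x y) (J z) else 0)"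
  using VV.current_commutator[OF x y J_in[OF z], of m "-1"] by auto

lemma normal_prod_lie_right:
  assumes x: "x \<in> so_alg l" and ab: "a < 2*l" "b < 2*l"
  shows "nprod V (G a b) (-1) (J (lie x (so_gen l b a))) =
    (\<Sum>c<2*l. smul (x $$ (c, b)) (nprod V (G a b) (-1) (G c a))) -
    (\<Sum>c<2*l. smul (x $$ (a, c)) (nprod V (G a b) (-1) (G b c)))"
proof -
  have lin: "linear_on (vcarrier V) (nprod V (G a b) (-1))" using VV.mode_linear G_in ab by blast
  have in1: "(\<Sum>c<2*l. smul (x $$ (c, b)) (G c a)) \<in> vcarrier V" and in2: "(\<Sum>c<2*l. smul (x $$ (a, c)) (G b c)) \<in> vcarrier V"
    using ab by (auto intro!: cvec.subspace_sum cvec.subspace_scale V_subspace G_in)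
  show ?thesis
    unfolding J_lie_so_gen[OF x ab(2,1)] linear_on_diff[OF lin V_subspace in1 in2]
    by (intro arg_cong2[where f = "(-)"] linear_on_combination[OF lin V_subspace] G_in) (use ab in auto)
qed

lemma normal_prod_lie_left:
  assumes x: "x \<in> so_alg l" and ab: "a < 2*l" "b < 2*l"
  shows "nprod V (J (lie x (so_gen l a b))) (-1) (G b a) =
    (\<Sum>c<2*l. smul (x $$ (c, a)) (nprod V (G c b) (-1) (G b a))) -
    (\<Sum>c<2*l. smul (x $$ (b, c)) (nprod V (G a c) (-1) (G b a)))"
proof -
  have lin: "linear_on (vcarrier V) (\<lambda>v. nprod V v (-1) (G b a))"
    using VV.mode_linear_left G_in ab by blast
  have in1: "(\<Sum>c<2*l. smul (x $$ (c, a)) (G c b)) \<in> vcarrier V" and in2: "(\<Sum>c<2*l. smul (x $$ (b, c)) (G a c)) \<in> vcarrier V"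
    using ab by (auto intro!: cvec.subspace_sum cvec.subspace_scale V_subspace G_in)
  show ?thesis
    unfolding J_lie_so_gen[OF x ab] linear_on_diff[OF lin V_subspace in1 in2]
    by (intro arg_cong2[where f = "(-)"] linear_on_combination[OF lin V_subspace] G_in) (use ab in auto)
qed

text \<open>All a, b are summed, so this is twice the sum over dual bases; together with the 2 in
  the Sugawara denominator this yields the factor 4 below.\<close>

definition casimir_vector :: "'v cvec" where
  "casimir_vector = (\<Sum>a<2*l. \<Sum>b<2*l. nprod V (G a b) (-1) (G b a))"

lemma casimir_vector_in: "casimir_vector \<in> vcarrier V"
  unfolding casimir_vector_def
  by (intro cvec.subspace_sum V_subspace V_mode_in G_in) auto

lemma current_casimir_vector_sum:
  assumes x: "x \<in> so_alg l"
  shows "nprod V (J x) m casimir_vector =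
    (\<Sum>a<2*l. \<Sum>b<2*l. nprod V (G a b) (-1) (nprod V (J x) m (G b a)) +
     nprod V (J (lie x (so_gen l a b))) (m - 1) (G b a) +
     (if m = 1 then smul (k * inv_form l x (so_gen l a b)) (G b a) else 0))"
proof -
  have lin: "linear_on (vcarrier V) (nprod V (J x) m)" using VV.mode_linear J_in[OF x] by blast
  have "nprod V (J x) m casimir_vector =
      (\<Sum>a<2*l. nprod V (J x) m (\<Sum>b<2*l. nprod V (G a b) (-1) (G b a)))"
    unfolding casimir_vector_def
    by (intro linear_on_sum[OF lin V_subspace] cvec.subspace_sum[OF V_subspace] V_mode_in G_in) auto
  also have "\<dots> = (\<Sum>a<2*l. \<Sum>b<2*l. nprod V (J x) m (nprod V (G a b) (-1) (G b a)))"
    by (intro sum.cong refl linear_on_sum[OF lin V_subspace] V_mode_in G_in) auto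
  finally show ?thesis using x by (simp add: current_normal_prod so_gen_in)
qed

text \<open>Invariance of the Casimir element: the bracket with x hits either index of either
  factor, and the four triple sums cancel in pairs after renaming indices.\<close>

lemma current_casimir_vector_0:
  assumes x: "x \<in> so_alg l"
  shows "nprod V (J x) 0 casimir_vector = 0"
proof -
  define f where "f a b c = smul (x $$ (a, c)) (nprod V (G a b) (-1) (G b c))" for a b c
  define g where "g a b c = smul (x $$ (c, b)) (nprod V (G a b) (-1) (G c a))" for a b c
  have "nprod V (J x) 0 casimir_vector =
     (\<Sum>a<2*l. \<Sum>b<2*l. nprod V (G a b) (-1) (J (lie x (so_gen l b a))) +
     nprod V (J (lie x (so_gen l a b))) (-1) (G b a))"
    unfolding current_casimir_vector_sum[OF x] using x by (simp add: J_prod0 so_gen_in)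
  also have "\<dots> = (\<Sum>a<2*l. \<Sum>b<2*l. (\<Sum>c<2*l. g a b c) - (\<Sum>c<2*l. f a b c) +
      ((\<Sum>c<2*l. f c b a) - (\<Sum>c<2*l. g a c b)))"
    using x by (simp add: normal_prod_lie_left normal_prod_lie_right f_def g_def)
  also have "\<dots> = (\<Sum>a<2*l. \<Sum>b<2*l. \<Sum>c<2*l. g a b c) - (\<Sum>a<2*l. \<Sum>b<2*l. \<Sum>c<2*l. f a b c)
      + ((\<Sum>a<2*l. \<Sum>b<2*l. \<Sum>c<2*l. f c b a) - (\<Sum>a<2*l. \<Sum>b<2*l. \<Sum>c<2*l. g a c b))"
    by (simp only: sum.distrib sum_subtractf)
  also have "(\<Sum>a<2*l. \<Sum>b<2*l. \<Sum>c<2*l. g a c b) = (\<Sum>a<2*l. \<Sum>b<2*l. \<Sum>c<2*l. g a b c)"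
    by (intro sum.cong refl sum.swap)
  also have "(\<Sum>a<2*l. \<Sum>b<2*l. \<Sum>c<2*l. f c b a) = (\<Sum>b<2*l. \<Sum>a<2*l. \<Sum>c<2*l. f c b a)"
    by (rule sum.swap)
  also have "\<dots> = (\<Sum>b<2*l. \<Sum>c<2*l. \<Sum>a<2*l. f c b a)"
    by (intro sum.cong refl sum.swap)
  also have "\<dots> = (\<Sum>a<2*l. \<Sum>b<2*l. \<Sum>c<2*l. f a b c)"
    by (rule sum.swap)
  finally show ?thesis by simp
qed

text \<open>The Casimir element acts on the adjoint representation by twice the dual Coxeter number,
  and the summation over all a, b doubles this once more.\<close>

lemma double_lie_casimir:
  assumes x: "x \<in> so_alg l"
  shows "(\<Sum>a<2*l. \<Sum>b<2*l. J (lie (lie x (so_gen l a b)) (so_gen l b a))) = smul (4 * dual_coxeter l) (J x)"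
proof -
  define X where "X a b = lie x (so_gen l a b)" for a b
  have X: "X a b \<in> so_alg l" if "a < 2*l" "b < 2*l" for a b
    using x that by (simp add: X_def so_alg_lie so_gen_in)
  have "(\<Sum>a<2*l. \<Sum>b<2*l. J (lie (X a b) (so_gen l b a))) =
      (\<Sum>a<2*l. \<Sum>b<2*l. (\<Sum>c<2*l. smul (X a b $$ (c, b)) (G c a)) - (\<Sum>c<2*l. smul (X a b $$ (a, c)) (G b c)))"
    by (simp add: J_lie_so_gen X)
  also have "\<dots> = (\<Sum>a<2*l. \<Sum>b<2*l. \<Sum>c<2*l. smul (X a b $$ (c, b)) (G c a)) -
      (\<Sum>a<2*l. \<Sum>b<2*l. \<Sum>c<2*l. smul (X a b $$ (a, c)) (G b c))"
    by (simp only: sum_subtractf)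
  also have "(\<Sum>a<2*l. \<Sum>b<2*l. \<Sum>c<2*l. smul (X a b $$ (c, b)) (G c a)) =
      (\<Sum>a<2*l. \<Sum>c<2*l. \<Sum>b<2*l. smul (X a b $$ (c, b)) (G c a))"
    by (intro sum.cong refl sum.swap)
  also have "\<dots> = (\<Sum>a<2*l. \<Sum>c<2*l. smul (dual_coxeter l * x $$ (c, a)) (G c a))"
    using x by (simp add: cvec.scale_sum_left[symmetric] X_def casimir_contract_right)
  also have "\<dots> = (\<Sum>c<2*l. \<Sum>a<2*l. smul (dual_coxeter l * x $$ (c, a)) (G c a))"
    by (rule sum.swap)
  also have "\<dots> = smul (dual_coxeter l) (smul 2 (J x))"
    unfolding J_expansion[OF x, symmetric] by (simp add: cvec.scale_sum_right)
  also have "(\<Sum>a<2*l. \<Sum>b<2*l. \<Sum>c<2*l. smul (X a b $$ (a, c)) (G b c)) =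
      (\<Sum>b<2*l. \<Sum>a<2*l. \<Sum>c<2*l. smul (X a b $$ (a, c)) (G b c))"
    by (rule sum.swap)
  also have "\<dots> = (\<Sum>b<2*l. \<Sum>c<2*l. \<Sum>a<2*l. smul (X a b $$ (a, c)) (G b c))"
    by (intro sum.cong refl sum.swap)
  also have "\<dots> = (\<Sum>b<2*l. \<Sum>c<2*l. smul (- dual_coxeter l * x $$ (b, c)) (G b c))"
    using x by (simp add: cvec.scale_sum_left[symmetric] X_def casimir_contract_left)
  also have "\<dots> = smul (- dual_coxeter l) (smul 2 (J x))"
    unfolding J_expansion[OF x, symmetric] by (simp add: cvec.scale_sum_right)
  finally have "(\<Sum>a<2*l. \<Sum>b<2*l. J (lie (X a b) (so_gen l b a))) =
      smul (dual_coxeter l * 2 - - dual_coxeter l * 2) (J x)"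
    by (simp only: cvec.scale_left_diff_distrib cvec.scale_scale)
  moreover have "dual_coxeter l * 2 - - dual_coxeter l * 2 = 4 * dual_coxeter l" by simp
  ultimately show ?thesis by (simp only: X_def)
qed

text \<open>The central terms with the two factors give 2k each, and the double bracket gives four
  times the dual Coxeter number. This is the origin of the shift of k.\<close>

lemma current_casimir_vector_1:
  assumes x: "x \<in> so_alg l"
  shows "nprod V (J x) 1 casimir_vector = smul (4 * (k + dual_coxeter l)) (J x)"
proof -
  have lin: "linear_on (vcarrier V) (nprod V (G a b) (-1))" if "a < 2*l" "b < 2*l" for a b
    using VV.mode_linear G_in that by blast
  have "nprod V (J x) 1 casimir_vector = (\<Sum>a<2*l. \<Sum>b<2*l. smul (k * x $$ (a, b)) (G a b) +
     J (lie (lie x (so_gen l a b)) (so_gen l b a)) + smul (k * x $$ (b, a)) (G b a))"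
    unfolding current_casimir_vector_sum[OF x] using x
    by (simp add: J_prod0 J_prod1 so_gen_in so_alg_lie inv_form_so_gen linear_on_smul[OF lin] vac_in vac_prod G_in)
  also have "\<dots> = (\<Sum>a<2*l. \<Sum>b<2*l. smul (k * x $$ (a, b)) (G a b)) +
      smul (4 * dual_coxeter l) (J x) + (\<Sum>a<2*l. \<Sum>b<2*l. smul (k * x $$ (b, a)) (G b a))"
    by (simp only: sum.distrib double_lie_casimir[OF x])
  also have "(\<Sum>a<2*l. \<Sum>b<2*l. smul (k * x $$ (b, a)) (G b a)) =
      (\<Sum>a<2*l. \<Sum>b<2*l. smul (k * x $$ (a, b)) (G a b))"
    by (rule sum.swap)
  also have "\<dots> = smul k (smul 2 (J x))"
    unfolding J_expansion[OF x, symmetric] by (simp add: cvec.scale_sum_right)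
  finally have "nprod V (J x) 1 casimir_vector = smul (k * 2 + 4 * dual_coxeter l + k * 2) (J x)"
    by (simp only: cvec.scale_left_distrib cvec.scale_scale)
  moreover have "k * 2 + 4 * dual_coxeter l + k * 2 = 4 * (k + dual_coxeter l)" by simp
  ultimately show ?thesis by (simp only:)
qed

text \<open>Only m = 2 needs care: there the currents pair to multiples of the vacuum, with the
  total coefficient that \<open>casimir_trace\<close> makes zero.\<close>

lemma current_casimir_vector_ge2:
  assumes x: "x \<in> so_alg l" and m: "m \<ge> 2"
  shows "nprod V (J x) m casimir_vector = 0"
proof -
  have "nprod V (J x) m casimir_vector =
      (\<Sum>a<2*l. \<Sum>b<2*l. nprod V (J (lie x (so_gen l a b))) (m - 1) (G b a))"
    unfolding current_casimir_vector_sum[OF x] using x m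
    by (simp add: J_prod2 so_gen_in VV.mode_zero G_in)
  also have "\<dots> = 0"
  proof (cases "m = 2")
    case True
    then have "(\<Sum>a<2*l. \<Sum>b<2*l. nprod V (J (lie x (so_gen l a b))) (m - 1) (G b a)) =
        (\<Sum>a<2*l. \<Sum>b<2*l. smul (k * inv_form l (lie x (so_gen l a b)) (so_gen l b a)) (vac V))"
      using x by (simp add: J_prod1 so_alg_lie so_gen_in)
    also have "\<dots> = smul (k * (\<Sum>a<2*l. \<Sum>b<2*l. inv_form l (lie x (so_gen l a b)) (so_gen l b a))) (vac V)"
      by (simp add: cvec.scale_sum_left sum_distrib_left)
    finally show ?thesis using casimir_trace[OF x] by simp
  next
    case False
    then show ?thesis using x m by (simp add: J_prod2 so_alg_lie so_gen_in)
  qed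
  finally show ?thesis .
qed

lemma sugawara_eq: "sugawara l k V J = smul (1 / (4 * (k + dual_coxeter l))) casimir_vector"
  by (simp add: sugawara_def casimir_vector_def)

lemma sugawara_in: "sugawara l k V J \<in> vcarrier V"
  unfolding sugawara_eq using casimir_vector_in V_subspace by (rule cvec.subspace_scale[rotated])

lemma current_sugawara:
  assumes "x \<in> so_alg l" "k + dual_coxeter l \<noteq> 0"
  shows "nprod V (J x) (int i) (sugawara l k V J) = (if i = 1 then J x else 0)"
proof -
  have "nprod V (J x) (int i) (sugawara l k V J) =
      smul (1 / (4 * (k + dual_coxeter l))) (nprod V (J x) (int i) casimir_vector)"
    unfolding sugawara_eq using linear_on_smul[OF VV.mode_linear casimir_vector_in] J_in[OF assms(1)] by blast
  moreover have "nprod V (J x) (int i) casimir_vector =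
      (if i = 1 then smul (4 * (k + dual_coxeter l)) (J x) else 0)"
  proof -
    consider "i = 0" | "i = 1" | "int i \<ge> 2" by linarith
    then show ?thesis
    proof cases
      case 1
      then show ?thesis using current_casimir_vector_0[OF assms(1)] by simp
    next
      case 2
      then show ?thesis using current_casimir_vector_1[OF assms(1)] by simp
    next
      case 3
      then show ?thesis using current_casimir_vector_ge2[OF assms(1) 3] by auto
    qed
  qed
  moreover have "1 / (4 * c) * (4 * c) = 1" if "c \<noteq> 0" for c :: complex
    using that by simp
  note this[OF assms(2)]
  ultimately show ?thesis
    by (cases "i = 1") (simp_all only: simp_thms if_True if_False cvec.scale_scale cvec.scale_one cvec.scale_zero_right)
qed

text \<open>This is [x t^n, L_0] = n x t^n. It follows from the products of a current with the
  Sugawara vector, so no Virasoro relation enters.\<close>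

lemma current_sugawara_mode:
  assumes x: "x \<in> so_alg l" and k: "k + dual_coxeter l \<noteq> 0" and u: "u \<in> M"
  shows "Y (J x) n (Y (sugawara l k V J) 1 u) =
     Y (sugawara l k V J) 1 (Y (J x) n u) + smul (of_int n) (Y (J x) n u)"
proof -
  have "Y (J x) n (Y (sugawara l k V J) 1 u) - Y (sugawara l k V J) 1 (Y (J x) n u) =
     Sum_any (\<lambda>i. smul (of_int n gchoose i) (Y (nprod V (J x) (int i) (sugawara l k V J)) (n + 1 - int i) u))"
    by (rule mode_commutator[OF J_in[OF x] sugawara_in u])
  also have "\<dots> = smul (of_int n) (Y (J x) n u)"
    by (subst Sum_any_single[where j = 1]) (use current_sugawara[OF x k] current_sugawara[OF x k, of 1] in \<open>auto simp: mode_zero_left[OF u]\<close>)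
  finally show ?thesis by (simp add: algebra_simps)
qed

end

section \<open>Quotient modules\<close>

text \<open>Finiteness matters: \<open>Sum_any\<close> is 0 on an infinite support, while f could
  make the support finite.\<close>

lemma linear_on_Sum_any:
  assumes "linear_on S f" "cvec.subspace S" "finite {i. g i \<noteq> 0}" "\<And>i. g i \<in> S"
  shows "f (Sum_any g) = Sum_any (\<lambda>i. f (g i))"
proof -
  have "Sum_any (\<lambda>i. f (g i)) = (\<Sum>i | g i \<noteq> 0. f (g i))"
    using linear_on_zero[OF assms(1,2)] by (intro Sum_any.expand_superset assms(3)) force
  then show ?thesis
    unfolding Sum_any.expand_set using linear_on_sum[OF assms(1,2)] assms(4) by metis
qed

context field_family begin

interpretation V: field_family V "vcarrier V" "nprod V"
  using vertex_algebra by unfold_locales (auto simp: vertex_algebra_def)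

text \<open>Truncation bounds i through the products of a and b on one side, and through the modes
  applied directly to u on the other.\<close>

lemma borcherds_support:
  assumes "a \<in> vcarrier V" "b \<in> vcarrier V" "u \<in> M"
  shows "finite {i. smul (of_int p gchoose i) (Y (nprod V a (r + int i) b) (p + q - int i) u) \<noteq> 0}"
    and "finite {i. smul ((-1) ^ i * (of_int r gchoose i))
          (Y a (p + r - int i) (Y b (q + int i) u)
           - smul ((-1) powi r) (Y b (q + r - int i) (Y a (p + int i) u))) \<noteq> 0}"
proof -
  obtain N where N: "\<And>n. n \<ge> N \<Longrightarrow> nprod V a n b = 0" using V.mode_truncation assms by blast
  obtain A where A: "\<And>n. n \<ge> A \<Longrightarrow> Y a n u = 0" using mode_truncation assms by blast
  obtain B where B: "\<And>n. n \<ge> B \<Longrightarrow> Y b n u = 0" using mode_truncation assms by blast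
  show "finite {i. smul (of_int p gchoose i) (Y (nprod V a (r + int i) b) (p + q - int i) u) \<noteq> 0}"
    by (rule finite_subset[of _ "{..<nat (N - r)}"])
      (auto simp: N mode_zero_left[OF assms(3)] not_less intro: ccontr)
  show "finite {i. smul ((-1) ^ i * (of_int r gchoose i))
          (Y a (p + r - int i) (Y b (q + int i) u)
           - smul ((-1) powi r) (Y b (q + r - int i) (Y a (p + int i) u))) \<noteq> 0}"
  proof (rule finite_subset[of _ "{..<nat (B - q) + nat (A - p)}"], rule subsetI, rule ccontr)
    fix i assume i: "i \<in> {i. smul ((-1) ^ i * (of_int r gchoose i))
          (Y a (p + r - int i) (Y b (q + int i) u)
           - smul ((-1) powi r) (Y b (q + r - int i) (Y a (p + int i) u))) \<noteq> 0}"
      "i \<notin> {..<nat (B - q) + nat (A - p)}"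
    then have "q + int i \<ge> B" "p + int i \<ge> A" by auto
    then show False using i A B assms by (simp add: mode_zero)
  qed simp
qed

text \<open>Every axiom is pushed along g by the intertwining relation; the finite supports let g
  pass through the Borcherds sums.\<close>

lemma fields_on_image:
  assumes g: "linear_on M g" and YY: "\<And>a n w. a \<in> vcarrier V \<Longrightarrow> w \<in> M \<Longrightarrow> Y' a n (g w) = g (Y a n w)"
  shows "fields_on V (g ` M) Y'"
  unfolding fields_on_def
proof (intro conjI ballI allI)
  show "cvec.subspace (g ` M)" by (rule subspace_linear_image[OF subspace g])
next
  fix a n u assume "a \<in> vcarrier V" "u \<in> g ` M"
  then show "Y' a n u \<in> g ` M" using YY mode_in by auto
next
  fix a n assume a: "a \<in> vcarrier V"
  have "Y' a n (g v + g w) = Y' a n (g v) + Y' a n (g w)" if "v \<in> M" "w \<in> M" for v w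
    using YY[OF a, of "v + w" n] YY[OF a that(1)] YY[OF a that(2)] that subspace mode_in[OF a]
    by (simp add: linear_on_add[OF g] linear_on_add[OF mode_linear[OF a]] cvec.subspace_add)
  moreover have "Y' a n (smul c (g v)) = smul c (Y' a n (g v))" if "v \<in> M" for c v
    using YY[OF a, of "smul c v" n] YY[OF a that(1)] that subspace mode_in[OF a]
    by (simp add: linear_on_smul[OF g] linear_on_smul[OF mode_linear[OF a]] cvec.subspace_scale)
  ultimately show "linear_on (g ` M) (Y' a n)" by (auto simp: linear_on_def)
next
  fix n u assume "u \<in> g ` M"
  then obtain w where w: "w \<in> M" "u = g w" by blast
  then show "linear_on (vcarrier V) (\<lambda>a. Y' a n u)"
    using mode_linear_left[OF w(1), of n] V_subspace
    by (simp add: linear_on_def YY mode_in linear_on_add[OF g] linear_on_smul[OF g]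
        cvec.subspace_add cvec.subspace_scale)
next
  fix a u assume "a \<in> vcarrier V" "u \<in> g ` M"
  then show "\<exists>N. \<forall>n\<ge>N. Y' a n u = 0"
  proof -
    from \<open>u \<in> g ` M\<close> obtain w where w: "w \<in> M" "u = g w" by blast
    obtain N where "\<forall>n\<ge>N. Y a n w = 0" using mode_truncation[OF \<open>a \<in> _\<close> w(1)] by blast
    then have "\<forall>n\<ge>N. Y' a n u = 0" using YY[OF \<open>a \<in> _\<close> w(1)] w(2) linear_on_zero[OF g subspace] by simp
    then show ?thesis by blast
  qed
next
  fix n u assume "u \<in> g ` M"
  then show "Y' (vac V) n u = (if n = -1 then u else 0)"
    using vac_in linear_on_zero[OF g subspace] by (auto simp: YY mode_vac)
next
  fix a b u p q r assume a: "a \<in> vcarrier V" and b: "b \<in> vcarrier V" and "u \<in> g ` M"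
  then obtain w where w: "w \<in> M" "u = g w" by blast
  let ?L = "\<lambda>i. smul (of_int p gchoose i) (Y (nprod V a (r + int i) b) (p + q - int i) w)"
  let ?R = "\<lambda>i. smul ((-1) ^ i * (of_int r gchoose i))
          (Y a (p + r - int i) (Y b (q + int i) w)
           - smul ((-1) powi r) (Y b (q + r - int i) (Y a (p + int i) w)))"
  note mem = cvec.subspace_scale[OF subspace] cvec.subspace_diff[OF subspace] mode_in V_mode_in a b w(1)
  have "Sum_any (\<lambda>i. smul (of_int p gchoose i) (Y' (nprod V a (r + int i) b) (p + q - int i) u)) =
      Sum_any (\<lambda>i. g (?L i))"
    by (simp add: w(2) YY linear_on_smul[OF g] mem)
  also have "\<dots> = g (Sum_any ?L)"
    by (intro linear_on_Sum_any[OF g subspace, symmetric] borcherds_support mem)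
  also have "\<dots> = g (Sum_any ?R)" using borcherds[OF a b w(1), of p r q] by simp
  also have "\<dots> = Sum_any (\<lambda>i. g (?R i))"
    by (intro linear_on_Sum_any[OF g subspace] borcherds_support mem)
  also have "\<dots> = Sum_any (\<lambda>i. smul ((-1) ^ i * (of_int r gchoose i))
          (Y' a (p + r - int i) (Y' b (q + int i) u)
           - smul ((-1) powi r) (Y' b (q + r - int i) (Y' a (p + int i) u))))"
    by (simp add: w(2) YY linear_on_smul[OF g] linear_on_diff[OF g subspace] mem)
  finally show "Sum_any (\<lambda>i. smul (of_int p gchoose i) (Y' (nprod V a (r + int i) b) (p + q - int i) u)) =
      Sum_any (\<lambda>i. smul ((-1) ^ i * (of_int r gchoose i))
          (Y' a (p + r - int i) (Y' b (q + int i) u)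
           - smul ((-1) powi r) (Y' b (q + r - int i) (Y' a (p + int i) u))))" .
qed

end

lemma va_module_quotient:
  assumes V: "vertex_algebra V" and M: "va_module V M" and N: "va_submodule V M N"
  obtains Q g where "va_module V Q" "va_hom V M Q g" "g ` mcarrier M = mcarrier Q"
    "{u \<in> mcarrier M. g u = 0} = N"
proof -
  interpret field_family V "mcarrier M" "mode M"
    using V M by unfold_locales (simp_all add: va_module_def)
  have N': "cvec.subspace N" "N \<subseteq> mcarrier M" "\<And>a n u. a \<in> vcarrier V \<Longrightarrow> u \<in> N \<Longrightarrow> mode M a n u \<in> N"
    using N by (auto simp: va_submodule_def)
  obtain p where p: "Vector_Spaces.linear smul smul p" "p ` mcarrier M \<subseteq> mcarrier M"
    "\<And>x. x \<in> mcarrier M \<Longrightarrow> p x = 0 \<longleftrightarrow> x \<in> N" "\<And>x. x \<in> mcarrier M \<Longrightarrow> x - p x \<in> N"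
    using exists_projection[OF subspace N'(1,2)] by blast
  have lin: "linear_on (mcarrier M) p" by (rule linear_on_linear[OF p(1)])
  define Q where "Q = \<lparr>mcarrier = p ` mcarrier M, mode = \<lambda>a n u. p (mode M a n u)\<rparr>"
  \<comment> \<open>Independence of the representative: w and \<open>p w\<close> differ by an
    element of N, which the modes keep in N and p kills.\<close>
  have pp: "p (mode M a n (p w)) = p (mode M a n w)" if a: "a \<in> vcarrier V" and w: "w \<in> mcarrier M" for a n w
  proof -
    have "mode M a n (w - p w) \<in> N" using N' p(4) that by blast
    moreover have "mode M a n (w - p w) = mode M a n w - mode M a n (p w)"
      using p(2) w by (intro linear_on_diff[OF mode_linear[OF a] subspace]) auto
    moreover have "p (mode M a n w - mode M a n (p w)) = p (mode M a n w) - p (mode M a n (p w))"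
      by (rule cvec_pair.linear_diff[OF p(1)])
    ultimately show ?thesis using p(3)[of "mode M a n w - mode M a n (p w)"] N'(2) by auto
  qed
  show thesis
  proof (rule that)
    show "va_module V Q"
      unfolding va_module_def Q_def using fields_on_image[OF lin] pp by simp
    show "va_hom V M Q p"
      using lin pp by (simp add: va_hom_def Q_def)
    show "p ` mcarrier M = mcarrier Q" by (simp add: Q_def)
    show "{u \<in> mcarrier M. p u = 0} = N" using p(3) N'(2) by blast
  qed
qed

lemma va_module_submodule:
  assumes V: "vertex_algebra V" and M: "va_module V M" and N: "va_submodule V M N"
  shows "va_module V (M\<lparr>mcarrier := N\<rparr>)"
proof -
  interpret field_family V "mcarrier M" "mode M"
    using V M by unfold_locales (simp_all add: va_module_def)
  have N: "cvec.subspace N" "\<And>a n u. a \<in> vcarrier V \<Longrightarrow> u \<in> N \<Longrightarrow> mode M a n u \<in> N"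
    and NM: "\<And>u. u \<in> N \<Longrightarrow> u \<in> mcarrier M"
    using N by (auto simp: va_submodule_def)
  have "linear_on N (mode M a n)" if "a \<in> vcarrier V" for a n
    using linear_on_subset[OF mode_linear[OF that]] NM by blast
  then have "fields_on V N (mode M)"
    unfolding fields_on_def
    by (intro conjI ballI allI) (fact N | rule borcherds mode_linear_left mode_truncation mode_vac | blast intro: NM N)+
  then show ?thesis by (simp add: va_module_def)
qed

section \<open>The affine action\<close>

locale affine_va =
  fixes l :: nat and k :: complex and V :: "'v valg" and J :: "complex mat \<Rightarrow> 'v cvec"
  assumes affine_va: "simple_affine_va l k V J"
begin

lemma vertex_algebra: "vertex_algebra V"
  using affine_va by (simp add: simple_affine_va_def)

lemma current_fields: "va_module V M \<Longrightarrow> current_fields V (mcarrier M) (mode M) l k J"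
  using vertex_algebra affine_va by unfold_locales (simp_all add: va_module_def)

lemma act_mcarrier [simp]: "act l k V J (M\<lparr>mcarrier := N\<rparr>) = act l k V J M"
proof (intro ext)
  fix X u show "act l k V J (M\<lparr>mcarrier := N\<rparr>) X u = act l k V J M X u" by (cases X) simp_all
qed

lemma act_h_mcarrier [simp]: "act_h l k V J (M\<lparr>mcarrier := N\<rparr>) = act_h l k V J M"
  by (intro ext) (simp add: act_h_def)

lemma act_stable:
  assumes M: "va_module V M" and N: "va_submodule V M N" and X: "X \<in> affine_span l" and u: "u \<in> N"
  shows "act l k V J M X u \<in> N"
proof -
  interpret current_fields V "mcarrier M" "mode M" l k J by (rule current_fields[OF M])
  show ?thesis using X N u J_in sugawara_in
    by (auto simp: affine_span_def va_submodule_def cvec.subspace_scale cvec.subspace_neg)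
qed

text \<open>By the associativity formula, the elements of \<open>V\<close> all of whose modes preserve a subspace form
  a vertex subalgebra.\<close>

lemma affine_submodule_iff:
  assumes M: "va_module V M"
  shows "affine_submodule l k V J M N \<longleftrightarrow> va_submodule V M N"
proof
  interpret current_fields V "mcarrier M" "mode M" l k J by (rule current_fields[OF M])
  assume N: "affine_submodule l k V J M N"
  then have N': "cvec.subspace N" "N \<subseteq> mcarrier M"
    and act: "\<And>X u. X \<in> affine_span l \<Longrightarrow> u \<in> N \<Longrightarrow> act l k V J M X u \<in> N"
    by (auto simp: affine_submodule_def)
  define U where "U = {a \<in> vcarrier V. \<forall>n. \<forall>u\<in>N. mode M a n u \<in> N}"
  have NM: "u \<in> mcarrier M" if "u \<in> N" for u using that N' by blast
  have "cvec.subspace U"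
  proof (rule cvec.subspaceI)
    show "0 \<in> U"
      using N' V_subspace by (simp add: U_def cvec.subspace_0 mode_zero_left NM)
  next
    fix x y assume "x \<in> U" "y \<in> U"
    then show "x + y \<in> U"
      using N' V_subspace by (simp add: U_def cvec.subspace_add linear_on_add[OF mode_linear_left] NM)
  next
    fix c x assume "x \<in> U"
    then show "smul c x \<in> U"
      using N' V_subspace by (simp add: U_def cvec.subspace_scale linear_on_smul[OF mode_linear_left] NM)
  qed
  moreover have "U \<subseteq> vcarrier V" by (auto simp: U_def)
  moreover have "vac V \<in> U"
    using N' vac_in by (simp add: U_def mode_vac cvec.subspace_0 NM)
  moreover have "J ` so_alg l \<subseteq> U"
  proof
    fix a assume "a \<in> J ` so_alg l"
    then obtain x where x: "x \<in> so_alg l" "a = J x" by blast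
    have "mode M a n u \<in> N" if "u \<in> N" for n u
      using act[of "Loop x n" u] x that by (simp add: affine_span_def)
    then show "a \<in> U" using J_in x by (simp add: U_def)
  qed
  moreover have "nprod V a n b \<in> U" if "a \<in> U" "b \<in> U" for a b n
  proof -
    have ab: "a \<in> vcarrier V" "b \<in> vcarrier V" using that by (auto simp: U_def)
    have "mode M (nprod V a n b) m u \<in> N" if u: "u \<in> N" for m u
      unfolding mode_associativity[OF ab NM[OF u]]
      using \<open>a \<in> U\<close> \<open>b \<in> U\<close> u N'(1)
      by (intro Sum_any_in_subspace[OF N'(1)] cvec.subspace_scale cvec.subspace_diff) (simp_all add: U_def)
    then show ?thesis using V_mode_in ab by (auto simp: U_def)
  qed
  ultimately have "U = vcarrier V"
    using J_generate unfolding va_generated_by_def by (elim conjE allE[of _ U]) simp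
  then show "va_submodule V M N"
    using N' by (auto simp: va_submodule_def U_def)
next
  assume "va_submodule V M N"
  then show "affine_submodule l k V J M N"
    using act_stable[OF M] by (auto simp: affine_submodule_def va_submodule_def)
qed

lemma act_h_linear:
  assumes M: "va_module V M" and H: "H \<in> cartan l"
  shows "linear_on (mcarrier M) (act_h l k V J M H c e)"
proof -
  interpret current_fields V "mcarrier M" "mode M" l k J by (rule current_fields[OF M])
  show ?thesis
    using mode_linear[OF J_in[OF cartan_so[OF H]], of 0] mode_linear[OF sugawara_in, of 1]
    by (simp add: linear_on_def act_h_def cvec.scale_right_distrib cvec.scale_right_diff_distrib algebra_simps)
qed

lemma act_h_stable:
  assumes M: "va_module V M" and N: "va_submodule V M N" and H: "H \<in> cartan l" and u: "u \<in> N"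
  shows "act_h l k V J M H c e u \<in> N"
proof -
  have "cvec.subspace N" using N by (simp add: va_submodule_def)
  moreover have "Loop H 0 \<in> affine_span l" "Central \<in> affine_span l" "Deriv \<in> affine_span l"
    using cartan_so[OF H] by (auto simp: affine_span_def)
  ultimately show ?thesis
    unfolding act_h_def using act_stable[OF M N _ u]
    by (intro cvec.subspace_add cvec.subspace_scale)
qed

lemma va_submodule_self: "va_module V M \<Longrightarrow> va_submodule V M (mcarrier M)"
  by (auto simp: va_module_def fields_on_def va_submodule_def)

lemma mcarrier_subspace: "va_module V M \<Longrightarrow> cvec.subspace (mcarrier M)"
  by (simp add: va_module_def fields_on_def)

lemma va_hom_linear: "va_hom V M Q g \<Longrightarrow> linear_on (mcarrier M) g"
  by (simp add: va_hom_def)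

lemma va_hom_0: "va_module V M \<Longrightarrow> va_hom V M Q g \<Longrightarrow> g 0 = 0"
  by (rule linear_on_zero[OF va_hom_linear mcarrier_subspace])

lemma va_submodule_zero: "va_module V M \<Longrightarrow> va_submodule V M {0}"
proof -
  assume M: "va_module V M"
  interpret current_fields V "mcarrier M" "mode M" l k J by (rule current_fields[OF M])
  show ?thesis by (simp add: va_submodule_def mode_zero cvec.subspace_0[OF subspace])
qed

lemma invariant_subspace_act_h:
  assumes "va_module V M" "H \<in> cartan l"
  shows "invariant_subspace (mcarrier M) (act_h l k V J M H c e)"
proof
  show "cvec.subspace (mcarrier M)" by (rule mcarrier_subspace[OF assms(1)])
qed (use assms act_h_linear act_h_stable[OF assms(1) va_submodule_self[OF assms(1)]] in auto)

end

section \<open>Generalised weight spaces\<close>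

text \<open>Points on the moment curve separate finitely many weights.\<close>

lemma weight_separation:
  assumes S: "finite S" "S \<subseteq> hdual l"
  shows "\<exists>H\<in>cartan l. \<exists>c e. inj_on (\<lambda>\<mu>. weval l \<mu> H c e) S"
proof -
  define coef :: "weight \<Rightarrow> nat \<Rightarrow> complex" where
    "coef \<mu> i = (if i < l then Poly_Mapping.lookup (fst \<mu>) i
       else if i = l then fst (snd \<mu>) else snd (snd \<mu>))" for \<mu> i
  define P where "P \<mu> x = (\<Sum>i\<le>Suc l. coef \<mu> i * x ^ i)" for \<mu> and x :: complex
  \<comment> \<open>On this curve a weight becomes a polynomial in x of degree at most l + 1 whose
    coefficients are the coordinates of the weight.\<close>
  have eval: "weval l \<mu> (wt_diag l (\<lambda>j. x ^ j)) (x ^ l) (x ^ Suc l) = P \<mu> x" for \<mu> x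
  proof -
    have "P \<mu> x = (\<Sum>i<l. coef \<mu> i * x ^ i) + coef \<mu> l * x ^ l + coef \<mu> (Suc l) * x ^ Suc l"
      unfolding P_def lessThan_Suc_atMost[symmetric] by (simp only: sum.lessThan_Suc)
    moreover have "(\<Sum>i<l. coef \<mu> i * x ^ i) =
        (\<Sum>j<l. Poly_Mapping.lookup (fst \<mu>) j * wt_diag l (\<lambda>j. x ^ j) $$ (j, j))"
      by (intro sum.cong) (auto simp: coef_def wt_diag_def)
    moreover have "coef \<mu> l = fst (snd \<mu>)" "coef \<mu> (Suc l) = snd (snd \<mu>)"
      by (simp_all add: coef_def)
    ultimately show ?thesis
      unfolding weval_def case_prod_unfold by (simp only:)
  qed
  have differ: "finite {x. P \<mu> x = P \<nu> x}" if "\<mu> \<in> hdual l" "\<nu> \<in> hdual l" "\<mu> \<noteq> \<nu>" for \<mu> \<nu>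
  proof -
    obtain m k n where \<mu>: "\<mu> = (m, k, n)" by (cases \<mu>)
    obtain m' k' n' where \<nu>: "\<nu> = (m', k', n')" by (cases \<nu>)
    have "\<exists>i\<le>Suc l. coef \<mu> i - coef \<nu> i \<noteq> 0"
    proof (rule ccontr)
      assume "\<not> ?thesis"
      then have eq: "coef \<mu> i = coef \<nu> i" if "i \<le> Suc l" for i using that by auto
      have "Poly_Mapping.lookup m i = Poly_Mapping.lookup m' i" for i
      proof (cases "i < l")
        case True
        then show ?thesis using eq[of i] by (simp add: coef_def \<mu> \<nu>)
      next
        case False
        then have "i \<notin> Poly_Mapping.keys m" "i \<notin> Poly_Mapping.keys m'"
          using that by (auto simp: hdual_def \<mu> \<nu>)
        then show ?thesis by (simp add: in_keys_iff)
      qed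
      then have "m = m'" by (rule poly_mapping_eqI)
      moreover have "k = k'" "n = n'" using eq[of l] eq[of "Suc l"] by (auto simp: coef_def \<mu> \<nu>)
      ultimately show False using that \<mu> \<nu> by simp
    qed
    then have "finite {x. (\<Sum>i\<le>Suc l. (coef \<mu> i - coef \<nu> i) * x ^ i) = 0}"
      using polyfun_finite_roots[of "\<lambda>i. coef \<mu> i - coef \<nu> i" "Suc l"] by blast
    then show ?thesis
      by (simp only: P_def left_diff_distrib sum_subtractf right_minus_eq)
  qed
  define Bad where "Bad = (\<Union>p\<in>{p \<in> S \<times> S. fst p \<noteq> snd p}. {x. P (fst p) x = P (snd p) x})"
  have "finite {p \<in> S \<times> S. fst p \<noteq> snd p}"
    by (rule finite_subset[of _ "S \<times> S"]) (use S in auto)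
  then have "finite Bad"
    unfolding Bad_def
  proof (rule finite_UN_I)
    fix p assume "p \<in> {p \<in> S \<times> S. fst p \<noteq> snd p}"
    then show "finite {x. P (fst p) x = P (snd p) x}" using S(2) by (intro differ) auto
  qed
  then obtain x where x: "x \<notin> Bad" using ex_new_if_finite[OF infinite_UNIV_char_0, of Bad] by auto
  have "inj_on (\<lambda>\<mu>. weval l \<mu> (wt_diag l (\<lambda>j. x ^ j)) (x ^ l) (x ^ Suc l)) S"
  proof (rule inj_onI)
    fix \<mu> \<nu> assume S: "\<mu> \<in> S" "\<nu> \<in> S"
      and "weval l \<mu> (wt_diag l (\<lambda>j. x ^ j)) (x ^ l) (x ^ Suc l) =
        weval l \<nu> (wt_diag l (\<lambda>j. x ^ j)) (x ^ l) (x ^ Suc l)"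
    then have eq: "P \<mu> x = P \<nu> x" by (simp only: eval)
    show "\<mu> = \<nu>"
    proof (rule ccontr)
      assume "\<mu> \<noteq> \<nu>"
      then have "(\<mu>, \<nu>) \<in> {p \<in> S \<times> S. fst p \<noteq> snd p}" using S by simp
      then have "x \<in> Bad" unfolding Bad_def by (rule UN_I) (simp add: eq)
      then show False using x by simp
    qed
  qed
  then show ?thesis
    by (intro bexI[OF _ wt_diag_cartan[of l "\<lambda>j. x ^ j"]] exI[of _ "x ^ l"] exI[of _ "x ^ Suc l"])
qed

lemma weight_eqI:
  assumes "\<mu> \<in> hdual l" "\<nu> \<in> hdual l" "\<And>H c e. H \<in> cartan l \<Longrightarrow> weval l \<mu> H c e = weval l \<nu> H c e"
  shows "\<mu> = \<nu>"
proof -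
  have "finite {\<mu>, \<nu>}" "{\<mu>, \<nu>} \<subseteq> hdual l" using assms(1,2) by auto
  from weight_separation[OF this] obtain H c e
    where H: "H \<in> cartan l" and inj: "inj_on (\<lambda>\<mu>. weval l \<mu> H c e) {\<mu>, \<nu>}"
    by (elim bexE exE)
  show ?thesis by (rule inj_onD[OF inj assms(3)[OF H]]) simp_all
qed

context affine_va begin

abbreviation gws :: "('v, 'b) vmod \<Rightarrow> weight \<Rightarrow> 'b cvec set" where
  "gws \<equiv> gen_weight_space l k V J"

lemma gws_iff:
  "u \<in> gws M \<mu> \<longleftrightarrow> u \<in> mcarrier M \<and>
     (\<forall>H\<in>cartan l. \<forall>c e. gen_eigenvector (act_h l k V J M H c e) (weval l \<mu> H c e) u)"
  by (simp add: gen_weight_space_def gen_eigenvector_def)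

lemma gws_subspace:
  assumes M: "va_module V M"
  shows "cvec.subspace (gws M \<mu>)"
proof (rule cvec.subspaceI)
  have sub: "cvec.subspace (mcarrier M)" by (rule mcarrier_subspace[OF M])
  note ev = invariant_subspace.gen_eigenvector_zero[OF invariant_subspace_act_h[OF M]]
    invariant_subspace.gen_eigenvector_add[OF invariant_subspace_act_h[OF M]]
    invariant_subspace.gen_eigenvector_smul[OF invariant_subspace_act_h[OF M]]
  show "0 \<in> gws M \<mu>"
    unfolding gws_iff by (intro conjI ballI allI ev(1) cvec.subspace_0[OF sub])
  show "x + y \<in> gws M \<mu>" if x: "x \<in> gws M \<mu>" and y: "y \<in> gws M \<mu>" for x y
  proof -
    have "gen_eigenvector (act_h l k V J M H c e) (weval l \<mu> H c e) (x + y)" if "H \<in> cartan l" for H c e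
      by (rule ev(2)[OF that]) (use x y that in \<open>simp_all add: gws_iff\<close>)
    moreover have "x + y \<in> mcarrier M" using x y by (intro cvec.subspace_add[OF sub]) (simp_all add: gws_iff)
    ultimately show ?thesis unfolding gws_iff by blast
  qed
  show "smul c x \<in> gws M \<mu>" if x: "x \<in> gws M \<mu>" for c x
  proof -
    have "gen_eigenvector (act_h l k V J M H d e) (weval l \<mu> H d e) (smul c x)" if "H \<in> cartan l" for H d e
      by (rule ev(3)[OF that]) (use x that in \<open>simp_all add: gws_iff\<close>)
    moreover have "smul c x \<in> mcarrier M" using x by (intro cvec.subspace_scale[OF sub]) (simp add: gws_iff)
    ultimately show ?thesis unfolding gws_iff by blast
  qed
qed

lemma gws_submodule:
  "N \<subseteq> mcarrier M \<Longrightarrow> gws (M\<lparr>mcarrier := N\<rparr>) \<mu> = gws M \<mu> \<inter> N"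
  by (auto simp: gws_iff)

text \<open>A Cartan element with distinct values on S reduces the claim to generalised eigenvectors
  of a single operator.\<close>

lemma weight_components:
  assumes M: "va_module V M" and N: "va_submodule V M N"
    and S: "finite S" "S \<subseteq> hdual l" and f: "\<And>\<mu>. \<mu> \<in> S \<Longrightarrow> f \<mu> \<in> gws M \<mu>"
    and sum: "(\<Sum>\<mu>\<in>S. f \<mu>) \<in> N" and \<mu>: "\<mu> \<in> S"
  shows "f \<mu> \<in> N"
proof -
  obtain H c e where H: "H \<in> cartan l" and inj: "inj_on (\<lambda>\<mu>. weval l \<mu> H c e) S"
    using weight_separation[OF S] by (elim bexE exE)
  let ?ev = "\<lambda>\<mu>. weval l \<mu> H c e"
  \<comment> \<open>The components are relabelled by their eigenvalues.\<close>
  define g where "g = f \<circ> the_inv_into S ?ev"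
  have g: "g (?ev \<nu>) = f \<nu>" if "\<nu> \<in> S" for \<nu>
    by (simp add: g_def the_inv_into_f_f[OF inj that])
  interpret invariant_subspace "mcarrier M" "act_h l k V J M H c e"
    by (rule invariant_subspace_act_h[OF M H])
  have "g (?ev \<mu>) \<in> N"
  proof (rule gen_eigenvector_components[where A = "?ev ` S"])
    show "cvec.subspace N" "N \<subseteq> mcarrier M" using N by (auto simp: va_submodule_def)
    show "act_h l k V J M H c e x \<in> N" if "x \<in> N" for x by (rule act_h_stable[OF M N H that])
    show "(\<Sum>a\<in>?ev ` S. g a) \<in> N" using sum by (simp add: sum.reindex[OF inj] g)
    show "gen_eigenvector (act_h l k V J M H c e) a (g a)" if "a \<in> ?ev ` S" for a
      using that f H by (auto simp: g gws_iff)
    show "g a \<in> mcarrier M" if "a \<in> ?ev ` S" for a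
      using that f by (auto simp: g gws_iff)
  qed (use S \<mu> in auto)
  then show ?thesis using \<mu> by (simp add: g)
qed

text \<open>Only the existence of a decomposition is kept, because it passes easily to submodules
  and images; uniqueness follows from the separation of weights.\<close>

definition weight_decomposable :: "('v, 'b) vmod \<Rightarrow> bool" where
  "weight_decomposable M \<longleftrightarrow> (\<forall>u\<in>mcarrier M. \<exists>S f. finite S \<and> S \<subseteq> hdual l \<and>
     (\<forall>\<mu>. f \<mu> \<in> gws M \<mu>) \<and> u = (\<Sum>\<mu>\<in>S. f \<mu>))"

lemma weight_decomposableE:
  assumes "weight_decomposable M" "u \<in> mcarrier M"
  obtains S f where "finite S" "S \<subseteq> hdual l" "\<And>\<mu>. f \<mu> \<in> gws M \<mu>" "u = (\<Sum>\<mu>\<in>S. f \<mu>)"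
proof -
  from bspec[OF assms(1)[unfolded weight_decomposable_def] assms(2)]
  obtain S f where S: "finite S" "S \<subseteq> hdual l" "\<forall>\<mu>. f \<mu> \<in> gws M \<mu>" "u = (\<Sum>\<mu>\<in>S. f \<mu>)"
    by (elim exE conjE)
  show thesis by (rule that[OF S(1,2) spec[OF S(3)] S(4)])
qed

text \<open>The differences of the components of two decompositions sum to 0, so
  \<open>weight_components\<close> puts each of them into the zero submodule.\<close>

lemma weight_decomposable_iff:
  assumes M: "va_module V M"
  shows "weight_decomposable M \<longleftrightarrow> (\<forall>u\<in>mcarrier M. \<exists>!f :: weight \<Rightarrow>\<^sub>0 'b cvec.
        Poly_Mapping.keys f \<subseteq> hdual l \<and>
        (\<forall>\<mu>\<in>hdual l. Poly_Mapping.lookup f \<mu> \<in> gws M \<mu>) \<and>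
        u = (\<Sum>\<mu>\<in>Poly_Mapping.keys f. Poly_Mapping.lookup f \<mu>))"
    (is "_ \<longleftrightarrow> (\<forall>u\<in>_. \<exists>!f. ?dec u f)")
proof
  note z = cvec.subspace_0[OF gws_subspace[OF M]]
  assume dec: "weight_decomposable M"
  show "\<forall>u\<in>mcarrier M. \<exists>!f. ?dec u f"
  proof (intro ballI ex_ex1I)
    fix u assume "u \<in> mcarrier M"
    obtain S f where S: "finite S" "S \<subseteq> hdual l" "\<And>\<mu>. f \<mu> \<in> gws M \<mu>" "u = (\<Sum>\<mu>\<in>S. f \<mu>)"
      by (rule weight_decomposableE[OF dec \<open>u \<in> mcarrier M\<close>]) (rule that)
    define F where "F = Abs_poly_mapping (\<lambda>\<mu>. if \<mu> \<in> S then f \<mu> else 0)"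
    have F: "Poly_Mapping.lookup F = (\<lambda>\<mu>. if \<mu> \<in> S then f \<mu> else 0)"
      unfolding F_def using S(1) by (intro Abs_poly_mapping_inverse) (auto intro: finite_subset)
    have keys: "Poly_Mapping.keys F \<subseteq> S" by (auto simp: in_keys_iff F split: if_splits)
    have "(\<Sum>\<mu>\<in>Poly_Mapping.keys F. Poly_Mapping.lookup F \<mu>) = (\<Sum>\<mu>\<in>S. Poly_Mapping.lookup F \<mu>)"
      by (rule sum.mono_neutral_left[OF S(1) keys]) (simp add: in_keys_iff)
    also have "\<dots> = u" using S(4) by (simp add: F)
    finally show "\<exists>f. ?dec u f"
      using keys S by (intro exI[of _ F]) (auto simp: F z)
  next
    fix u F F' assume F: "?dec u F" and F': "?dec u F'"
    define T where "T = Poly_Mapping.keys F \<union> Poly_Mapping.keys F'"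
    have T: "finite T" "T \<subseteq> hdual l" using F F' by (auto simp: T_def)
    have sums: "u = (\<Sum>\<mu>\<in>T. Poly_Mapping.lookup F \<mu>)" "u = (\<Sum>\<mu>\<in>T. Poly_Mapping.lookup F' \<mu>)"
      using F F' sum.mono_neutral_left[of T "Poly_Mapping.keys F" "Poly_Mapping.lookup F"]
        sum.mono_neutral_left[of T "Poly_Mapping.keys F'" "Poly_Mapping.lookup F'"]
      by (auto simp: T_def in_keys_iff)
    have comp: "Poly_Mapping.lookup F \<mu> - Poly_Mapping.lookup F' \<mu> \<in> {0}" if "\<mu> \<in> T" for \<mu>
    proof (rule weight_components[OF M va_submodule_zero[OF M] T, where \<mu> = \<mu>])
      show "Poly_Mapping.lookup F \<mu> - Poly_Mapping.lookup F' \<mu> \<in> gws M \<mu>" if "\<mu> \<in> T" for \<mu>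
        using that F F' T by (intro cvec.subspace_diff[OF gws_subspace[OF M]]) auto
      show "(\<Sum>\<mu>\<in>T. Poly_Mapping.lookup F \<mu> - Poly_Mapping.lookup F' \<mu>) \<in> {0}"
        using sums by (simp add: sum_subtractf)
    qed (rule that)
    show "F = F'"
    proof (rule poly_mapping_eqI)
      fix \<mu> show "Poly_Mapping.lookup F \<mu> = Poly_Mapping.lookup F' \<mu>"
        using comp[of \<mu>] by (cases "\<mu> \<in> T") (auto simp: T_def in_keys_iff)
    qed
  qed
next
  note z = cvec.subspace_0[OF gws_subspace[OF M]]
  assume *: "\<forall>u\<in>mcarrier M. \<exists>!f. ?dec u f"
  show "weight_decomposable M"
    unfolding weight_decomposable_def
  proof
    fix u assume "u \<in> mcarrier M"
    then obtain F where F: "?dec u F" using * by blast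
    let ?f = "\<lambda>\<mu>. if \<mu> \<in> Poly_Mapping.keys F then Poly_Mapping.lookup F \<mu> else 0"
    show "\<exists>S f. finite S \<and> S \<subseteq> hdual l \<and> (\<forall>\<mu>. f \<mu> \<in> gws M \<mu>) \<and> u = (\<Sum>\<mu>\<in>S. f \<mu>)"
      using F z by (intro exI[of _ "Poly_Mapping.keys F"] exI[of _ ?f]) auto
  qed
qed

section \<open>Homomorphisms and generalised weight spaces\<close>

lemma act_hom:
  assumes "va_module V M" "va_module V Q" "va_hom V M Q g" "X \<in> affine_span l" "u \<in> mcarrier M"
  shows "g (act l k V J M X u) = act l k V J Q X (g u)"
proof -
  interpret current_fields V "mcarrier M" "mode M" l k J by (rule current_fields[OF assms(1)])
  have g: "linear_on (mcarrier M) g" "\<And>a n. a \<in> vcarrier V \<Longrightarrow> g (mode M a n u) = mode Q a n (g u)"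
    using assms by (auto simp: va_hom_def)
  show ?thesis
    using assms(4,5) by (auto simp: affine_span_def g linear_on_smul[OF g(1)] linear_on_minus[OF g(1)]
        J_in sugawara_in mode_in)
qed

lemma act_h_hom:
  assumes M: "va_module V M" and Q: "va_module V Q" and g: "va_hom V M Q g"
    and H: "H \<in> cartan l" and u: "u \<in> mcarrier M"
  shows "g (act_h l k V J M H c e u) = act_h l k V J Q H c e (g u)"
proof -
  have lin: "linear_on (mcarrier M) g" by (rule va_hom_linear[OF g])
  have sub: "cvec.subspace (mcarrier M)" by (rule mcarrier_subspace[OF M])
  have X: "Loop H 0 \<in> affine_span l" "Central \<in> affine_span l" "Deriv \<in> affine_span l"
    using cartan_so[OF H] by (auto simp: affine_span_def)
  note st = act_stable[OF M va_submodule_self[OF M] _ u]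
  show ?thesis
    unfolding act_h_def
    using X st act_hom[OF M Q g _ u]
    by (simp only: linear_on_add[OF lin] linear_on_smul[OF lin] cvec.subspace_add[OF sub]
        cvec.subspace_scale[OF sub])
qed

lemma act_h_shift_hom:
  assumes M: "va_module V M" and Q: "va_module V Q" and g: "va_hom V M Q g"
    and H: "H \<in> cartan l" and u: "u \<in> mcarrier M"
  shows "g (((\<lambda>u. act_h l k V J M H c e u - smul a u) ^^ n) u) =
     ((\<lambda>u. act_h l k V J Q H c e u - smul a u) ^^ n) (g u)"
proof (induction n)
  case (Suc n)
  interpret invariant_subspace "mcarrier M" "act_h l k V J M H c e"
    by (rule invariant_subspace_act_h[OF M H])
  have lin: "linear_on (mcarrier M) g" by (rule va_hom_linear[OF g])
  show ?case
    using Suc shift_pow_in[OF u] inv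
    by (simp add: linear_on_diff[OF lin sub] linear_on_smul[OF lin] act_h_hom[OF M Q g H] cvec.subspace_scale[OF sub])
qed simp

lemma gws_hom:
  assumes M: "va_module V M" and Q: "va_module V Q" and g: "va_hom V M Q g" and u: "u \<in> gws M \<mu>"
  shows "g u \<in> gws Q \<mu>"
proof -
  have "g 0 = 0" by (rule va_hom_0[OF M g])
  then have "gen_eigenvector (act_h l k V J Q H c e) a (g u)"
    if "gen_eigenvector (act_h l k V J M H c e) a u" "H \<in> cartan l" "u \<in> mcarrier M" for H c e a
  proof -
    obtain n where "((\<lambda>u. act_h l k V J M H c e u - smul a u) ^^ n) u = 0"
      using \<open>gen_eigenvector _ a u\<close> by (auto simp: gen_eigenvector_def)
    then have "((\<lambda>u. act_h l k V J Q H c e u - smul a u) ^^ n) (g u) = 0"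
      using act_h_shift_hom[OF M Q g \<open>H \<in> _\<close> \<open>u \<in> mcarrier M\<close>, where n = n and a = a] \<open>g 0 = 0\<close> by metis
    then show ?thesis by (auto simp: gen_eigenvector_def)
  qed
  then show ?thesis using u g by (auto simp: gws_iff va_hom_def)
qed

text \<open>Exactness on the left: an injective homomorphism reflects the vanishing of powers of the
  shifted Cartan operators.\<close>

lemma gws_hom_inj:
  assumes M: "va_module V M" and Q: "va_module V Q" and g: "va_hom V M Q g"
    and inj: "inj_on g (mcarrier M)" and u: "u \<in> mcarrier M" "g u \<in> gws Q \<mu>"
  shows "u \<in> gws M \<mu>"
proof -
  have glin: "linear_on (mcarrier M) g" "cvec.subspace (mcarrier M)"
    by (rule va_hom_linear[OF g], rule mcarrier_subspace[OF M])
  have "gen_eigenvector (act_h l k V J M H c e) a u"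
    if ev: "gen_eigenvector (act_h l k V J Q H c e) a (g u)" and H: "H \<in> cartan l" for H c e a
  proof -
    interpret invariant_subspace "mcarrier M" "act_h l k V J M H c e"
      by (rule invariant_subspace_act_h[OF M H])
    obtain n where "((\<lambda>u. act_h l k V J Q H c e u - smul a u) ^^ n) (g u) = 0"
      using ev by (auto simp: gen_eigenvector_def)
    then have "g ((shift a ^^ n) u) = g 0"
      using act_h_shift_hom[OF M Q g H u(1)] linear_on_zero[OF glin] by simp
    then have "(shift a ^^ n) u = 0"
      using inj_onD[OF inj] shift_pow_in[OF u(1)] cvec.subspace_0[OF sub] by blast
    then show ?thesis by (auto simp: gen_eigenvector_def)
  qed
  then show ?thesis using u by (auto simp: gws_iff)
qed

text \<open>Exactness on the right: any preimage of q is decomposed into weight components, and the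
  one at \<mu> already maps to q.\<close>

lemma gws_hom_image:
  assumes M: "va_module V M" and Q: "va_module V Q" and g: "va_hom V M Q g"
    and surj: "g ` mcarrier M = mcarrier Q" and dec: "weight_decomposable M" and \<mu>: "\<mu> \<in> hdual l"
  shows "g ` gws M \<mu> = gws Q \<mu>"
proof
  show "g ` gws M \<mu> \<subseteq> gws Q \<mu>" using gws_hom[OF M Q g] by blast
  show "gws Q \<mu> \<subseteq> g ` gws M \<mu>"
  proof
    fix q assume q: "q \<in> gws Q \<mu>"
    then have "q \<in> g ` mcarrier M" using surj by (simp add: gws_iff)
    then obtain u where u: "u \<in> mcarrier M" "q = g u" by blast
    obtain S f where S: "finite S" "S \<subseteq> hdual l" and f: "\<And>\<nu>. f \<nu> \<in> gws M \<nu>" and u_sum: "u = (\<Sum>\<nu>\<in>S. f \<nu>)"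
      by (rule weight_decomposableE[OF dec u(1)]) (rule that)
    \<comment> \<open>Extended by 0, since \<mu> may be missing from S.\<close>
    define F where "F \<nu> = (if \<nu> \<in> S then f \<nu> else 0)" for \<nu>
    define T where "T = insert \<mu> S"
    have T: "finite T" "T \<subseteq> hdual l" "\<mu> \<in> T" using S \<mu> by (auto simp: T_def)
    have F: "F \<nu> \<in> gws M \<nu>" for \<nu>
      using f cvec.subspace_0[OF gws_subspace[OF M]] by (simp add: F_def)
    have "u = (\<Sum>\<nu>\<in>T. F \<nu>)"
      using u_sum S(1) by (auto simp: T_def F_def intro!: sum.mono_neutral_cong_left)
    moreover have "linear_on (mcarrier M) g" "cvec.subspace (mcarrier M)"
      by (rule va_hom_linear[OF g], rule mcarrier_subspace[OF M])
    ultimately have q_sum: "q = (\<Sum>\<nu>\<in>T. g (F \<nu>))"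
      using u(2) linear_on_sum[of "mcarrier M" g T F] F by (simp add: gws_iff)
    \<comment> \<open>Subtracting q at \<mu> turns the decomposition of q into one of 0, so the
      component at \<mu> vanishes.\<close>
    define h where "h \<nu> = g (F \<nu>) - (if \<nu> = \<mu> then q else 0)" for \<nu>
    have "h \<nu> \<in> gws Q \<nu>" for \<nu>
      using gws_hom[OF M Q g F] q gws_subspace[OF Q] by (simp add: h_def cvec.subspace_diff)
    moreover have "(\<Sum>\<nu>\<in>T. h \<nu>) \<in> {0}"
      using T q_sum by (simp add: h_def sum_subtractf)
    ultimately have "h \<mu> \<in> {0}"
      by (rule weight_components[OF Q va_submodule_zero[OF Q] T(1,2) _ _ T(3)])
    then have "q = g (F \<mu>)" by (simp add: h_def)
    then show "q \<in> g ` gws M \<mu>" using F by blast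
  qed
qed

end

section \<open>The weights \<open>z \<rho> - \<rho>\<close>\<close>

definition wcoord :: "weight \<Rightarrow> nat \<Rightarrow> complex" where
  "wcoord \<mu> j = Poly_Mapping.lookup (fst \<mu>) j"

lemma weight_eq_iff: "\<mu> = \<nu> \<longleftrightarrow> (\<forall>j. wcoord \<mu> j = wcoord \<nu> j) \<and> snd \<mu> = snd \<nu>"
  by (auto simp: wcoord_def prod_eq_iff intro: poly_mapping_eqI)

lemma wcoord_simps [simp]:
  "wcoord (\<mu> + \<nu>) j = wcoord \<mu> j + wcoord \<nu> j"
  "wcoord (\<mu> - \<nu>) j = wcoord \<mu> j - wcoord \<nu> j"
  "wcoord (- \<mu>) j = - wcoord \<mu> j"
  "wcoord 0 j = 0"
  "wcoord (wscale c \<mu>) j = c * wcoord \<mu> j"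
  "wcoord (eps i) j = of_bool (j = i)"
  "wcoord Lambda0 j = 0"
  "wcoord delta j = 0"
  by (auto simp: wcoord_def lookup_add lookup_minus wscale_def eps_def Lambda0_def delta_def
      lookup_single when_def split: prod.splits)

lemma snd_weight_simps [simp]:
  "snd (wscale c \<mu>) = (c * fst (snd \<mu>), c * snd (snd \<mu>))"
  "snd (eps i) = 0" "snd Lambda0 = (1, 0)" "snd delta = (0, 1)"
  by (auto simp: wscale_def eps_def Lambda0_def delta_def zero_prod_def split: prod.splits)

lemma wcoord_sum: "wcoord (\<Sum>i\<in>I. f i) j = (\<Sum>i\<in>I. wcoord (f i) j)"
  by (induction I rule: infinite_finite_induct) auto

lemma wform_eq: "wform l \<mu> \<nu> = (\<Sum>j<l. wcoord \<mu> j * wcoord \<nu> j) +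
    fst (snd \<mu>) * snd (snd \<nu>) + snd (snd \<mu>) * fst (snd \<nu>)"
  by (simp add: wform_def wcoord_def case_prod_unfold)

lemma hdual_iff: "\<mu> \<in> hdual l \<longleftrightarrow> (\<forall>j\<ge>l. wcoord \<mu> j = 0)"
proof -
  obtain m k n where \<mu>: "\<mu> = (m, k, n)" by (cases \<mu>)
  have "(Poly_Mapping.keys m \<subseteq> {..<l}) \<longleftrightarrow> (\<forall>j\<ge>l. Poly_Mapping.lookup m j = 0)"
    unfolding subset_iff in_keys_iff lessThan_iff not_less[symmetric] by blast
  then show ?thesis by (simp add: \<mu> hdual_def wcoord_def)
qed

text \<open>The last finiteness condition of the category ranges over arbitrary \<nu> above \<mu>,
  whereas images of weight spaces are controlled for weights in \<open>hdual l\<close>; this bridges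
  the gap.\<close>

lemma hdual_Q_plus:
  assumes l: "l \<ge> 2" and "\<mu> \<in> hdual l" "\<nu> - \<mu> \<in> Q_plus l"
  shows "\<nu> \<in> hdual l"
proof -
  obtain c :: "nat \<Rightarrow> nat" where c: "\<nu> - \<mu> = (\<Sum>i\<le>l. wscale (of_nat (c i)) (simple_root l i))"
    using assms(3) by (auto simp: Q_plus_def)
  have "wcoord \<nu> j = 0" if j: "j \<ge> l" for j
  proof -
    have "wcoord (simple_root l i) j = 0" if "i \<le> l" for i
      using j l that by (auto simp: simple_root_def)
    then have "wcoord (\<nu> - \<mu>) j = 0" unfolding c by (simp add: wcoord_sum)
    then show ?thesis using assms(2) j by (simp add: hdual_iff)
  qed
  then show ?thesis by (simp add: hdual_iff)
qed

text \<open>The roots \<open>eps i - eps j\<close> and \<open>eps i + eps j\<close> add up to twice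
  \<open>eps i\<close>. The sum runs over a set, so different pairs and signs must be shown to give
  different roots.\<close>

lemma sum_pos_roots: "(\<Sum>\<alpha>\<in>pos_roots l. \<alpha>) = (\<Sum>i<l. \<Sum>j\<in>{i<..<l}. eps i + eps i)"
proof -
  define P where "P = (SIGMA i:{..<l}. {i<..<l})"
  let ?f = "\<lambda>p. eps (fst p) - eps (snd p)" and ?g = "\<lambda>p. eps (fst p) + eps (snd p)"
  have P: "p \<in> P \<longleftrightarrow> fst p < snd p \<and> snd p < l" for p by (cases p) (auto simp: P_def)
  have fin: "finite P" by (simp add: P_def)
  have pos: "pos_roots l = ?f ` P \<union> ?g ` P"
  proof -
    have "pos_roots l = {?f p | p. p \<in> P} \<union> {?g p | p. p \<in> P}"
      unfolding pos_roots_def P by simp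
    then show ?thesis by (simp only: image_def) blast
  qed
  have injf: "inj_on ?f P"
  proof (rule inj_onI)
    fix p q assume p: "p \<in> P" "q \<in> P" and "?f p = ?f q"
    then have eq: "wcoord (?f p) t = wcoord (?f q) t" for t by simp
    have "fst p = fst q"
      using eq[of "fst p"] p by (cases "fst p = fst q"; cases "fst p = snd q") (simp_all add: P)
    moreover have "snd p = snd q"
      using eq[of "snd p"] p by (cases "snd p = fst q"; cases "snd p = snd q") (simp_all add: P)
    ultimately show "p = q" by (simp add: prod_eq_iff)
  qed
  have injg: "inj_on ?g P"
  proof (rule inj_onI)
    fix p q assume p: "p \<in> P" "q \<in> P" and "?g p = ?g q"
    then have eq: "wcoord (?g p) t = wcoord (?g q) t" for t by simp
    have "fst p = fst q \<or> fst p = snd q"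
      using eq[of "fst p"] p by (cases "fst p = fst q"; cases "fst p = snd q") (simp_all add: P)
    moreover have "snd p = fst q \<or> snd p = snd q"
      using eq[of "snd p"] p by (cases "snd p = fst q"; cases "snd p = snd q") (simp_all add: P)
    ultimately show "p = q" using p by (auto simp: prod_eq_iff P)
  qed
  have disj: "?f ` P \<inter> ?g ` P = {}"
  proof (rule ccontr)
    assume "?f ` P \<inter> ?g ` P \<noteq> {}"
    then obtain p q where p: "p \<in> P" "q \<in> P" and "?f p = ?g q" by blast
    then have "wcoord (?f p) (snd p) = wcoord (?g q) (snd p)" by simp
    then show False
      using p by (cases "snd p = fst q"; cases "snd p = snd q") (simp_all add: P)
  qed
  have "(\<Sum>\<alpha>\<in>pos_roots l. \<alpha>) = (\<Sum>p\<in>P. ?f p) + (\<Sum>p\<in>P. ?g p)"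
    unfolding pos using fin disj by (simp add: sum.union_disjoint sum.reindex[OF injf] sum.reindex[OF injg])
  also have "\<dots> = (\<Sum>p\<in>P. eps (fst p) + eps (fst p))"
    by (simp add: sum.distrib[symmetric])
  also have "\<dots> = (\<Sum>i<l. \<Sum>j\<in>{i<..<l}. eps i + eps i)"
    by (simp add: P_def sum.Sigma case_prod_unfold)
  finally show ?thesis .
qed

lemma wcoord_rho: "wcoord (rho l) j = (if j < l then of_nat (l - 1 - j) else 0)"
proof -
  have "wcoord (rho l) j = (\<Sum>i<l. of_nat (card {i<..<l}) * of_bool (j = i))"
    by (simp add: rho_def sum_pos_roots wcoord_sum sum_distrib_left)
  also have "\<dots> = (\<Sum>i<l. if i = j then of_nat (l - 1 - j) else 0)"
    by (intro sum.cong) auto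
  finally show ?thesis by simp
qed

lemma snd_rho: "snd (rho l) = 0"
proof -
  have "snd (\<Sum>i<l. \<Sum>j\<in>{i<..<l}. eps i + eps i) = 0" by (simp add: snd_sum)
  then show ?thesis by (simp add: rho_def sum_pos_roots zero_prod_def)
qed

section \<open>The shifted vacuum weight and its orbit under the finite Weyl group\<close>

definition shifted_vac :: "nat \<Rightarrow> weight" where
  "shifted_vac l = - Lambda0 + rho_hat l"

lemma shifted_vac_coord: "wcoord (shifted_vac l) j = (if j < l then of_nat (l - 1 - j) else 0)"
  and shifted_vac_snd: "snd (shifted_vac l) = (dual_coxeter l - 1, 0)"
  by (simp_all add: shifted_vac_def rho_hat_def wcoord_rho snd_rho zero_prod_def)

text \<open>The level of the shifted weight is 2l - 3, and its pairing with the highest root is (l -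
  1) + (l - 2), the same number; so the affine simple root is orthogonal to it.\<close>

lemma srefl_0_shifted_vac:
  assumes "l \<ge> 2"
  shows "srefl l 0 (shifted_vac l) = shifted_vac l"
proof -
  have "(\<Sum>j<l. wcoord (shifted_vac l) j * wcoord (simple_root l 0) j) =
      (\<Sum>j<l. (if j = 0 then - of_nat (l - 1) else 0) + (if j = 1 then - of_nat (l - 2) else 0))"
    by (intro sum.cong) (auto simp: shifted_vac_coord simple_root_def)
  also have "\<dots> = - of_nat (l - 1) - of_nat (l - 2)"
    using assms by (simp add: sum.distrib)
  also have "\<dots> = - (dual_coxeter l - 1)"
    using assms by (simp add: dual_coxeter_def of_nat_diff)
  finally have "wform l (shifted_vac l) (simple_root l 0) = 0"
    by (simp add: wform_eq shifted_vac_snd) (simp add: simple_root_def)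
  then show ?thesis by (simp add: srefl_def weight_eq_iff prod_eq_iff)
qed

text \<open>The product condition says that the number of sign changes is even, as for type D. From
  l on, where the finite reflections act trivially, the signs are normalised to 1.\<close>

definition signed_perm :: "nat \<Rightarrow> (nat \<Rightarrow> nat) \<Rightarrow> (nat \<Rightarrow> complex) \<Rightarrow> (weight \<Rightarrow> weight) \<Rightarrow> bool" where
  "signed_perm l \<sigma> s z \<longleftrightarrow> \<sigma> permutes {..<l} \<and> (\<forall>j. s j = 1 \<or> s j = -1) \<and> (\<forall>j\<ge>l. s j = 1) \<and>
     (\<Prod>j<l. s j) = 1 \<and> (\<forall>\<mu>. (\<forall>j. wcoord (z \<mu>) j = s j * wcoord \<mu> (\<sigma> j)) \<and> snd (z \<mu>) = snd \<mu>)"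

lemma signed_permD:
  assumes "signed_perm l \<sigma> s z"
  shows "\<sigma> permutes {..<l}" "s j = 1 \<or> s j = -1" "j \<ge> l \<Longrightarrow> s j = 1" "(\<Prod>j<l. s j) = 1"
    "wcoord (z \<mu>) j = s j * wcoord \<mu> (\<sigma> j)" "snd (z \<mu>) = snd \<mu>"
  using assms unfolding signed_perm_def by blast+

lemma signed_permI:
  assumes "\<sigma> permutes {..<l}" "\<And>j. s j = 1 \<or> s j = -1" "\<And>j. j \<ge> l \<Longrightarrow> s j = 1" "(\<Prod>j<l. s j) = 1"
    "\<And>\<mu> j. wcoord (z \<mu>) j = s j * wcoord \<mu> (\<sigma> j)" "\<And>\<mu>. snd (z \<mu>) = snd \<mu>"
  shows "signed_perm l \<sigma> s z"
  unfolding signed_perm_def using assms by blast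

text \<open>Coordinates are pulled back along the permutations, so these compose in the opposite
  order.\<close>

lemma signed_perm_comp:
  assumes "signed_perm l \<tau> t y" "signed_perm l \<sigma> s z"
  shows "signed_perm l (\<sigma> \<circ> \<tau>) (\<lambda>j. t j * s (\<tau> j)) (y \<circ> z)"
proof (rule signed_permI)
  note y = signed_permD[OF assms(1)] and z = signed_permD[OF assms(2)]
  show "\<sigma> \<circ> \<tau> permutes {..<l}" by (rule permutes_compose[OF y(1) z(1)])
  show "t j * s (\<tau> j) = 1 \<or> t j * s (\<tau> j) = -1" for j
    using y(2)[of j] z(2)[of "\<tau> j"] by auto
  show "t j * s (\<tau> j) = 1" if "j \<ge> l" for j
    using y(3)[OF that] z(3)[OF that] permutes_not_in[OF y(1), of j] that by simp
  have "(\<Prod>j<l. s (\<tau> j)) = (\<Prod>j<l. s j)"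
    using prod.permute[OF y(1), of s] by (simp add: comp_def)
  then show "(\<Prod>j<l. t j * s (\<tau> j)) = 1"
    using y(4) z(4) by (simp add: prod.distrib)
  show "wcoord ((y \<circ> z) \<mu>) j = t j * s (\<tau> j) * wcoord \<mu> ((\<sigma> \<circ> \<tau>) j)" for \<mu> j
    by (simp add: y(5) z(5))
  show "snd ((y \<circ> z) \<mu>) = snd \<mu>" for \<mu> by (simp only: comp_apply y(6) z(6))
qed

lemma signed_perm_srefl:
  assumes l: "l \<ge> 2" and i: "i \<in> {1..l}"
  shows "\<exists>\<sigma> s. signed_perm l \<sigma> s (srefl l i)"
proof -
  \<comment> \<open>Every finite simple root is \<open>eps a + wscale c (eps b)\<close>: c is -1
    along the chain, and 1 at the last node, where a and b are l - 2 and l - 1.\<close>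
  define a where "a = (if i < l then i - 1 else l - 2)"
  define b where "b = (if i < l then i else l - 1)"
  define c :: complex where "c = (if i < l then -1 else 1)"
  have ab: "a < l" "b < l" "a \<noteq> b" and c: "c * c = 1" "c = 1 \<or> c = -1"
    using l i by (auto simp: a_def b_def c_def)
  have root: "simple_root l i = eps a + wscale c (eps b)"
    using i by (auto simp: simple_root_def a_def b_def c_def weight_eq_iff prod_eq_iff)
  have form: "wform l \<mu> (eps a + wscale c (eps b)) = wcoord \<mu> a + c * wcoord \<mu> b" for \<mu>
  proof -
    have "(\<Sum>j<l. wcoord \<mu> j * wcoord (eps a + wscale c (eps b)) j) =
        (\<Sum>j<l. (if j = a then wcoord \<mu> a else 0) + (if j = b then c * wcoord \<mu> b else 0))"
      by (intro sum.cong) (auto simp: algebra_simps)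
    then show ?thesis using ab by (simp add: wform_eq sum.distrib)
  qed
  have refl: "srefl l i \<mu> = \<mu> - wscale (wcoord \<mu> a + c * wcoord \<mu> b) (eps a + wscale c (eps b))" for \<mu>
  proof -
    have "wform l (eps a + wscale c (eps b)) (eps a + wscale c (eps b)) = 2"
      unfolding form using ab c by simp
    then show ?thesis
      unfolding srefl_def root form by (simp only: nonzero_mult_div_cancel_left[OF zero_neq_numeral[symmetric]])
  qed
  \<comment> \<open>The reflection exchanges the coordinates a and b, both with the sign -c; the
    number of sign changes is 0 or 2.\<close>
  let ?s = "\<lambda>j. if j = a \<or> j = b then - c else 1"
  have "(\<Prod>j<l. ?s j) = (\<Prod>j\<in>{a, b}. - c)"
    using ab by (intro prod.mono_neutral_cong_right) auto
  also have "\<dots> = 1" using ab c by simp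
  finally have "signed_perm l (transpose a b) ?s (srefl l i)"
  proof (intro signed_permI)
    show "transpose a b permutes {..<l}" using ab by (intro permutes_swap_id) auto
    show "?s j = 1 \<or> ?s j = -1" for j using c by auto
    show "?s j = 1" if "j \<ge> l" for j using that ab by auto
    show "snd (srefl l i \<mu>) = snd \<mu>" for \<mu> by (simp add: refl prod_eq_iff)
    show "wcoord (srefl l i \<mu>) j = ?s j * wcoord \<mu> (transpose a b j)" for \<mu> j
    proof -
      have "c * (c * wcoord \<mu> b) = wcoord \<mu> b"
        using c by (simp add: mult.assoc[symmetric])
      then show ?thesis using ab by (auto simp: refl transpose_def algebra_simps)
    qed
  qed
  then show ?thesis by blast
qed

lemma W_fin_signed_perm:
  assumes l: "l \<ge> 2" and z: "z \<in> W_fin l"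
  shows "\<exists>\<sigma> s. signed_perm l \<sigma> s z"
proof -
  obtain "is" where z: "z = word_elt l is" and "set is \<subseteq> {1..l}" using z by (auto simp: W_fin_def)
  from this(2) show ?thesis unfolding z
  proof (induction "is")
    case Nil
    have "signed_perm l id (\<lambda>_. 1) (word_elt l [])"
      by (rule signed_permI) (simp_all add: word_elt_def permutes_id)
    then show ?case by blast
  next
    case (Cons i js)
    have "word_elt l (i # js) = srefl l i \<circ> word_elt l js" by (simp add: word_elt_def)
    moreover obtain \<tau> t where "signed_perm l \<tau> t (srefl l i)"
      using signed_perm_srefl[OF l, of i] Cons.prems by auto
    moreover obtain \<sigma> s where "signed_perm l \<sigma> s (word_elt l js)" using Cons by auto
    ultimately show ?case using signed_perm_comp by metis
  qed
qed

text \<open>The coordinates of \<open>\<rho>\<close> have distinct absolute values and only the last one vanishes, so an even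
  signed permutation is determined by the image of \<open>\<rho>\<close>.\<close>

lemma signed_perm_regular:
  assumes l: "l \<ge> 1" and z: "signed_perm l \<sigma> s z" and y: "signed_perm l \<tau> t y"
    and eq: "z (shifted_vac l) = y (shifted_vac l)"
  shows "z = y"
proof -
  note zD = signed_permD[OF z] and yD = signed_permD[OF y]
  note perm = zD(1) yD(1)
  have in_l: "\<sigma> j < l" "\<tau> j < l" if "j < l" for j
    using permutes_in_image[OF perm(1), of j] permutes_in_image[OF perm(2), of j] that by auto
  have coord: "s j * of_nat (l - 1 - \<sigma> j) = t j * of_nat (l - 1 - \<tau> j)" if "j < l" for j
  proof -
    have "wcoord (z (shifted_vac l)) j = wcoord (y (shifted_vac l)) j" using eq by simp
    then show ?thesis using that in_l unfolding zD(5) yD(5) by (simp only: shifted_vac_coord if_True)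
  qed
  have norm1: "norm (s j) = 1" "norm (t j) = 1" for j
    using zD(2)[of j] yD(2)[of j] by auto
  have \<sigma>\<tau>: "\<sigma> j = \<tau> j" for j
  proof (cases "j < l")
    case True
    have "norm (s j * of_nat (l - 1 - \<sigma> j)) = norm (t j * of_nat (l - 1 - \<tau> j))"
      using coord[OF True] by simp
    then have "l - 1 - \<sigma> j = l - 1 - \<tau> j" by (simp add: norm_mult norm1)
    then show ?thesis using in_l[OF True] by simp
  next
    case False
    then show ?thesis using permutes_not_in[OF perm(1)] permutes_not_in[OF perm(2)] by simp
  qed
  have st: "s j = t j" if "j < l" "\<sigma> j \<noteq> l - 1" for j
  proof -
    have "l - 1 - \<tau> j \<noteq> 0" using that(2) in_l[OF that(1)] by (simp add: \<sigma>\<tau>)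
    then have "of_nat (l - 1 - \<tau> j) \<noteq> (0 :: complex)" by (simp only: of_nat_eq_0_iff not_False_eq_True)
    then show ?thesis using coord[OF that(1)] unfolding \<sigma>\<tau> using mult_right_cancel by blast
  qed
  \<comment> \<open>At the position that receives the zero coordinate of rho the sign is invisible;
    the product of all signs recovers it.\<close>
  have st_all: "s j = t j" for j
  proof (cases "j < l \<and> \<sigma> j = l - 1")
    case True
    have st': "s i = t i" if "i \<in> {..<l} - {j}" for i
    proof (rule st)
      show "\<sigma> i \<noteq> l - 1"
        using that True permutes_inj[OF perm(1)] by (metis DiffD2 injD singletonI)
    qed (use that in simp)
    have "s j * (\<Prod>i\<in>{..<l} - {j}. s i) = t j * (\<Prod>i\<in>{..<l} - {j}. t i)"
      using zD(4) yD(4) prod.remove[of "{..<l}" j s] prod.remove[of "{..<l}" j t] True by simp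
    moreover have "(\<Prod>i\<in>{..<l} - {j}. s i) = (\<Prod>i\<in>{..<l} - {j}. t i)"
      using st' by (rule prod.cong[OF refl])
    moreover have "t i \<noteq> 0" for i using yD(2)[of i] by auto
    then have "(\<Prod>i\<in>{..<l} - {j}. t i) \<noteq> 0" by simp
    ultimately show ?thesis by simp
  next
    case False
    show ?thesis
    proof (cases "j < l")
      case True
      then show ?thesis using st False by simp
    next
      case False
      then show ?thesis using zD(3) yD(3) by simp
    qed
  qed
  show ?thesis
    by (intro ext) (simp only: weight_eq_iff zD(5,6) yD(5,6) st_all \<sigma>\<tau> simp_thms)
qed

lemma dot_vac:
  assumes "l \<ge> 2"
  shows "dot l (z \<circ> srefl l 0) (- Lambda0) = z (shifted_vac l) - rho_hat l"
  using srefl_0_shifted_vac[OF assms] by (simp add: dot_def shifted_vac_def)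

lemma dot_vac_hdual:
  assumes l: "l \<ge> 2" and z: "z \<in> W_fin l"
  shows "dot l (z \<circ> srefl l 0) (- Lambda0) \<in> hdual l"
proof -
  obtain \<sigma> s where zs: "signed_perm l \<sigma> s z" using W_fin_signed_perm[OF assms] by blast
  have "\<sigma> j = j" if "j \<ge> l" for j
    using permutes_not_in[OF signed_permD(1)[OF zs], of j] that by simp
  then show ?thesis
    unfolding dot_vac[OF l]
    by (simp add: hdual_iff signed_permD(5)[OF zs] shifted_vac_coord rho_hat_def wcoord_rho)
qed

lemma dot_vac_inject:
  assumes l: "l \<ge> 2" and z: "z \<in> W_fin l" and y: "y \<in> W_fin l"
    and eq: "dot l (z \<circ> srefl l 0) (- Lambda0) = dot l (y \<circ> srefl l 0) (- Lambda0)"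
  shows "z = y"
proof -
  obtain \<sigma> s where zs: "signed_perm l \<sigma> s z" using W_fin_signed_perm[OF l z] by (elim exE)
  obtain \<tau> t where yt: "signed_perm l \<tau> t y" using W_fin_signed_perm[OF l y] by (elim exE)
  show ?thesis
    by (rule signed_perm_regular[OF _ zs yt]) (use l eq in \<open>simp_all add: dot_vac[OF l]\<close>)
qed

lemma id_in_W_fin: "id \<in> W_fin l"
  by (auto simp: W_fin_def word_elt_def intro!: exI[of _ "[]"])

section \<open>The category is closed under submodules and quotients\<close>

locale linkage_category = affine_va l "-1" V J
  for l :: nat and V :: "'v valg" and J +
  assumes rank: "l \<ge> 2"
begin

abbreviation Ob :: "('v, 'b) vmod set" where
  "Ob \<equiv> cat_C l V J"

abbreviation irr_sq :: "('v, 'b) vmod \<Rightarrow> 'b cvec set \<Rightarrow> 'b cvec set \<Rightarrow> bool" where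
  "irr_sq \<equiv> irreducible_subquotient l (-1) V J"

abbreviation linked_sq :: "('v, 'b) vmod \<Rightarrow> 'b cvec set \<Rightarrow> 'b cvec set \<Rightarrow> (weight \<Rightarrow> weight) \<Rightarrow> bool" where
  "linked_sq M N N' w \<equiv> simple_hw_subquotient l (-1) V J M N N' (dot l w (- Lambda0))"

definition linked :: "('v, 'b) vmod \<Rightarrow> bool" where
  "linked M \<longleftrightarrow> (\<forall>N N'. irr_sq M N N' \<longrightarrow>
        (\<exists>w\<in>W_aff l. linked_sq M N N' w))"

lemma Ob_iff: "M \<in> Ob \<longleftrightarrow> va_module V M \<and> linked M \<and> weight_decomposable M \<and>
     (\<forall>\<mu>\<in>hdual l. \<exists>B. finite B \<and> gws M \<mu> \<subseteq> cvec.span B) \<and>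
     (\<forall>\<mu>\<in>hdual l. finite {\<nu>. \<nu> - \<mu> \<in> Q_plus l \<and> gws M \<nu> \<noteq> {0}})"
proof (cases "va_module V M")
  case True
  then show ?thesis
    unfolding cat_C_def mem_Collect_eq linked_def weight_decomposable_iff[OF True]
    by (simp add: cvec.scale_minus_left)
qed (simp add: cat_C_def)

lemma Ob_va_module: "M \<in> Ob \<Longrightarrow> va_module V M"
  and Ob_decomposable: "M \<in> Ob \<Longrightarrow> weight_decomposable M"
  and Ob_finite_dim: "M \<in> Ob \<Longrightarrow> \<mu> \<in> hdual l \<Longrightarrow> \<exists>B. finite B \<and> gws M \<mu> \<subseteq> cvec.span B"
  by (simp_all add: Ob_iff)

lemma Ob_linked:
  assumes "M \<in> Ob" "irr_sq M N N'"
  obtains w where "w \<in> W_aff l" "linked_sq M N N' w"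
proof -
  have "linked M" using assms(1) unfolding Ob_iff by (elim conjE)
  then have "\<exists>w\<in>W_aff l. linked_sq M N N' w"
    using assms(2) unfolding linked_def by (elim allE impE)
  then show thesis using that by (elim bexE)
qed

lemma affine_submodule_mcarrier:
  assumes "N \<subseteq> mcarrier M"
  shows "affine_submodule l k V J (M\<lparr>mcarrier := N\<rparr>) P \<longleftrightarrow> affine_submodule l k V J M P \<and> P \<subseteq> N"
proof -
  have "act l k V J (M\<lparr>mcarrier := N\<rparr>) X u = act l k V J M X u" for X u by (cases X) simp_all
  then show ?thesis using assms by (auto simp: affine_submodule_def)
qed

text \<open>Subquotients of N are subquotients of M, and the weight components of a vector of N stay
  in N; the finiteness conditions are inherited by intersection.\<close>

lemma Ob_submodule:
  assumes M: "M \<in> Ob" and N: "va_submodule V M N"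
  shows "M\<lparr>mcarrier := N\<rparr> \<in> Ob"
proof -
  note Mm = Ob_va_module[OF M]
  have NM: "N \<subseteq> mcarrier M" and Nsub: "cvec.subspace N" using N by (auto simp: va_submodule_def)
  have "linked (M\<lparr>mcarrier := N\<rparr>)"
    unfolding linked_def
  proof (intro allI impI)
    fix P P' assume irr: "irr_sq (M\<lparr>mcarrier := N\<rparr>) P P'"
    then have irr': "irr_sq M P P'"
      unfolding irreducible_subquotient_def affine_submodule_mcarrier[OF NM] by (meson subset_trans)
    obtain w where w: "w \<in> W_aff l" "linked_sq M P P' w"
      by (rule Ob_linked[OF M irr'])
    then have "linked_sq (M\<lparr>mcarrier := N\<rparr>) P P' w"
      using irr unfolding simple_hw_subquotient_def hw_vector_mod_def act_mcarrier act_h_mcarrier by blast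
    then show "\<exists>w\<in>W_aff l. linked_sq (M\<lparr>mcarrier := N\<rparr>) P P' w"
      using w(1) by blast
  qed
  moreover have "weight_decomposable (M\<lparr>mcarrier := N\<rparr>)"
    unfolding weight_decomposable_def
  proof
    fix u assume "u \<in> mcarrier (M\<lparr>mcarrier := N\<rparr>)"
    then have u: "u \<in> N" "u \<in> mcarrier M" using NM by auto
    obtain S f where S: "finite S" "S \<subseteq> hdual l" "\<And>\<mu>. f \<mu> \<in> gws M \<mu>" "u = (\<Sum>\<mu>\<in>S. f \<mu>)"
      by (rule weight_decomposableE[OF Ob_decomposable[OF M] u(2)]) (rule that)
    have "f \<mu> \<in> N" if "\<mu> \<in> S" for \<mu>
      using weight_components[OF Mm N S(1,2), of f \<mu>] S(3,4) u(1) that by simp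
    then have "(if \<mu> \<in> S then f \<mu> else 0) \<in> gws (M\<lparr>mcarrier := N\<rparr>) \<mu>" for \<mu>
      using S(3) cvec.subspace_0[OF gws_subspace[OF Mm]] cvec.subspace_0[OF Nsub]
      by (simp add: gws_submodule[OF NM])
    moreover have "u = (\<Sum>\<mu>\<in>S. if \<mu> \<in> S then f \<mu> else 0)" using S(4) by simp
    ultimately show "\<exists>S f. finite S \<and> S \<subseteq> hdual l \<and>
        (\<forall>\<mu>. f \<mu> \<in> gws (M\<lparr>mcarrier := N\<rparr>) \<mu>) \<and> u = (\<Sum>\<mu>\<in>S. f \<mu>)"
      using S(1,2) by (intro exI[of _ S] exI[of _ "\<lambda>\<mu>. if \<mu> \<in> S then f \<mu> else 0"]) simp
  qed
  moreover have "\<exists>B. finite B \<and> gws (M\<lparr>mcarrier := N\<rparr>) \<mu> \<subseteq> cvec.span B" if "\<mu> \<in> hdual l" for \<mu>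
    using Ob_finite_dim[OF M that] unfolding gws_submodule[OF NM] by (meson inf.coboundedI1)
  moreover have "finite {\<nu>. \<nu> - \<mu> \<in> Q_plus l \<and> gws (M\<lparr>mcarrier := N\<rparr>) \<nu> \<noteq> {0}}" if "\<mu> \<in> hdual l" for \<mu>
  proof (rule finite_subset)
    show "{\<nu>. \<nu> - \<mu> \<in> Q_plus l \<and> gws (M\<lparr>mcarrier := N\<rparr>) \<nu> \<noteq> {0}} \<subseteq>
        {\<nu>. \<nu> - \<mu> \<in> Q_plus l \<and> gws M \<nu> \<noteq> {0}}"
      using cvec.subspace_0[OF gws_subspace[OF Mm]] cvec.subspace_0[OF Nsub]
      by (auto simp: gws_submodule[OF NM])
    show "finite {\<nu>. \<nu> - \<mu> \<in> Q_plus l \<and> gws M \<nu> \<noteq> {0}}"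
      using M that by (simp add: Ob_iff)
  qed
  ultimately show ?thesis
    using va_module_submodule[OF vertex_algebra Mm N] by (simp add: Ob_iff)
qed

section \<open>Quotients of objects\<close>

lemma va_hom_vimage:
  assumes M: "va_module V M" and g: "va_hom V M Q g" and P: "va_submodule V Q P"
  shows "va_submodule V M {u \<in> mcarrier M. g u \<in> P}"
proof -
  interpret current_fields V "mcarrier M" "mode M" l "-1" J by (rule current_fields[OF M])
  show ?thesis
    using g P subspace_linear_vimage[OF subspace, of g P] mode_in
    by (auto simp: va_submodule_def va_hom_def)
qed

lemma va_hom_image:
  assumes g: "va_hom V M Q g" and P: "va_submodule V M P"
  shows "va_submodule V Q (g ` P)"
proof -
  have P': "cvec.subspace P" "P \<subseteq> mcarrier M" "\<And>a n u. a \<in> vcarrier V \<Longrightarrow> u \<in> P \<Longrightarrow> mode M a n u \<in> P"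
    using P by (auto simp: va_submodule_def)
  have g': "linear_on P g" "g ` mcarrier M \<subseteq> mcarrier Q"
    "\<And>a n u. a \<in> vcarrier V \<Longrightarrow> u \<in> mcarrier M \<Longrightarrow> mode Q a n (g u) = g (mode M a n u)"
    using g P'(2) by (auto simp: va_hom_def intro: linear_on_subset)
  show ?thesis
    unfolding va_submodule_def
  proof (intro conjI ballI allI)
    show "cvec.subspace (g ` P)" by (rule subspace_linear_image[OF P'(1) g'(1)])
    show "g ` P \<subseteq> mcarrier Q" using g'(2) P'(2) by blast
    fix a n v assume a: "a \<in> vcarrier V" and "v \<in> g ` P"
    then obtain u where u: "u \<in> P" "v = g u" by blast
    then have "mode Q a n v = g (mode M a n u)" using g'(3)[OF a] P'(2) by blast
    then show "mode Q a n v \<in> g ` P" using P'(3)[OF a u(1)] by simp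
  qed
qed

text \<open>The correspondence of submodules: whatever lies between the two preimages contains the
  kernel, hence is the preimage of its own image.\<close>

lemma irreducible_subquotient_vimage:
  assumes M: "va_module V M" and Q: "va_module V Q" and g: "va_hom V M Q g"
    and surj: "g ` mcarrier M = mcarrier Q" and irr: "irr_sq Q N N'"
  shows "irr_sq M {u \<in> mcarrier M. g u \<in> N} {u \<in> mcarrier M. g u \<in> N'}"
proof -
  have N: "va_submodule V Q N" "va_submodule V Q N'" "N' \<subset> N"
    and max: "\<And>P. va_submodule V Q P \<Longrightarrow> N' \<subseteq> P \<Longrightarrow> P \<subseteq> N \<Longrightarrow> P = N' \<or> P = N"
    using irr unfolding irreducible_subquotient_def affine_submodule_iff[OF Q] by blast+
  have NQ: "N \<subseteq> mcarrier Q" "0 \<in> N'"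
    using N by (auto simp: va_submodule_def cvec.subspace_0)
  have glin: "linear_on (mcarrier M) g" by (rule va_hom_linear[OF g])
  have Msub: "cvec.subspace (mcarrier M)" by (rule mcarrier_subspace[OF M])
  show ?thesis
    unfolding irreducible_subquotient_def affine_submodule_iff[OF M]
  proof (intro conjI allI impI va_hom_vimage[OF M g] N)
    obtain v where "v \<in> N" "v \<notin> N'" using N(3) by blast
    moreover obtain u where "u \<in> mcarrier M" "v = g u" using NQ \<open>v \<in> N\<close> surj by blast
    ultimately show "{u \<in> mcarrier M. g u \<in> N'} \<subset> {u \<in> mcarrier M. g u \<in> N}" using N(3) by blast
  next
    fix P assume "va_submodule V M P \<and> {u \<in> mcarrier M. g u \<in> N'} \<subseteq> P \<and> P \<subseteq> {u \<in> mcarrier M. g u \<in> N}"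
    then have P: "va_submodule V M P" "{u \<in> mcarrier M. g u \<in> N'} \<subseteq> P" "P \<subseteq> {u \<in> mcarrier M. g u \<in> N}"
      by auto
    have Psub: "cvec.subspace P" "P \<subseteq> mcarrier M" using P(1) by (auto simp: va_submodule_def)
    have sat: "P = {u \<in> mcarrier M. g u \<in> g ` P}"
    proof (intro subset_antisym subsetI)
      fix u assume "u \<in> {u \<in> mcarrier M. g u \<in> g ` P}"
      then obtain v where v: "u \<in> mcarrier M" "v \<in> P" "g u = g v" by blast
      then have "g (u - v) = 0" using linear_on_diff[OF glin Msub, of u v] Psub(2) by auto
      moreover have "u - v \<in> mcarrier M" using v Psub(2) by (intro cvec.subspace_diff[OF Msub]) auto
      ultimately have "u - v \<in> P" using P(2) NQ(2) by auto
      then have "(u - v) + v \<in> P" using v(2) by (rule cvec.subspace_add[OF Psub(1)])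
      then show "u \<in> P" by simp
    qed (use Psub(2) in blast)
    have "N' \<subseteq> g ` P"
    proof
      fix v assume "v \<in> N'"
      then obtain u where "u \<in> mcarrier M" "v = g u" using NQ(1) N(3) surj by blast
      then show "v \<in> g ` P" using P(2) \<open>v \<in> N'\<close> by blast
    qed
    moreover have "g ` P \<subseteq> N" using P(3) by blast
    ultimately have "g ` P = N' \<or> g ` P = N" by (rule max[OF va_hom_image[OF g P(1)]])
    then show "P = {u \<in> mcarrier M. g u \<in> N'} \<or> P = {u \<in> mcarrier M. g u \<in> N}"
      using sat by metis
  qed
qed

lemma hw_vector_mod_hom:
  assumes M: "va_module V M" and Q: "va_module V Q" and g: "va_hom V M Q g" and u: "u \<in> mcarrier M"
    and hw: "hw_vector_mod l (-1) V J M {u \<in> mcarrier M. g u \<in> N'} \<mu> u"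
  shows "hw_vector_mod l (-1) V J Q N' \<mu> (g u)"
proof -
  have glin: "linear_on (mcarrier M) g" by (rule va_hom_linear[OF g])
  have Msub: "cvec.subspace (mcarrier M)" by (rule mcarrier_subspace[OF M])
  have root: "Loop x n \<in> affine_span l" if "x \<in> root_space l \<alpha>" for x n \<alpha>
    using that by (auto simp: root_space_def affine_span_def)
  have loop: "Loop x n \<in> affine_span l" if "x \<in> so_alg l" for x n
    using that by (auto simp: affine_span_def)
  show ?thesis
    unfolding hw_vector_mod_def
  proof (intro conjI ballI allI impI)
    show "g u \<notin> N'" using hw u by (auto simp: hw_vector_mod_def)
    show "act l (-1) V J Q (Loop x 0) (g u) \<in> N'" if "\<alpha> \<in> pos_roots l" "x \<in> root_space l \<alpha>" for \<alpha> x
      using hw that unfolding hw_vector_mod_def act_hom[OF M Q g root[OF that(2)] u, symmetric] by blast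
    show "act l (-1) V J Q (Loop x n) (g u) \<in> N'" if "x \<in> so_alg l" "n > 0" for x n
      using hw that unfolding hw_vector_mod_def act_hom[OF M Q g loop[OF that(1)] u, symmetric] by blast
    fix H c e assume H: "H \<in> cartan l"
    have "g (act_h l (-1) V J M H c e u - smul (weval l \<mu> H c e) u) =
        act_h l (-1) V J Q H c e (g u) - smul (weval l \<mu> H c e) (g u)"
      using u act_h_stable[OF M va_submodule_self[OF M] H u]
      by (simp add: linear_on_diff[OF glin Msub] linear_on_smul[OF glin] cvec.subspace_scale[OF Msub]
          act_h_hom[OF M Q g H])
    note eq = this
    show "act_h l (-1) V J Q H c e (g u) - smul (weval l \<mu> H c e) (g u) \<in> N'"
    proof -
      have *: "\<forall>H\<in>cartan l. \<forall>c e. act_h l (-1) V J M H c e u - smul (weval l \<mu> H c e) u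
          \<in> {u \<in> mcarrier M. g u \<in> N'}"
        using hw unfolding hw_vector_mod_def by (elim conjE)
      have "act_h l (-1) V J M H c e u - smul (weval l \<mu> H c e) u \<in> {u \<in> mcarrier M. g u \<in> N'}"
        by (rule spec[OF spec[OF bspec[OF * H]]])
      then show ?thesis unfolding eq[symmetric] by blast
    qed
  qed
qed

text \<open>Linkage is tested on the preimages of subquotients; the finiteness conditions hold
  because each weight space of Q is the image of the one of M.\<close>

lemma Ob_quotient:
  assumes M: "M \<in> Ob" and Q: "va_module V Q" and g: "va_hom V M Q g"
    and surj: "g ` mcarrier M = mcarrier Q"
  shows "Q \<in> Ob"
proof -
  note Mm = Ob_va_module[OF M]
  note im = gws_hom_image[OF Mm Q g surj Ob_decomposable[OF M]]
  have glin: "linear_on (mcarrier M) g" by (rule va_hom_linear[OF g])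
  have Msub: "cvec.subspace (mcarrier M)" by (rule mcarrier_subspace[OF Mm])
  have "linked Q"
    unfolding linked_def
  proof (intro allI impI)
    fix N N' assume irr: "irr_sq Q N N'"
    let ?pre = "\<lambda>N. {u \<in> mcarrier M. g u \<in> N}"
    have irr': "irr_sq M (?pre N) (?pre N')"
      by (rule irreducible_subquotient_vimage[OF Mm Q g surj irr])
    obtain w where w: "w \<in> W_aff l" "linked_sq M (?pre N) (?pre N') w"
      by (rule Ob_linked[OF M irr'])
    then obtain u where u: "u \<in> ?pre N" "hw_vector_mod l (-1) V J M (?pre N') (dot l w (- Lambda0)) u"
      unfolding simple_hw_subquotient_def by blast
    then have "hw_vector_mod l (-1) V J Q N' (dot l w (- Lambda0)) (g u)"
      by (intro hw_vector_mod_hom[OF Mm Q g]) simp_all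
    then have "linked_sq Q N N' w"
      using irr u(1) unfolding simple_hw_subquotient_def by blast
    then show "\<exists>w\<in>W_aff l. linked_sq Q N N' w"
      using w(1) by blast
  qed
  moreover have "weight_decomposable Q"
    unfolding weight_decomposable_def
  proof
    fix q assume "q \<in> mcarrier Q"
    then have "q \<in> g ` mcarrier M" using surj by simp
    then obtain u where u: "u \<in> mcarrier M" "q = g u" by blast
    obtain S f where S: "finite S" "S \<subseteq> hdual l" "\<And>\<mu>. f \<mu> \<in> gws M \<mu>" "u = (\<Sum>\<mu>\<in>S. f \<mu>)"
      by (rule weight_decomposableE[OF Ob_decomposable[OF M] u(1)]) (rule that)
    have "q = (\<Sum>\<mu>\<in>S. g (f \<mu>))"
      unfolding u(2) S(4) using S(3) by (intro linear_on_sum[OF glin Msub]) (simp add: gws_iff)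
    then show "\<exists>S f. finite S \<and> S \<subseteq> hdual l \<and> (\<forall>\<mu>. f \<mu> \<in> gws Q \<mu>) \<and> q = (\<Sum>\<mu>\<in>S. f \<mu>)"
      using S(1,2) gws_hom[OF Mm Q g S(3)] by (intro exI[of _ S] exI[of _ "\<lambda>\<mu>. g (f \<mu>)"]) simp
  qed
  moreover have "\<exists>B. finite B \<and> gws Q \<mu> \<subseteq> cvec.span B" if \<mu>: "\<mu> \<in> hdual l" for \<mu>
  proof -
    obtain B where B: "finite B" "gws M \<mu> \<subseteq> cvec.span B" using Ob_finite_dim[OF M \<mu>] by blast
    \<comment> \<open>The span of B may leave the carrier, so g is replaced by a global linear
      map.\<close>
    obtain h where h: "Vector_Spaces.linear smul smul h" "\<And>x. x \<in> mcarrier M \<Longrightarrow> h x = g x"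
      using linear_on_extend[OF Msub glin] by blast
    have "gws Q \<mu> = h ` gws M \<mu>"
      unfolding im[OF \<mu>, symmetric] using h(2) by (intro image_cong) (simp_all add: gws_iff)
    also have "\<dots> \<subseteq> cvec.span (h ` B)"
      unfolding cvec_pair.linear_span_image[OF h(1)] using B(2) by (rule image_mono)
    finally show ?thesis using B(1) by blast
  qed
  moreover have "finite {\<nu>. \<nu> - \<mu> \<in> Q_plus l \<and> gws Q \<nu> \<noteq> {0}}" if \<mu>: "\<mu> \<in> hdual l" for \<mu>
  proof (rule finite_subset)
    have "gws M \<nu> \<noteq> {0}" if \<nu>: "\<nu> - \<mu> \<in> Q_plus l" "gws Q \<nu> \<noteq> {0}" for \<nu>
    proof -
      have "\<nu> \<in> hdual l" by (rule hdual_Q_plus[OF rank \<mu> \<nu>(1)])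
      then show ?thesis using im[of \<nu>] \<nu>(2) linear_on_zero[OF glin Msub] by auto
    qed
    then show "{\<nu>. \<nu> - \<mu> \<in> Q_plus l \<and> gws Q \<nu> \<noteq> {0}} \<subseteq> {\<nu>. \<nu> - \<mu> \<in> Q_plus l \<and> gws M \<nu> \<noteq> {0}}"
      by blast
    show "finite {\<nu>. \<nu> - \<mu> \<in> Q_plus l \<and> gws M \<nu> \<noteq> {0}}" using M \<mu> by (simp add: Ob_iff)
  qed
  ultimately show ?thesis using Q by (simp add: Ob_iff)
qed

section \<open>Dimensions of generalised weight spaces\<close>

definition gdim :: "('v, 'b) vmod \<Rightarrow> weight \<Rightarrow> nat" where
  "gdim M \<mu> = cvec.dim (gws M \<mu>)"

lemma gdim_pos:
  assumes "M \<in> Ob" "\<mu> \<in> hdual l" "gws M \<mu> \<noteq> {0}"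
  shows "gdim M \<mu> > 0"
proof -
  obtain B where "finite B" "gws M \<mu> \<subseteq> cvec.span B" using Ob_finite_dim[OF assms(1,2)] by blast
  then show ?thesis
    unfolding gdim_def using gws_subspace[OF Ob_va_module[OF assms(1)]] assms(3) by (intro dim_pos)
qed

lemma gdim_zero: "gws M \<mu> = {0} \<Longrightarrow> gdim M \<mu> = 0"
  unfolding gdim_def using cvec.dim_le_card[of "{0}" "{}"] by simp

text \<open>Passing to a generalised weight space is exact: \<open>gws_hom_inj\<close> identifies
  the kernel and \<open>gws_hom_image\<close> the image. Rank-nullity does the rest.\<close>

lemma gdim_additive:
  assumes Ob: "M' \<in> Ob" "M \<in> Ob" "M'' \<in> Ob" and ex: "short_exact V M' M M''" and \<mu>: "\<mu> \<in> hdual l"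
  shows "gdim M \<mu> = gdim M' \<mu> + gdim M'' \<mu>"
proof -
  note mods = Ob[THEN Ob_va_module]
  obtain f g where f: "va_hom V M' M f" and g: "va_hom V M M'' g" and inj: "inj_on f (mcarrier M')"
    and surj: "g ` mcarrier M = mcarrier M''" and ker: "f ` mcarrier M' = {u \<in> mcarrier M. g u = 0}"
    using ex unfolding short_exact_def by blast
  obtain B where B: "finite B" "gws M \<mu> \<subseteq> cvec.span B" using Ob_finite_dim[OF Ob(2) \<mu>] by blast
  obtain B' where B': "finite B'" "gws M' \<mu> \<subseteq> cvec.span B'" using Ob_finite_dim[OF Ob(1) \<mu>] by blast
  have sub: "gws M \<mu> \<subseteq> mcarrier M" "gws M' \<mu> \<subseteq> mcarrier M'" by (auto simp: gws_iff)
  have lin: "linear_on (gws M \<mu>) g" "linear_on (gws M' \<mu>) f"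
    using f g unfolding va_hom_def by (auto intro: linear_on_subset[OF _ sub(1)] linear_on_subset[OF _ sub(2)])
  have "{u \<in> gws M \<mu>. g u = 0} = f ` gws M' \<mu>"
  proof (intro subset_antisym subsetI)
    fix u assume u: "u \<in> {u \<in> gws M \<mu>. g u = 0}"
    then have "u \<in> f ` mcarrier M'" using ker sub(1) by blast
    then obtain v where v: "v \<in> mcarrier M'" "u = f v" by blast
    then have "v \<in> gws M' \<mu>" using u by (intro gws_hom_inj[OF mods(1,2) f inj]) simp_all
    then show "u \<in> f ` gws M' \<mu>" using v(2) by blast
  next
    fix u assume "u \<in> f ` gws M' \<mu>"
    then obtain v where v: "v \<in> gws M' \<mu>" "u = f v" by blast
    then have "f v \<in> f ` mcarrier M'" using sub(2) by blast
    then show "u \<in> {u \<in> gws M \<mu>. g u = 0}" using v ker gws_hom[OF mods(1,2) f v(1)] by simp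
  qed
  then show ?thesis
    unfolding gdim_def dim_rank_nullity[OF gws_subspace[OF mods(2)] B lin(1)]
    using dim_linear_image_inj[OF gws_subspace[OF mods(1)] B' lin(2) inj_on_subset[OF inj sub(2)]]
    by (simp add: gws_hom_image[OF mods(2,3) g surj Ob_decomposable[OF Ob(2)] \<mu>])
qed

end

section \<open>Weights of simple highest-weight modules\<close>

lemma (in invariant_subspace) gen_eigenspace_subspace:
  "cvec.subspace {x \<in> M. gen_eigenvector T a x}"
  using sub gen_eigenvector_add gen_eigenvector_smul gen_eigenvector_zero
  by (intro cvec.subspaceI) (auto simp: cvec.subspace_0 cvec.subspace_add cvec.subspace_scale)

lemma (in invariant_subspace) gen_eigenvector_if_eigenvector:
  "T x = smul a x \<Longrightarrow> gen_eigenvector T a x"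
  unfolding gen_eigenvector_def by (rule exI[of _ 1]) simp

lemma (in invariant_subspace) true_gen_eigenvalue:
  assumes "x \<in> M" "x \<noteq> 0" "T x = smul a x" "gen_eigenvector T b x"
  shows "a = b"
proof (rule ccontr)
  assume "a \<noteq> b"
  obtain n where n: "(shift b ^^ n) x = 0" using assms(4) by (auto simp: gen_eigenvector_def)
  have "x \<in> {0}"
    by (rule shift_in_stable[where N = "{0}" and a = b and b = a and m = n])
      (use assms n \<open>a \<noteq> b\<close> sub linear_on_zero[OF lin sub] in \<open>auto simp: cvec.subspace_0\<close>)
  then show False using assms(2) by simp
qed

text \<open>The relation between v, u and the eigenvectors in E is sorted by eigenvalue. As b avoids
  C, nothing from E meets v, so only u can cancel it.\<close>

lemma (in invariant_subspace) gen_eigenvector_in_eigen_sum: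
  assumes v: "v \<in> M" "gen_eigenvector T b v" "v \<noteq> 0"
    and u: "u \<in> M" "T u = smul a u"
    and E: "E \<subseteq> M" "\<And>t. t \<in> E \<Longrightarrow> \<exists>c\<in>C. T t = smul c t"
    and dec: "v - smul r u \<in> cvec.span E" and b: "b \<notin> C" and a: "a \<notin> C"
  shows "a = b \<and> v = smul r u"
proof -
  obtain F q where F: "finite F" "F \<subseteq> E" "v - smul r u = (\<Sum>t\<in>F. smul (q t) t)"
    using dec unfolding cvec.span_explicit by auto
  have "\<forall>t\<in>E. \<exists>c. c \<in> C \<and> T t = smul c t" using E(2) by blast
  then obtain ev where ev: "\<And>t. t \<in> E \<Longrightarrow> ev t \<in> C" "\<And>t. t \<in> E \<Longrightarrow> T t = smul (ev t) t"
    by (metis (no_types, lifting))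
  define A where "A = insert a (insert b (ev ` F))"
  \<comment> \<open>The part of \<open>- v + smul r u\<close> plus the sum over F at the eigenvalue
    \<alpha>. The total is 0, so each part is 0.\<close>
  define h where "h \<alpha> = (if \<alpha> = b then - v else 0) + (if \<alpha> = a then smul r u else 0) +
      (\<Sum>t\<in>{t \<in> F. ev t = \<alpha>}. smul (q t) t)" for \<alpha>
  have A: "finite A" "a \<in> A" "b \<in> A" "ev ` F \<subseteq> A" using F(1) by (auto simp: A_def)
  let ?G = "\<lambda>\<alpha>. {x \<in> M. gen_eigenvector T \<alpha> x}"
  have h: "h \<alpha> \<in> ?G \<alpha>" for \<alpha>
    unfolding h_def
  proof (intro cvec.subspace_add[OF gen_eigenspace_subspace] cvec.subspace_sum[OF gen_eigenspace_subspace]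
      cvec.subspace_scale[OF gen_eigenspace_subspace])
    show "(if \<alpha> = b then - v else 0) \<in> ?G \<alpha>"
      using v cvec.subspace_neg[OF gen_eigenspace_subspace, of v b] cvec.subspace_0[OF gen_eigenspace_subspace]
      by auto
    show "(if \<alpha> = a then smul r u else 0) \<in> ?G \<alpha>"
      using u gen_eigenvector_if_eigenvector[OF u(2)] cvec.subspace_scale[OF gen_eigenspace_subspace, of u a r]
        cvec.subspace_0[OF gen_eigenspace_subspace]
      by auto
    show "t \<in> ?G \<alpha>" if "t \<in> {t \<in> F. ev t = \<alpha>}" for t
      using that ev(2)[of t] F(2) E(1) gen_eigenvector_if_eigenvector[of t \<alpha>] by auto
  qed
  have "(\<Sum>\<alpha>\<in>A. h \<alpha>) = - v + smul r u + (\<Sum>t\<in>F. smul (q t) t)"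
    unfolding h_def using A F(1) by (simp add: sum.distrib sum.group)
  also have "\<dots> = 0" by (simp add: F(3)[symmetric])
  finally have sum: "(\<Sum>\<alpha>\<in>A. h \<alpha>) \<in> {0}" by simp
  have zero: "h \<alpha> \<in> {0}" if "\<alpha> \<in> A" for \<alpha>
    by (rule gen_eigenvector_components[where A = A])
      (use A(1) h sum that sub linear_on_zero[OF lin sub] in \<open>auto simp: cvec.subspace_0\<close>)
  have none: "{t \<in> F. ev t = b} = {}" using ev(1) F(2) b by blast
  have "h b = - v + (if b = a then smul r u else 0)" unfolding h_def none by simp
  then have "- v + (if b = a then smul r u else 0) = 0" using zero[OF A(3)] by simp
  then show ?thesis using v(3) by (auto split: if_splits)
qed

text \<open>The element \<open>diag(l,\<dots>,1,-l,\<dots>,-1) + (2l+1) d\<close> grades the affine algebra by integers, with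
  degrees 1 or 3 on the finite simple root vectors and 2 on the affine one.\<close>

definition hh_diag :: "nat \<Rightarrow> complex mat" where
  "hh_diag l = wt_diag l (\<lambda>j. of_nat (l - j))"

definition hh_entry :: "nat \<Rightarrow> nat \<Rightarrow> int" where
  "hh_entry l a = (if a < l then int l - int a else int a - 2 * int l)"

lemma hh_diag_entry: "a < 2*l \<Longrightarrow> hh_diag l $$ (a, a) = of_int (hh_entry l a)"
  by (auto simp: hh_diag_def wt_diag_def hh_entry_def of_nat_diff)

lemma hh_diag_cartan: "hh_diag l \<in> cartan l"
  by (simp add: hh_diag_def wt_diag_cartan)

abbreviation hh_value :: "nat \<Rightarrow> weight \<Rightarrow> complex" where
  "hh_value l \<mu> \<equiv> weval l \<mu> (hh_diag l) 0 (of_nat (2*l + 1))"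

text \<open>The entries l, ..., 1, -l, ..., -1 are pairwise distinct, so for a and b distinct the
  degree decides whether F_ab raises or lowers.\<close>

lemma hh_entry_inject: "a < 2*l \<Longrightarrow> b < 2*l \<Longrightarrow> hh_entry l a = hh_entry l b \<Longrightarrow> a = b"
  by (auto simp: hh_entry_def split: if_splits)

text \<open>The reason for the coefficient 2l + 1 of d: a negative power of t outweighs every finite
  degree.\<close>

lemma hh_entry_diff_le: "a < 2*l \<Longrightarrow> b < 2*l \<Longrightarrow> hh_entry l a - hh_entry l b \<le> 2 * int l"
  by (auto simp: hh_entry_def)

lemma so_gen_zero: "b = dual_index l a \<Longrightarrow> a < 2*l \<Longrightarrow> so_gen l a b = 0\<^sub>m (2*l) (2*l)"
  by (rule eq_matI) (auto simp: so_gen_def)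

lemma weval_eps: "j < l \<Longrightarrow> weval l (eps j) H c e = H $$ (j, j)"
  by (simp add: weval_def eps_def lookup_single when_def if_distrib[of "\<lambda>x. x * _"] cong: if_cong)

lemma weval_add: "weval l (\<mu> + \<nu>) H c e = weval l \<mu> H c e + weval l \<nu> H c e"
  by (cases \<mu>; cases \<nu>) (simp add: weval_def lookup_add sum.distrib algebra_simps)

lemma weval_minus: "weval l (- \<mu>) H c e = - weval l \<mu> H c e"
  by (cases \<mu>) (simp add: weval_def sum_negf)

lemma weval_diff: "weval l (\<mu> - \<nu>) H c e = weval l \<mu> H c e - weval l \<nu> H c e"
  using weval_add[of l \<mu> "- \<nu>"] by (simp add: weval_minus)

text \<open>The cases are the upper left block of the matrix, the upper right block with its two
  indices in either order, and the lower right block. The zero matrix accounts for b = a'.\<close>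

lemma so_gen_positive_root:
  assumes ab: "a < 2*l" "b < 2*l" and pos: "hh_entry l a > hh_entry l b"
  shows "so_gen l a b = 0\<^sub>m (2*l) (2*l) \<or> (\<exists>\<alpha>\<in>pos_roots l. so_gen l a b \<in> root_space l \<alpha>)"
proof (cases "b = dual_index l a")
  case True
  then show ?thesis using so_gen_zero ab by blast
next
  case False
  have mem: "so_gen l a b \<in> root_space l \<alpha>"
    if "\<And>H. H \<in> cartan l \<Longrightarrow> weval l \<alpha> H 0 0 = H $$ (a, a) - H $$ (b, b)" for \<alpha>
    using that ab by (simp add: root_space_def so_gen_in cartan_lie_so_gen)
  \<comment> \<open>The second half of the diagonal is the negative of the first, which translates
    positions from l on into eps coordinates.\<close>
  have dual: "H $$ (c, c) = - H $$ (c - l, c - l)" if "H \<in> cartan l" "l \<le> c" "c < 2*l" for H c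
  proof -
    have "dual_index l (c - l) = c" using that(2,3) by (simp add: dual_index_def)
    then show ?thesis
      using so_alg_skew[OF cartan_so[OF that(1)], of "c - l" "c - l"] that(2,3) by simp
  qed
  consider "a < b" "b < l" | "a < l" "l \<le> b" "a < b - l" | "a < l" "l \<le> b" "b - l < a"
    | "l \<le> b" "b < a"
    using pos False ab by (fastforce simp: hh_entry_def dual_index_def split: if_splits)
  then have "\<exists>\<alpha>\<in>pos_roots l. \<forall>H\<in>cartan l. weval l \<alpha> H 0 0 = H $$ (a, a) - H $$ (b, b)"
  proof cases
    case 1
    then have "eps a - eps b \<in> pos_roots l" unfolding pos_roots_def by blast
    then show ?thesis using 1 by (intro bexI[of _ "eps a - eps b"]) (simp_all add: weval_diff weval_eps)
  next
    case 2
    then have "b - l < l" using ab by simp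
    then have "eps a + eps (b - l) \<in> pos_roots l" using 2(3) unfolding pos_roots_def by blast
    then show ?thesis using 2 ab
      by (intro bexI[of _ "eps a + eps (b - l)"]) (simp_all add: weval_add weval_eps dual)
  next
    case 3
    then have "eps (b - l) + eps a \<in> pos_roots l" unfolding pos_roots_def by blast
    then show ?thesis using 3 ab
      by (intro bexI[of _ "eps (b - l) + eps a"]) (simp_all add: weval_add weval_eps dual)
  next
    case 4
    then have "b - l < a - l" "a - l < l" using ab by auto
    then have "eps (b - l) - eps (a - l) \<in> pos_roots l" unfolding pos_roots_def by blast
    then show ?thesis using 4 ab
      by (intro bexI[of _ "eps (b - l) - eps (a - l)"]) (simp_all add: weval_diff weval_eps dual)
  qed
  then show ?thesis using mem by blast
qed

section \<open>The grading operator on a module\<close>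

context affine_va begin

abbreviation hh :: "('v, 'b) vmod \<Rightarrow> 'b cvec \<Rightarrow> 'b cvec" where
  "hh M \<equiv> act_h l k V J M (hh_diag l) 0 (of_nat (2*l + 1))"

definition hh_deg :: "nat \<Rightarrow> nat \<Rightarrow> int \<Rightarrow> int" where
  "hh_deg a b n = hh_entry l a - hh_entry l b + (2 * int l + 1) * n"

definition lowering :: "nat \<Rightarrow> nat \<Rightarrow> int \<Rightarrow> bool" where
  "lowering a b n \<longleftrightarrow> a < 2*l \<and> b < 2*l \<and> (n < 0 \<or> n = 0 \<and> hh_entry l a < hh_entry l b)"

lemma lowering_deg: "lowering a b n \<Longrightarrow> hh_deg a b n < 0"
proof -
  assume low: "lowering a b n"
  have "hh_deg a b n < 0" if "n \<le> -1"
  proof -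
    have "(2 * int l + 1) * n \<le> (2 * int l + 1) * (-1)" using that by (intro mult_left_mono) auto
    then show ?thesis using hh_entry_diff_le[of a l b] low by (simp add: hh_deg_def lowering_def)
  qed
  then show ?thesis using low by (auto simp: lowering_def hh_deg_def)
qed

text \<open>The diagonal part comes from the current commutator, whose central term has the factor 0
  because the Cartan current has mode 0; the derivation part is the Sugawara relation.\<close>

lemma hh_commutator:
  assumes M: "va_module V M" and k: "k + dual_coxeter l \<noteq> 0" and ab: "a < 2*l" "b < 2*l"
    and u: "u \<in> mcarrier M"
  shows "hh M (mode M (J (so_gen l a b)) n u) =
    mode M (J (so_gen l a b)) n (hh M u) + smul (of_int (hh_deg a b n)) (mode M (J (so_gen l a b)) n u)"
proof -
  interpret current_fields V "mcarrier M" "mode M" l k J by (rule current_fields[OF M])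
  let ?x = "so_gen l a b" and ?H = "hh_diag l" and ?\<omega> = "sugawara l k V J"
  let ?e = "of_nat (2*l + 1) :: complex"
  have x: "?x \<in> so_alg l" and H: "?H \<in> so_alg l"
    using ab so_gen_in cartan_so[OF hh_diag_cartan] by auto
  let ?w = "mode M (J ?x) n u"
  have w: "?w \<in> mcarrier M" and Hu: "mode M (J ?H) 0 u \<in> mcarrier M" and \<omega>u: "mode M ?\<omega> 1 u \<in> mcarrier M"
    using mode_in J_in x H u sugawara_in by auto
  have "J (lie ?H ?x) = smul (of_int (hh_entry l a - hh_entry l b)) (J ?x)"
    using ab by (simp add: cartan_lie_so_gen[OF hh_diag_cartan] J_smult[OF x] hh_diag_entry)
  then have 1: "mode M (J ?H) 0 ?w = mode M (J ?x) n (mode M (J ?H) 0 u) +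
      smul (of_int (hh_entry l a - hh_entry l b)) ?w"
    using current_commutator[OF H x u, of 0 n] linear_on_smul[OF mode_linear_left[OF u] J_in[OF x]] by simp
  have 2: "mode M ?\<omega> 1 ?w = mode M (J ?x) n (mode M ?\<omega> 1 u) - smul (of_int n) ?w"
    using current_sugawara_mode[OF x k u, of n] by (simp add: algebra_simps)
  have hh: "hh M v = mode M (J ?H) 0 v - smul ?e (mode M ?\<omega> 1 v)" for v
    by (simp add: act_h_def)
  have 3: "mode M (J ?x) n (hh M u) =
      mode M (J ?x) n (mode M (J ?H) 0 u) - smul ?e (mode M (J ?x) n (mode M ?\<omega> 1 u))"
    unfolding hh using linear_on_diff[OF mode_linear[OF J_in[OF x]] subspace Hu]
      linear_on_smul[OF mode_linear[OF J_in[OF x]] \<omega>u] cvec.subspace_scale[OF subspace \<omega>u] by simp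
  have deg: "of_int (hh_deg a b n) = (of_int (hh_entry l a - hh_entry l b) + ?e * of_int n :: complex)"
    by (simp add: hh_deg_def)
  have "hh M ?w = mode M (J ?x) n (hh M u) +
      (smul (of_int (hh_entry l a - hh_entry l b)) ?w + smul ?e (smul (of_int n) ?w))"
    unfolding 3 unfolding hh 1 2 cvec.scale_right_diff_distrib by (simp add: algebra_simps)
  then show ?thesis
    unfolding deg cvec.scale_left_distrib by simp
qed

end

section \<open>Lowered vectors fill a simple highest-weight module\<close>

locale hw_module = affine_va l k V J for l k and V :: "'v valg" and J +
  fixes M :: "('v, 'b) vmod" and \<theta> :: weight
  assumes nondeg: "k + dual_coxeter l \<noteq> 0" and va_module: "va_module V M"
    and hw: "is_simple_hw_module l k V J M \<theta>"
begin

sublocale current_fields V "mcarrier M" "mode M" l k J by (rule current_fields[OF va_module])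

definition hwv :: "'b cvec" where
  "hwv = (SOME u. u \<in> mcarrier M \<and> hw_vector_mod l k V J M {0} \<theta> u)"

lemma hwv: "hwv \<in> mcarrier M" "hw_vector_mod l k V J M {0} \<theta> hwv"
proof -
  have "\<exists>u. u \<in> mcarrier M \<and> hw_vector_mod l k V J M {0} \<theta> u"
    using hw unfolding is_simple_hw_module_def simple_hw_subquotient_def by blast
  from someI_ex[OF this] show "hwv \<in> mcarrier M" "hw_vector_mod l k V J M {0} \<theta> hwv"
    unfolding hwv_def by auto
qed

lemma irreducible: "affine_submodule l k V J M N \<Longrightarrow> N = {0} \<or> N = mcarrier M"
proof -
  assume N: "affine_submodule l k V J M N"
  then have "{0} \<subseteq> N" "N \<subseteq> mcarrier M" by (auto simp: affine_submodule_def cvec.subspace_0)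
  then show ?thesis
    using hw N unfolding is_simple_hw_module_def simple_hw_subquotient_def irreducible_subquotient_def by blast
qed

lemma hwv_nonzero: "hwv \<noteq> 0"
  using hwv(2) by (simp add: hw_vector_mod_def)

lemma hwv_weight: "H \<in> cartan l \<Longrightarrow> act_h l k V J M H c e hwv = smul (weval l \<theta> H c e) hwv"
  using hwv(2) by (simp add: hw_vector_mod_def)

lemma hwv_in_gws: "hwv \<in> gws M \<theta>"
  unfolding gws_iff
proof (intro conjI ballI allI hwv(1))
  fix H c e assume H: "H \<in> cartan l"
  show "gen_eigenvector (act_h l k V J M H c e) (weval l \<theta> H c e) hwv"
    by (rule invariant_subspace.gen_eigenvector_if_eigenvector[OF invariant_subspace_act_h[OF va_module H] hwv_weight[OF H]])
qed

text \<open>The smallest lowering-closed set stands for \<open>U(\<nn>\<^sub>-)\<close> applied to the highest-weight vector. It is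
  stable under the whole affine algebra, which replaces an appeal to the PBW theorem.\<close>

definition lowering_closed :: "'b cvec set \<Rightarrow> bool" where
  "lowering_closed S \<longleftrightarrow> cvec.subspace S \<and> S \<subseteq> mcarrier M \<and> hwv \<in> S \<and>
     (\<forall>a b n. lowering a b n \<longrightarrow> (\<forall>w\<in>S. mode M (G a b) n w \<in> S))"

definition lowered :: "'b cvec set" where
  "lowered = \<Inter> {S. lowering_closed S}"

lemma lowering_closedI:
  assumes "cvec.subspace S" "S \<subseteq> mcarrier M" "hwv \<in> S"
    "\<And>a b n w. lowering a b n \<Longrightarrow> w \<in> S \<Longrightarrow> mode M (G a b) n w \<in> S"
  shows "lowering_closed S"
  using assms unfolding lowering_closed_def by blast

lemma lowering_closedD:
  assumes "lowering_closed S"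
  shows "cvec.subspace S" "S \<subseteq> mcarrier M" "hwv \<in> S"
    "lowering a b n \<Longrightarrow> w \<in> S \<Longrightarrow> mode M (G a b) n w \<in> S"
  using assms unfolding lowering_closed_def by blast+

lemma lowering_closed_carrier: "lowering_closed (mcarrier M)"
  by (rule lowering_closedI) (auto simp: subspace hwv lowering_def intro!: mode_in G_in)

lemma lowered_closed: "lowering_closed lowered"
proof (rule lowering_closedI)
  show "cvec.subspace lowered"
    unfolding lowered_def by (rule cvec.subspace_Inter) (auto dest: lowering_closedD(1))
  show "lowered \<subseteq> mcarrier M" unfolding lowered_def using lowering_closed_carrier by blast
  show "hwv \<in> lowered" unfolding lowered_def by (auto dest: lowering_closedD(3))
  show "mode M (G a b) n w \<in> lowered" if "lowering a b n" "w \<in> lowered" for a b n w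
    using that(2) unfolding lowered_def by (auto dest: lowering_closedD(4)[OF _ that(1)])
qed

lemma lowered_least: "lowering_closed S \<Longrightarrow> lowered \<subseteq> S"
  unfolding lowered_def by blast

lemmas lowered = lowering_closedD[OF lowered_closed]

lemma lowered_in: "w \<in> lowered \<Longrightarrow> w \<in> mcarrier M"
  using lowered(2) by blast

text \<open>Base case of the stability: by the triangular decomposition a generator lowers the
  highest-weight vector, rescales it or kills it.\<close>

lemma hwv_generator:
  assumes ab: "a < 2*l" "b < 2*l"
  shows "mode M (G a b) n hwv \<in> lowered"
proof -
  note zero = cvec.subspace_0[OF lowered(1)]
  consider "lowering a b n" | "n > 0" | "n = 0" "a = b" | "n = 0" "hh_entry l a > hh_entry l b"
    using ab hh_entry_inject[OF ab] unfolding lowering_def by fastforce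
  then show ?thesis
  proof cases
    case 1
    then show ?thesis by (rule lowered(4)[OF _ lowered(3)])
  next
    case 2
    then have "mode M (G a b) n hwv = 0"
      using hwv(2) so_gen_in[OF ab] by (simp add: hw_vector_mod_def)
    then show ?thesis using zero by simp
  next
    case 3
    have "mode M (G a a) 0 hwv = act_h l k V J M (so_gen l a a) 0 0 hwv"
      by (simp add: act_h_def)
    then show ?thesis
      using 3 hwv_weight[OF so_gen_diag_cartan[OF ab(1)]] cvec.subspace_scale[OF lowered(1,3)] by simp
  next
    case 4
    then consider "so_gen l a b = 0\<^sub>m (2*l) (2*l)" | \<alpha> where "\<alpha> \<in> pos_roots l" "so_gen l a b \<in> root_space l \<alpha>"
      using so_gen_positive_root[OF ab] by blast
    then have "mode M (G a b) 0 hwv = 0"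
    proof cases
      case 1
      have "0\<^sub>m (2*l) (2*l) = (0 :: complex) \<cdot>\<^sub>m 0\<^sub>m (2*l) (2*l)" by (rule eq_matI) auto
      then have "J (so_gen l a b) = 0" using J_smult[OF so_alg_zero, of 0] 1 by simp
      then show ?thesis using mode_zero_left[OF hwv(1)] by simp
    next
      case 2
      then show ?thesis using hwv(2) by (simp add: hw_vector_mod_def)
    qed
    then show ?thesis using 4 zero by simp
  qed
qed

lemma subspace_mode_closed:
  assumes S: "cvec.subspace S" "S \<subseteq> mcarrier M"
    and a: "a \<in> vcarrier V"
  shows "cvec.subspace {w \<in> S. mode M a n w \<in> S}"
  by (rule subspace_linear_vimage[OF S(1) linear_on_subset[OF mode_linear[OF a] S(2)] S(1)])

lemma loop_expansion:
  assumes x: "x \<in> so_alg l" and w: "w \<in> mcarrier M"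
  shows "mode M (J x) n w = (\<Sum>a<2*l. \<Sum>b<2*l. smul (x $$ (a, b) / 2) (mode M (G a b) n w))"
proof -
  note lin = mode_linear_left[OF w, of n]
  have in_V: "(\<Sum>b<2*l. smul (x $$ (a, b) / 2) (G a b)) \<in> vcarrier V" if "a < 2*l" for a
    using that by (intro cvec.subspace_sum[OF V_subspace] cvec.subspace_scale[OF V_subspace] G_in) auto
  have "mode M (J x) n w = (\<Sum>a<2*l. mode M (\<Sum>b<2*l. smul (x $$ (a, b) / 2) (G a b)) n w)"
    unfolding J_half_expansion[OF x] by (rule linear_on_sum[OF lin V_subspace]) (simp add: in_V)
  also have "\<dots> = (\<Sum>a<2*l. \<Sum>b<2*l. smul (x $$ (a, b) / 2) (mode M (G a b) n w))"
    by (intro sum.cong refl linear_on_combination[OF lin V_subspace] G_in) auto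
  finally show ?thesis .
qed

lemma loop_in_if_generators:
  assumes x: "x \<in> so_alg l" and w: "w \<in> mcarrier M" and S: "cvec.subspace S"
    and gen: "\<And>a b. a < 2*l \<Longrightarrow> b < 2*l \<Longrightarrow> mode M (G a b) n w \<in> S"
  shows "mode M (J x) n w \<in> S"
  unfolding loop_expansion[OF x w] using gen
  by (intro cvec.subspace_sum[OF S] cvec.subspace_scale[OF S]) simp

text \<open>Exchanging a generator with a lowering operator costs a bracket applied to w and a
  multiple of w, and both stay in \<open>lowered\<close>.\<close>

lemma lowered_generator:
  assumes ab: "a < 2*l" "b < 2*l" and w: "w \<in> lowered"
  shows "mode M (G a b) n w \<in> lowered"
proof -
  \<comment> \<open>All generators and all modes are quantified at once, since the bracket has mode
    m + n and expands into arbitrary generators.\<close>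
  define S where "S = {w \<in> lowered. \<forall>a<2*l. \<forall>b<2*l. \<forall>n. mode M (G a b) n w \<in> lowered}"
  have S_eq: "S = (\<Inter>p\<in>{..<2*l} \<times> {..<2*l} \<times> UNIV. {w \<in> lowered. mode M (G (fst p) (fst (snd p))) (snd (snd p)) w \<in> lowered}) \<inter> lowered"
    by (auto simp: S_def)
  have "lowering_closed S"
  proof (rule lowering_closedI)
    show "cvec.subspace S"
      unfolding S_eq
      by (intro cvec.subspace_inter lowered(1) cvec.subspace_Inter ballI)
        (auto intro!: subspace_mode_closed[OF lowered(1,2)] G_in)
    show "S \<subseteq> mcarrier M" unfolding S_def using lowered(2) by blast
    show "hwv \<in> S" unfolding S_def using lowered(3) hwv_generator by blast
    fix a b n w assume low: "lowering a b n" and w: "w \<in> S"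
    have ab: "a < 2*l" "b < 2*l" using low by (auto simp: lowering_def)
    have wl: "w \<in> lowered" and wS: "\<And>a b n. a < 2*l \<Longrightarrow> b < 2*l \<Longrightarrow> mode M (G a b) n w \<in> lowered"
      using w by (auto simp: S_def)
    have "mode M (G c d) m (mode M (G a b) n w) \<in> lowered" if cd: "c < 2*l" "d < 2*l" for c d m
    proof -
      have "mode M (G a b) n (mode M (G c d) m w) \<in> lowered"
        by (rule lowered(4)[OF low wS[OF cd]])
      moreover have "mode M (J (lie (so_gen l c d) (so_gen l a b))) (m + n) w \<in> lowered"
        using ab cd by (intro loop_in_if_generators[OF _ lowered_in[OF wl] lowered(1) wS] so_alg_lie so_gen_in)
      moreover have "(if m + n = 0 then smul (of_int m * (k * inv_form l (so_gen l c d) (so_gen l a b))) w else 0) \<in> lowered"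
        using cvec.subspace_scale[OF lowered(1) wl] cvec.subspace_0[OF lowered(1)] by simp
      ultimately show ?thesis
        unfolding current_commutator[OF so_gen_in[OF cd] so_gen_in[OF ab] lowered_in[OF wl]]
        by (intro cvec.subspace_add[OF lowered(1)])
    qed
    then show "mode M (G a b) n w \<in> S" unfolding S_def using wS[OF ab] by blast
  qed
  then have "w \<in> S" using lowered_least w by blast
  then show ?thesis unfolding S_def using ab by blast
qed

text \<open>L_0 acts on the highest-weight vector by a scalar, and moves past a lowering operator at
  the cost of a multiple of that operator.\<close>

lemma lowered_sugawara:
  assumes "w \<in> lowered"
  shows "mode M (sugawara l k V J) 1 w \<in> lowered"
proof -
  define S where "S = {w \<in> lowered. mode M (sugawara l k V J) 1 w \<in> lowered}"
  have "lowering_closed S"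
  proof (rule lowering_closedI)
    show "cvec.subspace S" unfolding S_def by (rule subspace_mode_closed[OF lowered(1,2) sugawara_in])
    show "S \<subseteq> mcarrier M" unfolding S_def using lowered(2) by blast
    \<comment> \<open>L_0 is isolated by comparing the coefficients 1 and 0 of d next to the same
      diagonal element.\<close>
    have "act_h l k V J M (hh_diag l) 0 1 hwv = mode M (J (hh_diag l)) 0 hwv - mode M (sugawara l k V J) 1 hwv"
      "act_h l k V J M (hh_diag l) 0 0 hwv = mode M (J (hh_diag l)) 0 hwv"
      by (simp_all add: act_h_def)
    then have "mode M (sugawara l k V J) 1 hwv =
        act_h l k V J M (hh_diag l) 0 0 hwv - act_h l k V J M (hh_diag l) 0 1 hwv" by simp
    then have "mode M (sugawara l k V J) 1 hwv \<in> lowered"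
      unfolding hwv_weight[OF hh_diag_cartan]
      using cvec.subspace_scale[OF lowered(1,3)] cvec.subspace_diff[OF lowered(1)] by simp
    then show "hwv \<in> S" using lowered(3) by (simp add: S_def)
    fix a b n w assume low: "lowering a b n" and w: "w \<in> S"
    then have ab: "a < 2*l" "b < 2*l" and wl: "w \<in> lowered" "mode M (sugawara l k V J) 1 w \<in> lowered"
      by (auto simp: lowering_def S_def)
    have "mode M (sugawara l k V J) 1 (mode M (G a b) n w) =
        mode M (G a b) n (mode M (sugawara l k V J) 1 w) - smul (of_int n) (mode M (G a b) n w)"
      using current_sugawara_mode[OF so_gen_in[OF ab] nondeg lowered_in[OF wl(1)], of n] by simp
    then have "mode M (sugawara l k V J) 1 (mode M (G a b) n w) \<in> lowered"
      using lowered(4)[OF low wl(1)] lowered(4)[OF low wl(2)]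
      by (simp add: cvec.subspace_diff[OF lowered(1)] cvec.subspace_scale[OF lowered(1)])
    then show "mode M (G a b) n w \<in> S" using lowered(4)[OF low wl(1)] by (simp add: S_def)
  qed
  then show ?thesis using lowered_least assms by (auto simp: S_def)
qed

lemma lowered_eq: "lowered = mcarrier M"
proof -
  have "act l k V J M X w \<in> lowered" if X: "X \<in> affine_span l" and w: "w \<in> lowered" for X w
  proof -
    consider x n where "X = Loop x n" "x \<in> so_alg l" | "X = Central" | "X = Deriv"
      using X by (auto simp: affine_span_def)
    then show ?thesis
    proof cases
      case 1
      then show ?thesis
        using loop_in_if_generators[OF _ lowered_in[OF w] lowered(1) lowered_generator[OF _ _ w]] by simp
    next
      case 2
      then show ?thesis using cvec.subspace_scale[OF lowered(1) w] by simp
    next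
      case 3
      then show ?thesis using cvec.subspace_neg[OF lowered(1) lowered_sugawara[OF w]] by simp
    qed
  qed
  then have "affine_submodule l k V J M lowered"
    using lowered(1,2) unfolding affine_submodule_def by blast
  then show ?thesis using irreducible[of lowered] lowered(3) hwv_nonzero by blast
qed

section \<open>Weights below the highest weight\<close>

definition low_values :: "complex set" where
  "low_values = {hh_value l \<theta> - of_nat n | n. n \<ge> (1::nat)}"

text \<open>True eigenvectors suffice: the highest-weight vector is one, and lowering operators
  shift eigenvalues.\<close>

definition low_eigenvectors :: "'b cvec set" where
  "low_eigenvectors = {v \<in> mcarrier M. \<exists>c\<in>low_values. hh M v = smul c v}"

lemma hwv_not_low: "hh_value l \<theta> \<notin> low_values"
  by (auto simp: low_values_def)

lemma lowering_eigenvector: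
  assumes low: "lowering a b n" and v: "v \<in> mcarrier M" and ev: "hh M v = smul c v"
    and c: "c = hh_value l \<theta> \<or> c \<in> low_values"
  shows "mode M (G a b) n v \<in> low_eigenvectors"
proof -
  have ab: "a < 2*l" "b < 2*l" using low by (auto simp: lowering_def)
  have w: "mode M (G a b) n v \<in> mcarrier M" using mode_in G_in ab v by blast
  have "hh M (mode M (G a b) n v) = smul (c + of_int (hh_deg a b n)) (mode M (G a b) n v)"
    unfolding hh_commutator[OF va_module nondeg ab v] ev linear_on_smul[OF mode_linear[OF G_in[OF ab]] v]
      cvec.scale_left_distrib ..
  moreover obtain d where d: "of_int (hh_deg a b n) = - (of_nat d :: complex)" "d \<ge> 1"
  proof (rule that[of "nat (- hh_deg a b n)"])
    show "of_int (hh_deg a b n) = - (of_nat (nat (- hh_deg a b n)) :: complex)"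
      using lowering_deg[OF low] by simp
    show "1 \<le> nat (- hh_deg a b n)" using lowering_deg[OF low] by simp
  qed
  moreover have "c - of_nat d \<in> low_values"
    using c
  proof
    assume "c = hh_value l \<theta>"
    then show ?thesis using d(2) by (auto simp: low_values_def)
  next
    assume "c \<in> low_values"
    then obtain m :: nat where "m \<ge> 1" "c = hh_value l \<theta> - of_nat m"
      by (auto simp: low_values_def)
    then show ?thesis unfolding low_values_def by (intro CollectI exI[of _ "m + d"]) simp
  qed
  ultimately show ?thesis using w by (auto simp: low_eigenvectors_def)
qed

text \<open>The vectors of this form are closed under lowering, because lowering carries both the
  highest-weight vector and the low part into the low part.\<close>

lemma lowered_decomposition:
  assumes "w \<in> mcarrier M"
  shows "\<exists>c. w - smul c hwv \<in> cvec.span low_eigenvectors"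
proof -
  let ?T = "cvec.span low_eigenvectors"
  have T: "?T \<subseteq> mcarrier M"
    by (rule cvec.span_minimal[OF _ subspace]) (auto simp: low_eigenvectors_def)
  define S where "S = {w \<in> mcarrier M. \<exists>c. w - smul c hwv \<in> ?T}"
  have "lowering_closed S"
  proof (rule lowering_closedI)
    show "cvec.subspace S"
    proof (rule cvec.subspaceI)
      show "0 \<in> S" unfolding S_def using cvec.subspace_0[OF subspace]
        by (intro CollectI conjI exI[of _ 0]) (simp_all add: cvec.span_zero)
    next
      fix x y assume "x \<in> S" "y \<in> S"
      then obtain c d where xy: "x \<in> mcarrier M" "y \<in> mcarrier M" "x - smul c hwv \<in> ?T" "y - smul d hwv \<in> ?T"
        unfolding S_def by blast
      have "x + y - smul (c + d) hwv = (x - smul c hwv) + (y - smul d hwv)"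
        by (simp add: cvec.scale_left_distrib)
      then have "x + y - smul (c + d) hwv \<in> ?T" using xy(3,4) by (simp only: cvec.span_add)
      then show "x + y \<in> S" unfolding S_def using cvec.subspace_add[OF subspace xy(1,2)] by blast
    next
      fix r x assume "x \<in> S"
      then obtain c where x: "x \<in> mcarrier M" "x - smul c hwv \<in> ?T" unfolding S_def by blast
      have "smul r x - smul (r * c) hwv = smul r (x - smul c hwv)"
        by (simp add: cvec.scale_right_diff_distrib)
      then have "smul r x - smul (r * c) hwv \<in> ?T" using x(2) by (simp only: cvec.span_scale)
      then show "smul r x \<in> S" unfolding S_def using cvec.subspace_scale[OF subspace x(1)] by blast
    qed
    show "S \<subseteq> mcarrier M" by (auto simp: S_def)
    show "hwv \<in> S" unfolding S_def using hwv(1)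
      by (intro CollectI conjI exI[of _ 1]) (simp_all add: cvec.span_zero)
    fix a b n w assume low: "lowering a b n" and w: "w \<in> S"
    then obtain c where w: "w \<in> mcarrier M" "w - smul c hwv \<in> ?T" unfolding S_def by blast
    have ab: "a < 2*l" "b < 2*l" using low by (auto simp: lowering_def)
    note lin = mode_linear[OF G_in[OF ab], of n]
    have "?T \<subseteq> {t \<in> mcarrier M. mode M (G a b) n t \<in> ?T}"
    proof (rule cvec.span_minimal)
      show "low_eigenvectors \<subseteq> {t \<in> mcarrier M. mode M (G a b) n t \<in> ?T}"
      proof
        fix t assume "t \<in> low_eigenvectors"
        then obtain d where t: "t \<in> mcarrier M" "d \<in> low_values" "hh M t = smul d t"
          unfolding low_eigenvectors_def by blast
        have "mode M (G a b) n t \<in> ?T"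
          by (rule cvec.span_base[OF lowering_eigenvector[OF low t(1,3) disjI2[OF t(2)]]])
        then show "t \<in> {t \<in> mcarrier M. mode M (G a b) n t \<in> ?T}" using t(1) by blast
      qed
      show "cvec.subspace {t \<in> mcarrier M. mode M (G a b) n t \<in> ?T}"
        by (rule subspace_linear_vimage[OF subspace lin cvec.subspace_span])
    qed
    then have t: "mode M (G a b) n (w - smul c hwv) \<in> ?T" using w(2) by blast
    have "mode M (G a b) n hwv \<in> low_eigenvectors"
      by (rule lowering_eigenvector[OF low hwv(1) hwv_weight[OF hh_diag_cartan]]) simp
    then have "smul c (mode M (G a b) n hwv) \<in> ?T" by (intro cvec.span_scale cvec.span_base)
    then have "mode M (G a b) n (w - smul c hwv) + smul c (mode M (G a b) n hwv) \<in> ?T"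
      by (rule cvec.span_add[OF t])
    also have "mode M (G a b) n (w - smul c hwv) + smul c (mode M (G a b) n hwv) = mode M (G a b) n w"
      using linear_on_diff[OF lin subspace w(1) cvec.subspace_scale[OF subspace hwv(1)]]
        linear_on_smul[OF lin hwv(1)] by simp
    \<comment> \<open>After a lowering step the coefficient of the highest-weight vector is
      0.\<close>
    finally have "mode M (G a b) n w - smul 0 hwv \<in> ?T" by simp
    then show "mode M (G a b) n w \<in> S" unfolding S_def using mode_in[OF G_in[OF ab] w(1)] by blast
  qed
  then show ?thesis using lowered_least assms unfolding lowered_eq by (auto simp: S_def)
qed

text \<open>A weight vector whose grading value is not low is a multiple of the highest-weight
  vector. The grading value alone need not determine \<mu>; comparison on the whole Cartan
  subalgebra does.\<close>

lemma weights_below: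
  assumes \<theta>: "\<theta> \<in> hdual l" and \<mu>: "\<mu> \<in> hdual l" and nz: "gws M \<mu> \<noteq> {0}"
  shows "\<mu> = \<theta> \<or> hh_value l \<mu> \<in> low_values"
proof (rule disjCI)
  assume notlow: "hh_value l \<mu> \<notin> low_values"
  obtain v where v: "v \<in> gws M \<mu>" "v \<noteq> 0"
    using nz cvec.subspace_0[OF gws_subspace[OF va_module]] by blast
  have vM: "v \<in> mcarrier M"
    and ev: "\<And>H c e. H \<in> cartan l \<Longrightarrow> gen_eigenvector (act_h l k V J M H c e) (weval l \<mu> H c e) v"
    using v(1) by (auto simp: gws_iff)
  obtain r where r: "v - smul r hwv \<in> cvec.span low_eigenvectors"
    using lowered_decomposition[OF vM] by blast
  have vr: "v = smul r hwv"
    using invariant_subspace.gen_eigenvector_in_eigen_sum[OF invariant_subspace_act_h[OF va_module hh_diag_cartan]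
      vM ev[OF hh_diag_cartan] v(2) hwv(1) hwv_weight[OF hh_diag_cartan] _ _ r notlow hwv_not_low]
    by (auto simp: low_eigenvectors_def)
  show "\<mu> = \<theta>"
  proof (rule weight_eqI[OF \<mu> \<theta>])
    fix H c e assume H: "H \<in> cartan l"
    interpret inv: invariant_subspace "mcarrier M" "act_h l k V J M H c e"
      by (rule invariant_subspace_act_h[OF va_module H])
    have "act_h l k V J M H c e v = smul (weval l \<theta> H c e) v"
      unfolding vr linear_on_smul[OF inv.lin hwv(1)] hwv_weight[OF H] by (simp add: mult.commute)
    then have "weval l \<theta> H c e = weval l \<mu> H c e"
      by (rule inv.true_gen_eigenvalue[OF vM v(2) _ ev[OF H]])
    then show "weval l \<mu> H c e = weval l \<theta> H c e" by (rule sym)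
  qed
qed

end

section \<open>The Grothendieck group\<close>

lemma K0_relations_subset:
  "K0_relations V Ob \<subseteq> carrier (free_Abelian_group Ob)"
  and subgroup_K0_relations: "subgroup (K0_relations V Ob) (free_Abelian_group Ob)"
proof -
  let ?S = "{frag_of M - frag_of M' - frag_of M'' | M' M M''.
        M' \<in> Ob \<and> M \<in> Ob \<and> M'' \<in> Ob \<and> short_exact V M' M M''}"
  have diff: "Poly_Mapping.keys (a - b) \<subseteq> Ob" if "Poly_Mapping.keys a \<subseteq> Ob" "Poly_Mapping.keys b \<subseteq> Ob"
    for a b :: "('a, 'b) vmod \<Rightarrow>\<^sub>0 int"
    using that keys_diff[of a b] by blast
  have "?S \<subseteq> carrier (free_Abelian_group Ob)"
  proof
    fix x assume "x \<in> ?S"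
    then obtain M' M M'' where x: "x = frag_of M - frag_of M' - frag_of M''" "M' \<in> Ob" "M \<in> Ob" "M'' \<in> Ob"
      by blast
    then show "x \<in> carrier (free_Abelian_group Ob)"
      unfolding carrier_free_Abelian_group_iff x(1) by (intro diff) simp_all
  qed
  then show "subgroup (K0_relations V Ob) (free_Abelian_group Ob)"
    unfolding K0_relations_def by (rule group.generate_is_subgroup[OF group_free_Abelian_group])
  then show "K0_relations V Ob \<subseteq> carrier (free_Abelian_group Ob)"
    by (rule subgroup.subset)
qed

lemma K0_relations_keys: "c \<in> K0_relations V Ob \<Longrightarrow> Poly_Mapping.keys c \<subseteq> Ob"
  using subsetD[OF K0_relations_subset] by (simp only: carrier_free_Abelian_group_iff)

lemma K0_relations_zero: "0 \<in> K0_relations V Ob"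
  using subgroup.one_closed[OF subgroup_K0_relations] by simp

lemma K0_relations_add: "x \<in> K0_relations V Ob \<Longrightarrow> y \<in> K0_relations V Ob \<Longrightarrow> x + y \<in> K0_relations V Ob"
  using subgroup.m_closed[OF subgroup_K0_relations] by fastforce

lemma K0_relations_minus: "x \<in> K0_relations V Ob \<Longrightarrow> - x \<in> K0_relations V Ob"
  using subgroup.m_inv_closed[OF subgroup_K0_relations, of x V Ob] K0_relations_keys[of x V Ob] by simp

lemma K0_relations_diff: "x \<in> K0_relations V Ob \<Longrightarrow> y \<in> K0_relations V Ob \<Longrightarrow> x - y \<in> K0_relations V Ob"
  using K0_relations_add[OF _ K0_relations_minus] by fastforce

lemma K0_relations_exact:
  assumes "M' \<in> Ob" "M \<in> Ob" "M'' \<in> Ob" "short_exact V M' M M''"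
  shows "frag_of M - frag_of M' - frag_of M'' \<in> K0_relations V Ob"
  unfolding K0_relations_def by (rule generate.incl) (use assms in blast)

text \<open>An additive function on objects extends to the free group. The target, generated by
  \<open>frag_of ()\<close>, is a copy of the integers.\<close>

lemma additive_vanishes_on_K0_relations:
  fixes f :: "('v, 'b) vmod \<Rightarrow> int"
  assumes add: "\<And>M' M M''. M' \<in> Ob \<Longrightarrow> M \<in> Ob \<Longrightarrow> M'' \<in> Ob \<Longrightarrow> short_exact V M' M M'' \<Longrightarrow> f M = f M' + f M''"
    and c: "c \<in> K0_relations V Ob"
  shows "frag_extend (\<lambda>M. frag_cmul (f M) (frag_of ())) c = 0"
proof -
  let ?F = "frag_extend (\<lambda>M. frag_cmul (f M) (frag_of ()))"
  have rel: "?F (frag_of M - frag_of M' - frag_of M'') = 0"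
    if "M' \<in> Ob" "M \<in> Ob" "M'' \<in> Ob" "short_exact V M' M M''" for M' M M''
    using add[OF that] by (simp add: frag_extend_diff frag_cmul_distrib)
  have "?F c = 0 \<and> Poly_Mapping.keys c \<subseteq> Ob"
    using c[unfolded K0_relations_def]
  proof (induction rule: generate.induct)
    case (inv h)
    then have "h \<in> K0_relations V Ob" unfolding K0_relations_def by (rule generate.incl)
    then have "Poly_Mapping.keys h \<subseteq> Ob" by (rule K0_relations_keys)
    then show ?case using inv rel by (auto simp: frag_extend_minus)
  next
    case (incl h)
    then have "h \<in> K0_relations V Ob" unfolding K0_relations_def by (rule generate.incl)
    then have "Poly_Mapping.keys h \<subseteq> Ob" by (rule K0_relations_keys)
    then show ?case using incl rel by auto
  next
    case (eng h1 h2)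
    then show ?case using Poly_Mapping.keys_add[of h1 h2] by (auto simp: frag_extend_add)
  qed simp
  then show ?thesis by simp
qed

text \<open>Generation and independence are phrased in the free group modulo relations, which
  confines the arithmetic of cosets to this proof.\<close>

lemma K0_free_basis:
  fixes L :: "'i \<Rightarrow> ('v, 'b) vmod"
  assumes L: "\<And>i. i \<in> I \<Longrightarrow> L i \<in> Ob"
    and gen: "\<And>M. M \<in> Ob \<Longrightarrow> \<exists>e. Poly_Mapping.keys e \<subseteq> I \<and>
        frag_of M - frag_extend (frag_of \<circ> L) e \<in> K0_relations V Ob"
    and indep: "\<And>e. Poly_Mapping.keys e \<subseteq> I \<Longrightarrow> frag_extend (frag_of \<circ> L) e \<in> K0_relations V Ob \<Longrightarrow> e = 0"
  shows "\<exists>\<phi>\<in>iso (free_Abelian_group I) (K0 V Ob). \<forall>i\<in>I. \<phi> (frag_of i) = K0_class V Ob (L i)"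
proof -
  let ?F = "free_Abelian_group Ob" and ?R = "K0_relations V Ob" and ?X = "frag_extend (frag_of \<circ> L)"
  let ?\<phi> = "\<lambda>e. ?R #>\<^bsub>?F\<^esub> ?X e"
  interpret F: comm_group ?F by (rule abelian_free_Abelian_group)
  interpret R: normal ?R ?F by (rule F.subgroup_imp_normal[OF subgroup_K0_relations])
  have X: "?X e \<in> carrier ?F" if "Poly_Mapping.keys e \<subseteq> I" for e
    using that keys_frag_extend[of "frag_of \<circ> L" e] L by fastforce
  have coset_eq: "?R #>\<^bsub>?F\<^esub> x = ?R #>\<^bsub>?F\<^esub> y \<longleftrightarrow> x - y \<in> ?R" if "x \<in> carrier ?F" "y \<in> carrier ?F" for x y
  proof
    assume "?R #>\<^bsub>?F\<^esub> x = ?R #>\<^bsub>?F\<^esub> y"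
    then have "x \<in> ?R #>\<^bsub>?F\<^esub> y" using F.rcos_self[OF that(1) subgroup_K0_relations[of V]] by simp
    then show "x - y \<in> ?R" by (auto simp: r_coset_def)
  next
    assume "x - y \<in> ?R"
    then have "x \<in> ?R #>\<^bsub>?F\<^esub> y" by (auto simp: r_coset_def intro!: bexI[of _ "x - y"])
    then show "?R #>\<^bsub>?F\<^esub> x = ?R #>\<^bsub>?F\<^esub> y"
      using F.repr_independence[OF _ that(2) subgroup_K0_relations] by simp
  qed
  have span: "\<exists>e. Poly_Mapping.keys e \<subseteq> I \<and> c - ?X e \<in> ?R" if "Poly_Mapping.keys c \<subseteq> Ob" for c
    using that
  proof (induction c rule: frag_induction)
    case zero
    show ?case using K0_relations_zero by (intro exI[of _ 0]) simp
  next
    case (one M)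
    then show ?case using gen by blast
  next
    case (diff a b)
    then obtain e e' where e: "Poly_Mapping.keys e \<subseteq> I" "a - ?X e \<in> ?R"
      "Poly_Mapping.keys e' \<subseteq> I" "b - ?X e' \<in> ?R" by blast
    have "?X (e - e') = ?X e - ?X e'"
      using frag_extend_add[of "frag_of \<circ> L" e "- e'"] by (simp add: frag_extend_minus)
    then have eq: "a - b - ?X (e - e') = (a - ?X e) - (b - ?X e')" by simp
    have "a - b - ?X (e - e') \<in> ?R" unfolding eq by (rule K0_relations_diff[OF e(2,4)])
    moreover have "Poly_Mapping.keys (e - e') \<subseteq> I" using keys_diff[of e e'] e by blast
    ultimately show ?case by blast
  qed
  have "?\<phi> \<in> iso (free_Abelian_group I) (K0 V Ob)"
  proof (rule isoI)
    show "?\<phi> \<in> hom (free_Abelian_group I) (K0 V Ob)"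
    proof (rule homI)
      fix x assume "x \<in> carrier (free_Abelian_group I)"
      then show "?\<phi> x \<in> carrier (K0 V Ob)" using X by (auto simp: K0_def FactGroup_def RCOSETS_def)
    next
      fix x y assume "x \<in> carrier (free_Abelian_group I)" "y \<in> carrier (free_Abelian_group I)"
      then have "?X x \<in> carrier ?F" "?X y \<in> carrier ?F" using X by auto
      then show "?\<phi> (x \<otimes>\<^bsub>free_Abelian_group I\<^esub> y) = ?\<phi> x \<otimes>\<^bsub>K0 V Ob\<^esub> ?\<phi> y"
        using R.rcos_sum[of "?X x" "?X y"]
        by (simp add: K0_def FactGroup_def frag_extend_add del: carrier_free_Abelian_group_iff)
    qed
    show "bij_betw ?\<phi> (carrier (free_Abelian_group I)) (carrier (K0 V Ob))"
    proof (rule bij_betw_imageI)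
      show "inj_on ?\<phi> (carrier (free_Abelian_group I))"
      proof (rule inj_onI)
        fix x y assume "x \<in> carrier (free_Abelian_group I)" "y \<in> carrier (free_Abelian_group I)" and eq: "?\<phi> x = ?\<phi> y"
        then have xy: "Poly_Mapping.keys x \<subseteq> I" "Poly_Mapping.keys y \<subseteq> I" by auto
        have "?X (x - y) \<in> ?R"
          using eq coset_eq[OF X[OF xy(1)] X[OF xy(2)]] frag_extend_add[of "frag_of \<circ> L" x "- y"]
          by (simp add: frag_extend_minus)
        moreover have "Poly_Mapping.keys (x - y) \<subseteq> I" using keys_diff[of x y] xy by blast
        ultimately have "x - y = 0" using indep by blast
        then show "x = y" by simp
      qed
      show "?\<phi> ` carrier (free_Abelian_group I) = carrier (K0 V Ob)"
      proof (intro subset_antisym subsetI)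
        fix A assume "A \<in> carrier (K0 V Ob)"
        then obtain c where c: "c \<in> carrier ?F" "A = ?R #>\<^bsub>?F\<^esub> c"
          by (auto simp: K0_def FactGroup_def RCOSETS_def)
        have "Poly_Mapping.keys c \<subseteq> Ob" using c(1) by simp
        from span[OF this] obtain e where e: "Poly_Mapping.keys e \<subseteq> I" "c - ?X e \<in> ?R" by (elim exE conjE)
        then have "A = ?\<phi> e" using coset_eq[OF c(1) X[OF e(1)]] c(2) by simp
        then show "A \<in> ?\<phi> ` carrier (free_Abelian_group I)" using e(1) by auto
      next
        fix A assume "A \<in> ?\<phi> ` carrier (free_Abelian_group I)"
        then show "A \<in> carrier (K0 V Ob)" using X by (auto simp: K0_def FactGroup_def RCOSETS_def)
      qed
    qed
  qed
  then show ?thesis by (rule bexI[rotated]) (simp add: K0_class_def)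
qed

section \<open>Simple objects and finite length\<close>

context linkage_category begin

lemma va_hom_inclusion:
  "N \<subseteq> mcarrier M \<Longrightarrow> va_hom V (M\<lparr>mcarrier := N\<rparr>) M (\<lambda>u. u)"
  by (auto simp: va_hom_def linear_on_def)

lemma short_exact_quotient:
  assumes "va_hom V M Q g" "g ` mcarrier M = mcarrier Q" "{u \<in> mcarrier M. g u = 0} = N"
  shows "short_exact V (M\<lparr>mcarrier := N\<rparr>) M Q"
proof -
  have "N \<subseteq> mcarrier M" using assms(3) by blast
  note incl = va_hom_inclusion[OF this]
  show ?thesis
    unfolding short_exact_def
    by (rule exI, rule exI, intro conjI, rule incl, rule assms(1), simp, rule assms(2)) (simp add: assms(3))
qed

lemma short_exact_zero:
  assumes "va_module V M"
  shows "short_exact V (M\<lparr>mcarrier := {0}\<rparr>) (M\<lparr>mcarrier := {0}\<rparr>) (M\<lparr>mcarrier := {0}\<rparr>)"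
proof -
  interpret current_fields V "mcarrier M" "mode M" l "-1" J by (rule current_fields[OF assms])
  show ?thesis
    unfolding short_exact_def
    by (intro exI[of _ "\<lambda>u. u"]) (auto simp: va_hom_def linear_on_def)
qed

text \<open>The sequence of three zero modules gives [0] = [0] + [0]. Each M has its own zero
  object, since the modes are part of the data.\<close>

lemma zero_module_relation:
  assumes "M \<in> Ob"
  shows "frag_of (M\<lparr>mcarrier := {0}\<rparr>) \<in> K0_relations V Ob"
proof -
  note M = Ob_va_module[OF assms]
  have "M\<lparr>mcarrier := {0}\<rparr> \<in> Ob" by (rule Ob_submodule[OF assms va_submodule_zero[OF M]])
  from K0_relations_exact[OF this this this short_exact_zero[OF M]]
  have "- frag_of (M\<lparr>mcarrier := {0}\<rparr>) \<in> K0_relations V Ob" by simp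
  from K0_relations_minus[OF this] show ?thesis by simp
qed

text \<open>An isomorphism is a surjection with zero kernel, so its exact sequence equates the two
  classes up to that of a zero module.\<close>

lemma isomorphic_relation:
  assumes M: "M \<in> Ob" and N: "N \<in> Ob" and iso: "va_isomorphic V M N"
  shows "frag_of M - frag_of N \<in> K0_relations V Ob"
proof -
  note Mm = Ob_va_module[OF M]
  obtain f where f: "va_hom V M N f" "bij_betw f (mcarrier M) (mcarrier N)"
    using iso unfolding va_isomorphic_def by blast
  have lin: "linear_on (mcarrier M) f" and sub: "cvec.subspace (mcarrier M)"
    using f(1) va_submodule_self[OF Mm] by (simp_all add: va_hom_def va_submodule_def)
  have "{u \<in> mcarrier M. f u = 0} = {0}"
  proof (intro subset_antisym subsetI)
    fix u assume "u \<in> {u \<in> mcarrier M. f u = 0}"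
    then have "u \<in> mcarrier M" "f u = f 0" using linear_on_zero[OF lin sub] by simp_all
    then show "u \<in> {0}" using inj_onD[OF bij_betw_imp_inj_on[OF f(2)]] cvec.subspace_0[OF sub] by blast
  qed (use linear_on_zero[OF lin sub] cvec.subspace_0[OF sub] in simp)
  then have "short_exact V (M\<lparr>mcarrier := {0}\<rparr>) M N"
    using bij_betw_imp_surj_on[OF f(2)] by (intro short_exact_quotient[OF f(1)])
  from K0_relations_exact[OF Ob_submodule[OF M va_submodule_zero[OF Mm]] M N this]
  have "frag_of M - frag_of (M\<lparr>mcarrier := {0}\<rparr>) - frag_of N \<in> K0_relations V Ob" .
  from K0_relations_add[OF this zero_module_relation[OF M]] show ?thesis by simp
qed

lemma isomorphic_gws_nonzero:
  assumes M: "M \<in> Ob" and N: "N \<in> Ob" and iso: "va_isomorphic V M N" and \<mu>: "\<mu> \<in> hdual l"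
    and nz: "gws N \<mu> \<noteq> {0}"
  shows "gws M \<mu> \<noteq> {0}"
proof
  assume zero: "gws M \<mu> = {0}"
  obtain f where f: "va_hom V M N f" "bij_betw f (mcarrier M) (mcarrier N)"
    using iso unfolding va_isomorphic_def by blast
  have "f 0 = 0" by (rule va_hom_0[OF Ob_va_module[OF M] f(1)])
  then show False
    using gws_hom_image[OF Ob_va_module[OF M] Ob_va_module[OF N] f(1) bij_betw_imp_surj_on[OF f(2)]
      Ob_decomposable[OF M] \<mu>] zero nz by simp
qed

section \<open>Submodules and simple subquotients\<close>

lemma va_submodule_mcarrier:
  "P \<subseteq> mcarrier M \<Longrightarrow> va_submodule V (M\<lparr>mcarrier := P\<rparr>) N \<Longrightarrow> va_submodule V M N"
  by (auto simp: va_submodule_def)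

lemma va_submodule_Inter:
  assumes "A \<noteq> {}" "\<And>N. N \<in> A \<Longrightarrow> va_submodule V M N"
  shows "va_submodule V M (\<Inter>A)"
  unfolding va_submodule_def
proof (intro conjI ballI allI)
  show "cvec.subspace (\<Inter>A)" using assms by (intro cvec.subspace_Inter) (auto simp: va_submodule_def)
  show "\<Inter>A \<subseteq> mcarrier M" using assms by (auto simp: va_submodule_def)
  show "mode M a n u \<in> \<Inter>A" if "a \<in> vcarrier V" "u \<in> \<Inter>A" for a n u
    using assms(2) that by (auto simp: va_submodule_def)
qed

lemma va_submodule_Union_chain:
  assumes "A \<noteq> {}" "\<And>N. N \<in> A \<Longrightarrow> va_submodule V M N" "\<And>N P. N \<in> A \<Longrightarrow> P \<in> A \<Longrightarrow> N \<subseteq> P \<or> P \<subseteq> N"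
  shows "va_submodule V M (\<Union>A)"
  unfolding va_submodule_def
proof (intro conjI ballI allI)
  show "cvec.subspace (\<Union>A)"
  proof (rule cvec.subspaceI)
    show "0 \<in> \<Union>A" using assms(1,2) by (auto simp: va_submodule_def cvec.subspace_0)
  next
    fix x y assume "x \<in> \<Union>A" "y \<in> \<Union>A"
    then obtain N where "N \<in> A" "x \<in> N" "y \<in> N" using assms(3) by blast
    then have "x + y \<in> N" using assms(2)[of N] by (intro cvec.subspace_add) (simp_all add: va_submodule_def)
    then show "x + y \<in> \<Union>A" using \<open>N \<in> A\<close> by blast
  next
    fix c x assume "x \<in> \<Union>A"
    then obtain N where "N \<in> A" "x \<in> N" by blast
    then have "smul c x \<in> N" using assms(2)[of N] by (intro cvec.subspace_scale) (simp_all add: va_submodule_def)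
    then show "smul c x \<in> \<Union>A" using \<open>N \<in> A\<close> by blast
  qed
  show "\<Union>A \<subseteq> mcarrier M" using assms(2) by (auto simp: va_submodule_def)
  show "mode M a n u \<in> \<Union>A" if "a \<in> vcarrier V" "u \<in> \<Union>A" for a n u
    using assms(2) that unfolding va_submodule_def by blast
qed

text \<open>Zorn's lemma applies because the union of a chain of submodules avoiding u avoids u; the
  zero submodule bounds the empty chain.\<close>

lemma maximal_submodule_avoiding:
  assumes M: "va_module V M" and u: "u \<noteq> 0"
  obtains N where "va_submodule V M N" "u \<notin> N"
    "\<And>P. va_submodule V M P \<Longrightarrow> N \<subseteq> P \<Longrightarrow> u \<notin> P \<Longrightarrow> P = N"
proof -
  let ?A = "{N. va_submodule V M N \<and> u \<notin> N}"
  have "\<exists>N\<in>?A. \<forall>P\<in>?A. N \<subseteq> P \<longrightarrow> P = N"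
  proof (rule subset_Zorn)
    fix C assume C: "subset.chain ?A C"
    have mem: "\<And>N. N \<in> C \<Longrightarrow> va_submodule V M N \<and> u \<notin> N"
      and tot: "\<And>N P. N \<in> C \<Longrightarrow> P \<in> C \<Longrightarrow> N \<subseteq> P \<or> P \<subseteq> N"
      using C unfolding subset.chain_def by blast+
    show "\<exists>U\<in>?A. \<forall>X\<in>C. X \<subseteq> U"
    proof (cases "C = {}")
      case True
      then show ?thesis using va_submodule_zero[OF M] u by blast
    next
      case False
      have "va_submodule V M (\<Union>C)" by (rule va_submodule_Union_chain[OF False]) (use mem tot in blast)+
      then show ?thesis using mem by (intro bexI[of _ "\<Union>C"]) auto
    qed
  qed
  then obtain N where N: "N \<in> ?A" "\<forall>P\<in>?A. N \<subseteq> P \<longrightarrow> P = N" by (elim bexE)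
  show thesis by (rule that[of N]) (use N in blast)+
qed

text \<open>A simple subquotient: modulo a submodule that is maximal among those not containing \<open>u\<close>, the
  submodule generated by \<open>u\<close> is contained in every nonzero submodule.\<close>

lemma simple_subquotient:
  assumes M: "M \<in> Ob" and nz: "mcarrier M \<noteq> {0}"
  obtains Q g P where "Q \<in> Ob" "va_hom V M Q g" "g ` mcarrier M = mcarrier Q" "P \<subseteq> mcarrier Q"
    "simple_object V Ob (Q\<lparr>mcarrier := P\<rparr>)"
proof -
  note Mm = Ob_va_module[OF M]
  have Msub: "cvec.subspace (mcarrier M)" by (rule mcarrier_subspace[OF Mm])
  obtain u where u: "u \<in> mcarrier M" "u \<noteq> 0" using nz cvec.subspace_0[OF Msub] by blast
  obtain N where N: "va_submodule V M N" "u \<notin> N"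
    and max: "\<And>P. va_submodule V M P \<Longrightarrow> N \<subseteq> P \<Longrightarrow> u \<notin> P \<Longrightarrow> P = N"
    by (rule maximal_submodule_avoiding[OF Mm u(2)]) (rule that)
  obtain Q g where Q: "va_module V Q" and g: "va_hom V M Q g" "g ` mcarrier M = mcarrier Q"
    "{u \<in> mcarrier M. g u = 0} = N"
    by (rule va_module_quotient[OF vertex_algebra Mm N(1)]) (rule that)
  have Q_Ob: "Q \<in> Ob" by (rule Ob_quotient[OF M Q g(1,2)])
  have gu: "g u \<in> mcarrier Q" "g u \<noteq> 0" using u(1) N(2) g(2,3) by blast+
  \<comment> \<open>The preimage of R contains N. If it missed u it would equal N, and R would be
    zero.\<close>
  have contains: "g u \<in> R" if R: "va_submodule V Q R" "R \<noteq> {0}" for R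
  proof (rule ccontr)
    assume "g u \<notin> R"
    let ?pre = "{v \<in> mcarrier M. g v \<in> R}"
    have R0: "0 \<in> R" "R \<subseteq> mcarrier Q" using R(1) by (auto simp: va_submodule_def cvec.subspace_0)
    have "?pre = N"
    proof (rule max)
      show "va_submodule V M ?pre" by (rule va_hom_vimage[OF Mm g(1) R(1)])
      show "N \<subseteq> ?pre" using g(3) R0(1) by auto
      show "u \<notin> ?pre" using \<open>g u \<notin> R\<close> by simp
    qed
    have "R \<subseteq> {0}"
    proof
      fix r assume r: "r \<in> R"
      then obtain v where v: "v \<in> mcarrier M" "r = g v" using R0(2) g(2) by blast
      then have "v \<in> N" using r \<open>?pre = N\<close> by blast
      then show "r \<in> {0}" using v(2) g(3) by blast
    qed
    then show False using R(2) R0(1) by blast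
  qed
  define A where "A = {R. va_submodule V Q R \<and> g u \<in> R}"
  define P where "P = \<Inter>A"
  have A: "mcarrier Q \<in> A" using va_submodule_self[OF Q] gu by (simp add: A_def)
  have P: "va_submodule V Q P"
    unfolding P_def by (rule va_submodule_Inter) (use A in \<open>auto simp: A_def\<close>)
  have PQ: "P \<subseteq> mcarrier Q" using P by (simp add: va_submodule_def)
  have gP: "g u \<in> P" by (simp add: P_def A_def)
  have "simple_object V Ob (Q\<lparr>mcarrier := P\<rparr>)"
    unfolding simple_object_def
  proof (intro conjI allI impI)
    show "Q\<lparr>mcarrier := P\<rparr> \<in> Ob" by (rule Ob_submodule[OF Q_Ob P])
    show "mcarrier (Q\<lparr>mcarrier := P\<rparr>) \<noteq> {0}" using gP gu(2) by auto
    fix R assume "va_submodule V (Q\<lparr>mcarrier := P\<rparr>) R \<and> Q\<lparr>mcarrier := P\<rparr>\<lparr>mcarrier := R\<rparr> \<in> Ob"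
    then have R: "va_submodule V (Q\<lparr>mcarrier := P\<rparr>) R" by simp
    then have RQ: "va_submodule V Q R" by (rule va_submodule_mcarrier[OF PQ])
    have RP: "R \<subseteq> P" using R by (simp add: va_submodule_def)
    show "R = {0} \<or> R = mcarrier (Q\<lparr>mcarrier := P\<rparr>)"
    proof (cases "R = {0}")
      case False
      then have "R \<in> A" using contains[OF RQ] RQ by (simp add: A_def)
      then have "P \<subseteq> R" unfolding P_def by blast
      then show ?thesis using RP by simp
    qed simp
  qed
  then show thesis using that Q_Ob g(1,2) PQ by blast
qed

end

section \<open>The simple classes form a basis\<close>

locale finite_linkage_category = linkage_category l V J
  for l and V :: "'v valg" and J +
  fixes L :: "nat \<Rightarrow> ('v, 'b) vmod" and wt :: "nat \<Rightarrow> weight"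
  assumes nondeg: "-1 + dual_coxeter l \<noteq> 0"
    and L_hw: "i \<le> l \<Longrightarrow> is_simple_hw_module l (-1) V J (L i) (wt i)"
    and L_simple: "i \<le> l \<Longrightarrow> simple_object V Ob (L i)"
    and L_all: "simple_object V Ob M \<Longrightarrow> \<exists>i\<le>l. va_isomorphic V M (L i)"
    and wt_hdual: "i \<le> l \<Longrightarrow> wt i \<in> hdual l"
    and wt_inj: "inj_on wt {..l}"
begin

lemma L_Ob: "i \<le> l \<Longrightarrow> L i \<in> Ob"
  using L_simple by (simp add: simple_object_def)

lemma L_hw_module: "i \<le> l \<Longrightarrow> hw_module l (-1) V J (L i) (wt i)"
  using affine_va nondeg L_hw Ob_va_module[OF L_Ob] by unfold_locales

lemma L_gws_nonzero: "i \<le> l \<Longrightarrow> gws (L i) (wt i) \<noteq> {0}"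
  using hw_module.hwv_in_gws[OF L_hw_module] hw_module.hwv_nonzero[OF L_hw_module] by blast

text \<open>Grading values are complex, but those compared differ by integers; real parts turn this
  into a linear order with maxima.\<close>

definition height :: "nat \<Rightarrow> real" where
  "height i = Re (hh_value l (wt i))"

lemma L_gdim_triangular:
  assumes "i \<le> l" "j \<le> l" "gdim (L j) (wt i) \<noteq> 0"
  shows "i = j \<or> height i < height j"
proof -
  have "gws (L j) (wt i) \<noteq> {0}" using gdim_zero[of "L j" "wt i"] assms(3) by auto
  then have "wt i = wt j \<or> hh_value l (wt i) \<in>
      {hh_value l (wt j) - of_nat n | n. n \<ge> (1::nat)}"
    using hw_module.weights_below[OF L_hw_module[OF assms(2)] wt_hdual[OF assms(2)] wt_hdual[OF assms(1)]]
    unfolding hw_module.low_values_def[OF L_hw_module[OF assms(2)]] by blast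
  then show ?thesis
  proof
    assume "wt i = wt j"
    then show ?thesis using inj_onD[OF wt_inj] assms by simp
  next
    assume "hh_value l (wt i) \<in>
      {hh_value l (wt j) - of_nat n | n. n \<ge> (1::nat)}"
    then obtain n :: nat where n: "n \<ge> 1"
      "hh_value l (wt i) = hh_value l (wt j) - of_nat n"
      by blast
    then have "height i = height j - of_nat n" unfolding height_def n(2) by simp
    then show ?thesis using n(1) by simp
  qed
qed

text \<open>Among the indices with nonzero coefficient one of maximal height is taken. In the
  equation at its weight all other terms vanish, ties included, since triangularity is
  strict.\<close>

lemma L_independent:
  fixes a :: "nat \<Rightarrow> int"
  assumes "\<And>i. i \<le> l \<Longrightarrow> (\<Sum>j\<le>l. a j * int (gdim (L j) (wt i))) = 0"
  shows "\<forall>j\<le>l. a j = 0"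
proof (rule ccontr)
  assume "\<not> (\<forall>j\<le>l. a j = 0)"
  then have B: "finite {j. j \<le> l \<and> a j \<noteq> 0}" "{j. j \<le> l \<and> a j \<noteq> 0} \<noteq> {}" by auto
  have "Max (height ` {j. j \<le> l \<and> a j \<noteq> 0}) \<in> height ` {j. j \<le> l \<and> a j \<noteq> 0}"
    using B by (intro Max_in) simp_all
  then obtain i where i: "i \<le> l" "a i \<noteq> 0" "Max (height ` {j. j \<le> l \<and> a j \<noteq> 0}) = height i" by blast
  have max: "height j \<le> height i" if "j \<le> l" "a j \<noteq> 0" for j
    unfolding i(3)[symmetric] using B(1) that by (intro Max_ge) simp_all
  have "(\<Sum>j\<le>l. a j * int (gdim (L j) (wt i))) = (\<Sum>j\<in>{i}. a j * int (gdim (L j) (wt i)))"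
  proof (rule sum.mono_neutral_right)
    show "\<forall>j\<in>{..l} - {i}. a j * int (gdim (L j) (wt i)) = 0"
    proof
      fix j assume j: "j \<in> {..l} - {i}"
      show "a j * int (gdim (L j) (wt i)) = 0"
      proof (rule ccontr)
        assume "a j * int (gdim (L j) (wt i)) \<noteq> 0"
        then have "a j \<noteq> 0" "gdim (L j) (wt i) \<noteq> 0" by auto
        then show False using L_gdim_triangular[OF i(1), of j] max[of j] j by auto
      qed
    qed
  qed (use i in auto)
  then have "a i * int (gdim (L i) (wt i)) = 0" using assms[OF i(1)] by simp
  then show False
    using i gdim_pos[OF L_Ob[OF i(1)] wt_hdual[OF i(1)] L_gws_nonzero[OF i(1)]] by simp
qed

text \<open>An additive bound for the length: every nonzero object has some \<open>L i\<close> as a subquotient.\<close>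

definition mult_bound :: "('v, 'b) vmod \<Rightarrow> nat" where
  "mult_bound M = (\<Sum>i\<le>l. gdim M (wt i))"

text \<open>A simple subquotient is isomorphic to some \<open>L i\<close>; a nonzero vector of
  generalised weight \<open>wt i\<close> in it lifts to M along the quotient map.\<close>

lemma mult_bound_pos:
  assumes M: "M \<in> Ob" and nz: "mcarrier M \<noteq> {0}"
  shows "mult_bound M > 0"
proof -
  obtain Q g P where Q: "Q \<in> Ob" and g: "va_hom V M Q g" "g ` mcarrier M = mcarrier Q" and P: "P \<subseteq> mcarrier Q"
    and simple: "simple_object V Ob (Q\<lparr>mcarrier := P\<rparr>)"
    by (rule simple_subquotient[OF M nz]) (rule that)
  have P_Ob: "Q\<lparr>mcarrier := P\<rparr> \<in> Ob" using simple by (simp add: simple_object_def)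
  obtain i where i: "i \<le> l" "va_isomorphic V (Q\<lparr>mcarrier := P\<rparr>) (L i)" using L_all[OF simple] by blast
  have "gws (Q\<lparr>mcarrier := P\<rparr>) (wt i) \<noteq> {0}"
    by (rule isomorphic_gws_nonzero[OF P_Ob L_Ob[OF i(1)] i(2) wt_hdual[OF i(1)] L_gws_nonzero[OF i(1)]])
  then obtain v where "v \<in> gws Q (wt i)" "v \<noteq> 0"
    using cvec.subspace_0[OF gws_subspace[OF Ob_va_module[OF P_Ob]]] unfolding gws_submodule[OF P] by blast
  then obtain v' where v': "v' \<in> gws M (wt i)" "v = g v'"
    using gws_hom_image[OF Ob_va_module[OF M] Ob_va_module[OF Q] g Ob_decomposable[OF M] wt_hdual[OF i(1)]] by blast
  have "g 0 = 0" by (rule va_hom_0[OF Ob_va_module[OF M] g(1)])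
  have "gws M (wt i) \<noteq> {0}"
  proof
    assume "gws M (wt i) = {0}"
    then have "v' = 0" using v'(1) by simp
    then show False using v'(2) \<open>v \<noteq> 0\<close> \<open>g 0 = 0\<close> by simp
  qed
  then have "gdim M (wt i) > 0" by (rule gdim_pos[OF M wt_hdual[OF i(1)]])
  then show ?thesis unfolding mult_bound_def using i(1) by (intro sum_pos2[of _ i]) auto
qed

lemma K0_generated:
  assumes "M \<in> Ob"
  shows "\<exists>e. Poly_Mapping.keys e \<subseteq> {..l} \<and> frag_of M - frag_extend (frag_of \<circ> L) e \<in> K0_relations V Ob"
  using assms
proof (induction "mult_bound M" arbitrary: M rule: less_induct)
  case less
  note M = less.prems
  note Mm = Ob_va_module[OF M]
  let ?X = "frag_extend (frag_of \<circ> L)"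
  consider "mcarrier M = {0}" | "simple_object V Ob M"
    | N where "va_submodule V M N" "N \<noteq> {0}" "N \<noteq> mcarrier M"
    using M unfolding simple_object_def by blast
  then show ?case
  proof cases
    case 1
    \<comment> \<open>M is its own zero submodule, as replacing its carrier by the same set changes
      nothing.\<close>
    then have "M\<lparr>mcarrier := {0}\<rparr> = M" by (metis vmod.surjective vmod.update_convs(1))
    then show ?thesis using zero_module_relation[OF M] by (intro exI[of _ 0]) simp
  next
    case 2
    then obtain i where i: "i \<le> l" "va_isomorphic V M (L i)" using L_all by blast
    then show ?thesis
      using isomorphic_relation[OF M L_Ob[OF i(1)] i(2)] by (intro exI[of _ "frag_of i"]) simp
  next
    case 3
    obtain Q g where Q: "va_module V Q" and g: "va_hom V M Q g" "g ` mcarrier M = mcarrier Q"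
      "{u \<in> mcarrier M. g u = 0} = N"
      by (rule va_module_quotient[OF vertex_algebra Mm 3(1)]) (rule that)
    let ?N = "M\<lparr>mcarrier := N\<rparr>"
    have N_Ob: "?N \<in> Ob" by (rule Ob_submodule[OF M 3(1)])
    have Q_Ob: "Q \<in> Ob" by (rule Ob_quotient[OF M Q g(1,2)])
    have ex: "short_exact V ?N M Q" by (rule short_exact_quotient[OF g])
    have "mcarrier Q \<noteq> {0}"
    proof
      assume "mcarrier Q = {0}"
      then have "mcarrier M \<subseteq> N" using g(2,3) by blast
      then show False using 3(1,3) by (auto simp: va_submodule_def)
    qed
    then have pos: "mult_bound Q > 0" "mult_bound ?N > 0"
      using mult_bound_pos[OF Q_Ob] mult_bound_pos[OF N_Ob] 3(2) by simp_all
    have "mult_bound M = mult_bound ?N + mult_bound Q"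
      unfolding mult_bound_def sum.distrib[symmetric]
      by (intro sum.cong refl gdim_additive[OF N_Ob M Q_Ob ex wt_hdual]) simp
    then have less': "mult_bound ?N < mult_bound M" "mult_bound Q < mult_bound M" using pos by simp_all
    obtain e where e: "Poly_Mapping.keys e \<subseteq> {..l}" "frag_of ?N - ?X e \<in> K0_relations V Ob"
      using less.hyps[OF less'(1) N_Ob] by blast
    obtain e' where e': "Poly_Mapping.keys e' \<subseteq> {..l}" "frag_of Q - ?X e' \<in> K0_relations V Ob"
      using less.hyps[OF less'(2) Q_Ob] by blast
    have eq: "frag_of M - ?X (e + e') =
        (frag_of M - frag_of ?N - frag_of Q) + ((frag_of ?N - ?X e) + (frag_of Q - ?X e'))"
      by (simp add: frag_extend_add)
    have "frag_of M - ?X (e + e') \<in> K0_relations V Ob"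
      unfolding eq by (intro K0_relations_add K0_relations_exact[OF N_Ob M Q_Ob ex] e(2) e'(2))
    moreover have "Poly_Mapping.keys (e + e') \<subseteq> {..l}"
      using Poly_Mapping.keys_add[of e e'] e(1) e'(1) by blast
    ultimately show ?thesis by blast
  qed
qed

text \<open>Each dimension function vanishes on relations, so the coefficients of e solve the
  triangular system of \<open>L_independent\<close>.\<close>

lemma K0_independent:
  assumes e: "Poly_Mapping.keys e \<subseteq> {..l}" and rel: "frag_extend (frag_of \<circ> L) e \<in> K0_relations V Ob"
  shows "e = 0"
proof -
  have eval: "frag_extend (\<lambda>M. frag_cmul (f M) (frag_of ())) (frag_extend (frag_of \<circ> L) e) =
      frag_cmul (\<Sum>j\<le>l. Poly_Mapping.lookup e j * f (L j)) (frag_of ())" for f :: "('v, 'b) vmod \<Rightarrow> int"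
    using e
  proof (induction e rule: frag_induction)
    case (one j)
    have "(\<Sum>i\<le>l. Poly_Mapping.lookup (frag_of j) i * f (L i)) = (\<Sum>i\<le>l. if i = j then f (L j) else 0)"
      by (intro sum.cong) (auto simp: lookup_single when_def)
    then show ?case using one by simp
  next
    case (diff a b)
    then show ?case
      by (simp add: frag_extend_diff frag_cmul_diff_distrib lookup_minus left_diff_distrib sum_subtractf)
  qed simp
  have "(\<Sum>j\<le>l. Poly_Mapping.lookup e j * int (gdim (L j) (wt i))) = 0" if i: "i \<le> l" for i
  proof -
    have "frag_extend (\<lambda>M. frag_cmul (int (gdim M (wt i))) (frag_of ())) (frag_extend (frag_of \<circ> L) e) = 0"
      by (rule additive_vanishes_on_K0_relations[OF _ rel]) (simp add: gdim_additive[OF _ _ _ _ wt_hdual[OF i]])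
    then show ?thesis unfolding eval by simp
  qed
  then have zero: "\<forall>j\<le>l. Poly_Mapping.lookup e j = 0" by (rule L_independent)
  show ?thesis
  proof (rule poly_mapping_eqI)
    fix j show "Poly_Mapping.lookup e j = Poly_Mapping.lookup 0 j"
      using zero e by (cases "j \<le> l") (auto simp: in_keys_iff)
  qed
qed

lemma K0_free:
  "\<exists>\<phi>\<in>iso (free_Abelian_group {..l}) (K0 V Ob). \<forall>i\<le>l. \<phi> (frag_of i) = K0_class V Ob (L i)"
  using K0_free_basis[of "{..l}" L Ob V, OF L_Ob K0_generated K0_independent] by auto

end

theorem corollary5p4:
  fixes l :: nat
    and V :: "'v valg"
    and J :: "complex mat \<Rightarrow> 'v cvec"
    and w z :: "nat \<Rightarrow> weight \<Rightarrow> weight"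
    and L :: "nat \<Rightarrow> ('v, 'b) vmod"
  assumes "l \<ge> 5"
    and "simple_affine_va l (-1) V J"
    and "bij_betw w {..l} (left_cell l (srefl l 0))"
    and "w 0 = srefl l 0"
    and "\<forall>i\<in>{1..l}. z i \<in> W_fin l \<and> w i = z i \<circ> srefl l 0"
    and "\<forall>i\<le>l. is_simple_hw_module l (-1) V J (L i) (dot l (w i) (- Lambda0))"
    and "\<forall>i\<le>l. simple_object V (cat_C l V J) (L i)"
    and "\<forall>M. simple_object V (cat_C l V J) M \<longrightarrow> (\<exists>i\<le>l. va_isomorphic V M (L i))"
  shows "\<exists>\<phi> \<in> iso (free_Abelian_group {..l}) (K0 V (cat_C l V J)).
           \<forall>i\<le>l. \<phi> (frag_of i) = K0_class V (cat_C l V J) (L i)"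
proof -
  have l: "l \<ge> 2" using assms(1) by simp
  \<comment> \<open>With the identity at index 0, every \<open>w i\<close> has the same shape: a
    finite element after the affine reflection.\<close>
  define y where "y i = (if i = 0 then id else z i)" for i
  have y: "y i \<in> W_fin l" "w i = y i \<circ> srefl l 0" if "i \<le> l" for i
    using assms(4,5) that id_in_W_fin[of l] by (cases "i = 0"; simp add: y_def)+
  \<comment> \<open>The sum is 2l - 3, which is odd.\<close>
  have "-1 + dual_coxeter l \<noteq> 0"
  proof
    assume "-1 + dual_coxeter l = 0"
    then have "of_nat (2 * l) = (of_nat 3 :: complex)" by (simp add: dual_coxeter_def algebra_simps)
    then have "2 * l = 3" by (simp only: of_nat_eq_iff)
    then show False using assms(1) by simp
  qed
  \<comment> \<open>Equal weights force equal finite parts and hence equal cell elements; these are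
    distinct because w enumerates the cell bijectively.\<close>
  moreover have "inj_on (\<lambda>i. dot l (w i) (- Lambda0)) {..l}"
  proof (rule inj_onI)
    fix i j assume ij: "i \<in> {..l}" "j \<in> {..l}" and eq: "dot l (w i) (- Lambda0) = dot l (w j) (- Lambda0)"
    then have "y i = y j" using y[of i] y[of j] by (intro dot_vac_inject[OF l]) simp_all
    then have "w i = w j" using y ij by simp
    then show "i = j" using bij_betw_imp_inj_on[OF assms(3)] ij by (simp add: inj_on_def)
  qed
  moreover have "dot l (w i) (- Lambda0) \<in> hdual l" if "i \<le> l" for i
    using dot_vac_hdual[OF l y(1)[OF that]] y(2)[OF that] by simp
  ultimately interpret finite_linkage_category l V J L "\<lambda>i. dot l (w i) (- Lambda0)"
    using assms(2,6-8) l by unfold_locales auto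
  show ?thesis by (rule K0_free)
qed

end
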